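(* Suppose that $\overline H=(H_0,H_1)$ is a Hilbert space compatible pair. (i) If $\theta_0,\theta_1\in[0,1]$ and, for $j=0,1$, $\mathcal H_j:=(H_0,H_1)_{\theta_j,2}$ if $0<\theta_j<1$, while $\mathcal H_j:=H_{\theta_j}$ if $\theta_j\in\{0,1\}$, then $(\mathcal H_0,\mathcal H_1)_{\eta,2}=(H_0,H_1)_{\theta,2}$, with equal norms, for $\theta=(1-\eta)\theta_0+\eta\theta_1$ and $0<\eta<1$. (ii) If $\Delta(\overline H)$ is dense in $H_0$ and $H_1$, so that $\overline H^*:=(H_0^*,H_1^* )$ is a Hilbert space compatible pair, then $$(H_0,H_1)_{\theta,2}^*=(H_0^*,H_1^* )_{\theta,2},$$ for $0<\theta<1$, with equality of norms.
   Context: All spaces are complex. A Hilbert space compatible pair $\overline H=(H_0,H_1)$ consists of Hilbert spaces $H_0,H_1$ that are linear subspaces of a larger vector space $V$, such that $\Delta(\overline H):=H_0\cap H_1$ with norm $\max\{\|\phi\|_{H_0},\|\phi\|_{H_1}\}$ and $\Sigma(\overline H):=H_0+H_1$ with norm $\|\phi\|_{\Sigma(\overline H)}=\inf\{\|\phi_0\|_{H_0}+\|\phi_1\|_{H_1}:\phi_j\in H_j,\ \phi_0+\phi_1=\phi\}$ are Banach spaces. No separability is assumed. For $t>0$, $\phi\in\Sigma(\overline H)$, let $K(t,\phi):=\inf\{(\|\phi_0\|_{H_0}^2+t^2\|\phi_1\|_{H_1}^2)^{1/2}:\phi_j\in H_j,\ \phi_0+\phi_1=\phi\}$. For $0<\theta<1$,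 $(H_0,H_1)_{\theta,2}=K_{\theta,2}(\overline H)$ is the Hilbert space of $\phi\in\Sigma(\overline H)$ for which the norm $\|\phi\|_{K_{\theta,2}(\overline H)}:=N_{\theta,2}\left(\int_0^\infty |t^{-\theta}K(t,\phi)|^2\,\frac{dt}{t}\right)^{1/2}$ is finite, where $N_{\theta,2}:=\big((2/\pi)\sin(\pi\theta)\big)^{1/2}$. By convention $(H_0,H_1)_{0,2}:=H_0$ and $(H_0,H_1)_{1,2}:=H_1$ (needed in (i) only if $\theta_0=\theta_1\in\{0,1\}$). $X^*$ denotes the dual of $X$. In (ii), when $\Delta(\overline H)$ is dense in $H_0$ and $H_1$ (hence also dense in $(H_0,H_1)_{\theta,2}$), the spaces $H_0^*$, $H_1^*$ and $(H_0,H_1)_{\theta,2}^*$ are regarded as linear subspaces of $\Delta(\overline H)^*$ by mapping a functional to its restriction to $\Delta(\overline H)$ (this mapping is injective by density). *)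

theory Defs
  imports "HOL-Analysis.Analysis" "HOL-Library.Function_Algebras"
begin

text \<open>
  The ambient complex vector space is a type \<open>'v :: ab_group_add\<close> with a scalar
  multiplication \<open>s\<close> satisfying \<open>vector_space s\<close>. A normed space inside it is a
  carrier with a norm; the values of the norm off the carrier are never used.
\<close>

record 'v nspace =
  carr :: "'v set"
  nrm :: "'v \<Rightarrow> real"

definition space_eq :: "'v nspace \<Rightarrow> 'v nspace \<Rightarrow> bool" where
  "space_eq X Y \<longleftrightarrow> carr X = carr Y \<and> (\<forall>x\<in>carr X. nrm X x = nrm Y x)"

text \<open>The value 0 off the carrier is there only because \<open>Metric_space\<close> demands
  symmetry and nonnegativity on the whole type.\<close>

definition ndist :: "'v::ab_group_add nspace \<Rightarrow> 'v \<Rightarrow> 'v \<Rightarrow> real" where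
  "ndist X x y = (if x \<in> carr X \<and> y \<in> carr X then nrm X (x - y) else 0)"

definition normed_space :: "(complex \<Rightarrow> 'v \<Rightarrow> 'v) \<Rightarrow> 'v::ab_group_add nspace \<Rightarrow> bool" where
  "normed_space s X \<longleftrightarrow>
     module.subspace s (carr X) \<and>
     (\<forall>x\<in>carr X. 0 \<le> nrm X x \<and> (nrm X x = 0 \<longleftrightarrow> x = 0)) \<and>
     (\<forall>c. \<forall>x\<in>carr X. nrm X (s c x) = cmod c * nrm X x) \<and>
     (\<forall>x\<in>carr X. \<forall>y\<in>carr X. nrm X (x + y) \<le> nrm X x + nrm X y)"

definition banach_space :: "(complex \<Rightarrow> 'v \<Rightarrow> 'v) \<Rightarrow> 'v::ab_group_add nspace \<Rightarrow> bool" where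
  "banach_space s X \<longleftrightarrow> normed_space s X \<and> Metric_space.mcomplete (carr X) (ndist X)"

text \<open>The inner product is not stored: by polarization the norm determines it.\<close>

definition hilbert_space :: "(complex \<Rightarrow> 'v \<Rightarrow> 'v) \<Rightarrow> 'v::ab_group_add nspace \<Rightarrow> bool" where
  "hilbert_space s X \<longleftrightarrow> banach_space s X \<and>
     (\<exists>ip :: 'v \<Rightarrow> 'v \<Rightarrow> complex.
        (\<forall>x\<in>carr X. \<forall>y\<in>carr X. \<forall>z\<in>carr X. ip (x + y) z = ip x z + ip y z) \<and>
        (\<forall>c. \<forall>x\<in>carr X. \<forall>y\<in>carr X. ip (s c x) y = c * ip x y) \<and>
        (\<forall>x\<in>carr X. \<forall>y\<in>carr X. ip y x = cnj (ip x y)) \<and>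
        (\<forall>x\<in>carr X. ip x x = complex_of_real ((nrm X x)\<^sup>2)))"

definition dense_in :: "'v set \<Rightarrow> 'v::ab_group_add nspace \<Rightarrow> bool" where
  "dense_in D X \<longleftrightarrow>
     D \<subseteq> carr X \<and> Metric_space.mtopology (carr X) (ndist X) closure_of D = carr X"

definition Delta_space :: "'v nspace \<Rightarrow> 'v nspace \<Rightarrow> 'v nspace" where
  "Delta_space X Y = \<lparr>carr = carr X \<inter> carr Y, nrm = (\<lambda>x. max (nrm X x) (nrm Y x))\<rparr>"

definition Sigma_space :: "'v::ab_group_add nspace \<Rightarrow> 'v nspace \<Rightarrow> 'v nspace" where
  "Sigma_space X Y =
     \<lparr>carr = {x + y | x y. x \<in> carr X \<and> y \<in> carr Y},
      nrm = (\<lambda>z. Inf {nrm X x + nrm Y y | x y. x \<in> carr X \<and> y \<in> carr Y \<and> x + y = z})\<rparr>"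

definition hilbert_compatible_pair ::
    "(complex \<Rightarrow> 'v \<Rightarrow> 'v) \<Rightarrow> 'v::ab_group_add nspace \<Rightarrow> 'v nspace \<Rightarrow> bool" where
  "hilbert_compatible_pair s X Y \<longleftrightarrow>
     vector_space s \<and> hilbert_space s X \<and> hilbert_space s Y \<and>
     banach_space s (Delta_space X Y) \<and> banach_space s (Sigma_space X Y)"

definition K_functional :: "'v::ab_group_add nspace \<Rightarrow> 'v nspace \<Rightarrow> real \<Rightarrow> 'v \<Rightarrow> real" where
  "K_functional X Y t z =
     Inf {sqrt ((nrm X x)\<^sup>2 + t\<^sup>2 * (nrm Y y)\<^sup>2) | x y. x \<in> carr X \<and> y \<in> carr Y \<and> x + y = z}"

definition K_integral :: "'v::ab_group_add nspace \<Rightarrow> 'v nspace \<Rightarrow> real \<Rightarrow> 'v \<Rightarrow> ennreal" where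
  "K_integral X Y \<theta> z =
     (\<integral>\<^sup>+t\<in>{0<..}. ennreal (\<bar>t powr (- \<theta>) * K_functional X Y t z\<bar>\<^sup>2 / t) \<partial>lborel)"

definition N_const :: "real \<Rightarrow> real" where
  "N_const \<theta> = sqrt (2 / pi * sin (pi * \<theta>))"

definition K_space :: "'v::ab_group_add nspace \<Rightarrow> 'v nspace \<Rightarrow> real \<Rightarrow> 'v nspace" where
  "K_space X Y \<theta> =
     \<lparr>carr = {z \<in> carr (Sigma_space X Y). K_integral X Y \<theta> z < \<infinity>},
      nrm = (\<lambda>z. N_const \<theta> * sqrt (enn2real (K_integral X Y \<theta> z)))\<rparr>"

definition interp :: "'v::ab_group_add nspace \<Rightarrow> 'v nspace \<Rightarrow> real \<Rightarrow> 'v nspace" where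
  "interp X Y \<theta> = (if \<theta> = 0 then X else if \<theta> = 1 then Y else K_space X Y \<theta>)"

text \<open>A functional on a subspace \<open>D\<close> of \<open>'v\<close> is represented by the function on \<open>'v\<close>
  that vanishes off \<open>D\<close>. The ambient vector space of all functionals is
  \<open>'v \<Rightarrow> complex\<close> with pointwise operations.\<close>

definition fun_scale :: "complex \<Rightarrow> ('v \<Rightarrow> complex) \<Rightarrow> 'v \<Rightarrow> complex" where
  "fun_scale c f = (\<lambda>x. c * f x)"

definition dual_space ::
    "(complex \<Rightarrow> 'v \<Rightarrow> 'v) \<Rightarrow> 'v::ab_group_add nspace \<Rightarrow> ('v \<Rightarrow> complex) nspace" where
  "dual_space s X =
     \<lparr>carr = {f. (\<forall>x. x \<notin> carr X \<longrightarrow> f x = 0) \<and>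
                 (\<forall>x\<in>carr X. \<forall>y\<in>carr X. f (x + y) = f x + f y) \<and>
                 (\<forall>c. \<forall>x\<in>carr X. f (s c x) = c * f x) \<and>
                 (\<exists>B. \<forall>x\<in>carr X. cmod (f x) \<le> B * nrm X x)},
      nrm = (\<lambda>f. Sup {cmod (f x) | x. x \<in> carr X \<and> nrm X x \<le> 1})\<rparr>"

definition restr :: "'v set \<Rightarrow> ('v \<Rightarrow> complex) \<Rightarrow> 'v \<Rightarrow> complex" where
  "restr D f = (\<lambda>x. if x \<in> D then f x else 0)"

text \<open>The dual of \<open>X\<close>, transported to a space of functionals on \<open>D\<close> by restriction.
  A restricted functional keeps the norm of the functional on \<open>X\<close> it comes from, which
  is unique when \<open>D\<close> is dense in \<open>X\<close>.\<close>

definition dual_on ::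
    "(complex \<Rightarrow> 'v \<Rightarrow> 'v) \<Rightarrow> 'v set \<Rightarrow> 'v::ab_group_add nspace \<Rightarrow> ('v \<Rightarrow> complex) nspace" where
  "dual_on s D X =
     \<lparr>carr = restr D ` carr (dual_space s X),
      nrm = (\<lambda>g. nrm (dual_space s X) (inv_into (carr (dual_space s X)) (restr D) g))\<rparr>"

lemma Metric_space_ndist:
  assumes "vector_space s" and X: "normed_space s X"
  shows "Metric_space (carr X) (ndist X)"
proof -
  interpret vector_space s by fact
  have sub: "subspace (carr X)" using X by (simp add: normed_space_def)
  note diff = subspace_diff[OF sub]
  have neg: "nrm X (- x) = nrm X x" if "x \<in> carr X" for x
  proof -
    have "nrm X (s (- 1) x) = cmod (- 1) * nrm X x"
      using X that unfolding normed_space_def by blast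
    also have "s (- 1) x = - x" by (metis scale_minus_left scale_one)
    finally show ?thesis by simp
  qed
  have pos: "0 \<le> nrm X x" "nrm X x = 0 \<longleftrightarrow> x = 0" if "x \<in> carr X" for x
    using X that unfolding normed_space_def by blast+
  have tri: "nrm X (x + y) \<le> nrm X x + nrm X y" if "x \<in> carr X" "y \<in> carr X" for x y
    using X that unfolding normed_space_def by blast
  show ?thesis
  proof
    show "0 \<le> ndist X x y" for x y
      unfolding ndist_def using pos(1) diff by simp
    show "ndist X x y = ndist X y x" for x y
      unfolding ndist_def using neg[OF diff, of x y] by auto
    show "ndist X x y = 0 \<longleftrightarrow> x = y" if "x \<in> carr X" "y \<in> carr X" for x y
      unfolding ndist_def using that pos(2)[OF diff[OF that]] by simp
    show "ndist X x z \<le> ndist X x y + ndist X y z"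
      if "x \<in> carr X" "y \<in> carr X" "z \<in> carr X" for x y z
      unfolding ndist_def
      using that tri[OF diff[OF that(1,2)] diff[OF that(2,3)]] by simp
  qed
qed

end

theory Submission
  imports Defs
begin

text \<open>
  The usual proof diagonalizes the pair by the spectral theorem. Here approximation from
  finite-dimensional subspaces of \<open>\<Delta> = H\<^sub>0 \<inter> H\<^sub>1\<close> takes its place. On the span of a finite
  \<open>B \<subseteq> \<Delta>\<close> the two inner products are simultaneously diagonal, and the integral
  \<open>\<integral> t\<^bsup>-2\<theta>-1\<^esup> t\<^sup>2ab / (a + t\<^sup>2b) dt = (a\<^bsup>1-\<theta>\<^esup>b\<^bsup>\<theta>\<^esup> / 2) B(1 - \<theta>, \<theta>)\<close> shows that interpolation
  replaces the weights \<open>a, b\<close> by \<open>a\<^bsup>1-\<theta>\<^esup>b\<^bsup>\<theta>\<^esup>\<close>, so reiteration and duality are algebra there.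
  The norm of \<open>\<phi> \<in> \<Delta>\<close> in the full space is the infimum of its norms over these spans:
  adjoining near-optimal decompositions for countably many \<open>t\<close> yields a sequence of spans whose
  K-functionals converge to the full one at these \<open>t\<close>, hence at all \<open>t\<close> by monotonicity, and
  dominated convergence applies. So the norms agree on \<open>\<Delta>\<close>; as \<open>\<Delta>\<close> is dense and the
  spaces are complete, the spaces coincide.

  For duality, Riesz representation in \<open>\<Delta>\<close> under \<open>\<parallel>x\<parallel>\<^sub>0\<^sup>2 + t\<^sup>-\<^sup>2\<parallel>x\<parallel>\<^sub>1\<^sup>2\<close> identifies the
  K-functional at \<open>t\<close> of a functional \<open>g\<close> with its norm dual to this one, which is the
  supremum of the corresponding norms of \<open>g\<close> on finite spans.
\<close>

section \<open>Normed spaces inside an ambient vector space\<close>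

text \<open>Confining decompositions to a span can only raise a K-functional, so span norms bound
  the full norm from above and decrease as the span grows; one well-chosen span therefore suffices
  for an upper estimate. For \<phi> in the intersection, both parts of any decomposition in the
  original pair lie in the intersection themselves. For a pair of interpolation spaces they need
  not: a part must first be moved into the intersection with control of two norms at once. This is
  why density is proved simultaneously in two interpolation spaces, by cutting off one and the same
  element at large and at small \<open>t\<close>. Such density can fail when both exponents are 0 or
  both are 1, and equal exponents are settled by a direct computation instead. The Hilbert property
  is carried by the parallelogram law, which passes through infima, integrals and suprema where no
  inner product is at hand; the Jordan-von Neumann theorem recovers an inner product when one is
  needed. The normalization \<open>N_const\<close> cancels the Beta value, so no constants survive
  in the interpolated weights.\<close>

locale complex_vs = vector_space s for s :: "complex \<Rightarrow> 'v::ab_group_add \<Rightarrow> 'v"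

locale nvs = complex_vs s for s :: "complex \<Rightarrow> 'v::ab_group_add \<Rightarrow> 'v" +
  fixes X :: "'v nspace"
  assumes normed: "normed_space s X"
begin

lemma sub: "subspace (carr X)" using normed by (simp add: normed_space_def)

lemma in0[simp, intro]: "0 \<in> carr X" using sub by (rule subspace_0)
lemma in_add[intro]: "x \<in> carr X \<Longrightarrow> y \<in> carr X \<Longrightarrow> x + y \<in> carr X"
  using sub by (rule subspace_add)
lemma in_diff[intro]: "x \<in> carr X \<Longrightarrow> y \<in> carr X \<Longrightarrow> x - y \<in> carr X"
  using sub by (rule subspace_diff)
lemma in_scale[intro]: "x \<in> carr X \<Longrightarrow> s c x \<in> carr X"
  using sub by (rule subspace_scale)
lemma in_neg[intro]: "x \<in> carr X \<Longrightarrow> - x \<in> carr X"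
  using sub by (rule subspace_neg)

lemma nrm_ge0: "x \<in> carr X \<Longrightarrow> 0 \<le> nrm X x" using normed by (simp add: normed_space_def)
lemma nrm_eq0: "x \<in> carr X \<Longrightarrow> nrm X x = 0 \<longleftrightarrow> x = 0"
  using normed by (simp add: normed_space_def)
lemma nrm_zero[simp]: "nrm X 0 = 0" using nrm_eq0 by simp
lemma nrm_scale: "x \<in> carr X \<Longrightarrow> nrm X (s c x) = cmod c * nrm X x"
  using normed by (simp add: normed_space_def)
lemma nrm_tri: "x \<in> carr X \<Longrightarrow> y \<in> carr X \<Longrightarrow> nrm X (x + y) \<le> nrm X x + nrm X y"
  using normed by (simp add: normed_space_def)
lemma nrm_neg: "x \<in> carr X \<Longrightarrow> nrm X (- x) = nrm X x"
  using nrm_scale[of x "-1"] by simp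
lemma nrm_commute: "x \<in> carr X \<Longrightarrow> y \<in> carr X \<Longrightarrow> nrm X (x - y) = nrm X (y - x)"
  using nrm_neg[of "x - y"] in_diff by simp
lemma nrm_tri_diff: "x \<in> carr X \<Longrightarrow> y \<in> carr X \<Longrightarrow> nrm X (x - y) \<le> nrm X x + nrm X y"
  using nrm_tri[of x "- y"] nrm_neg[of y] in_neg by simp
lemma nrm_tri3:
  "x \<in> carr X \<Longrightarrow> y \<in> carr X \<Longrightarrow> z \<in> carr X \<Longrightarrow> nrm X (x - z) \<le> nrm X (x - y) + nrm X (y - z)"
  using nrm_tri[of "x - y" "y - z"] in_diff by simp
lemma nrm_rev: "x \<in> carr X \<Longrightarrow> y \<in> carr X \<Longrightarrow> \<bar>nrm X x - nrm X y\<bar> \<le> nrm X (x - y)"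
  using nrm_tri[of "x - y" y] nrm_tri[of "y - x" x] nrm_commute[of x y] in_diff by fastforce

lemma Metric_space: "Metric_space (carr X) (ndist X)"
  by (rule Metric_space_ndist[OF vector_space_axioms normed])

end

text \<open>Convergence and Cauchy sequences are stated through norms of differences, with
  membership included. \<open>mcomplete_iff\<close> and \<open>dense_in_iff\<close> translate the
  metric-space notions once; later arguments use only sequences and
  \<epsilon>-approximation.\<close>

definition conv :: "'v::ab_group_add nspace \<Rightarrow> (nat \<Rightarrow> 'v) \<Rightarrow> 'v \<Rightarrow> bool" where
  "conv X u x \<longleftrightarrow> (\<forall>n. u n \<in> carr X) \<and> x \<in> carr X \<and> (\<lambda>n. nrm X (u n - x)) \<longlonglongrightarrow> 0"

definition cauchy :: "'v::ab_group_add nspace \<Rightarrow> (nat \<Rightarrow> 'v) \<Rightarrow> bool" where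
  "cauchy X u \<longleftrightarrow> (\<forall>n. u n \<in> carr X) \<and> (\<forall>e>0. \<exists>N. \<forall>m\<ge>N. \<forall>n\<ge>N. nrm X (u m - u n) < e)"

context nvs begin

lemma convD: assumes "conv X u x" shows "u n \<in> carr X" "x \<in> carr X"
  using assms by (auto simp: conv_def)

lemma conv_eventually:
  assumes "conv X u x" "e > 0" shows "\<exists>N. \<forall>n\<ge>N. nrm X (u n - x) < e"
proof -
  have "(\<lambda>n. nrm X (u n - x)) \<longlonglongrightarrow> 0" using assms by (simp add: conv_def)
  from LIMSEQ_D[OF this assms(2)] show ?thesis by fastforce
qed

lemma conv_nrm: assumes "conv X u x" shows "(\<lambda>n. nrm X (u n)) \<longlonglongrightarrow> nrm X x"
proof -
  have "(\<lambda>n. nrm X (u n - x)) \<longlonglongrightarrow> 0" using assms by (simp add: conv_def)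
  then have "(\<lambda>n. nrm X (u n) - nrm X x) \<longlonglongrightarrow> 0"
    by (rule Lim_null_comparison[rotated])
      (use convD[OF assms] nrm_rev in \<open>simp add: eventually_sequentially\<close>)
  then show ?thesis by (rule LIM_zero_cancel)
qed

lemma conv_add: assumes "conv X u x" "conv X v y" shows "conv X (\<lambda>n. u n + v n) (x + y)"
proof -
  have lim: "(\<lambda>n. nrm X (u n - x) + nrm X (v n - y)) \<longlonglongrightarrow> 0"
    using tendsto_add[of "\<lambda>n. nrm X (u n - x)" 0 _ "\<lambda>n. nrm X (v n - y)" 0] assms
    by (simp add: conv_def)
  have "(\<lambda>n. nrm X (u n + v n - (x + y))) \<longlonglongrightarrow> 0"
  proof (rule Lim_null_comparison[OF _ lim], intro always_eventually allI)
    fix n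
    have e: "u n + v n - (x + y) = (u n - x) + (v n - y)" by simp
    have i: "u n - x \<in> carr X" "v n - y \<in> carr X"
      using convD[OF assms(1)] convD[OF assms(2)] by auto
    show "norm (nrm X (u n + v n - (x + y))) \<le> nrm X (u n - x) + nrm X (v n - y)"
      unfolding e using nrm_tri[OF i] nrm_ge0[OF in_add[OF i]] by simp
  qed
  then show ?thesis using assms by (auto simp: conv_def)
qed

lemma conv_scale: assumes "conv X u x" shows "conv X (\<lambda>n. s c (u n)) (s c x)"
proof -
  have "nrm X (s c (u n) - s c x) = cmod c * nrm X (u n - x)" for n
    using nrm_scale[of "u n - x" c] convD[OF assms] by (simp add: scale_right_diff_distrib in_diff)
  then show ?thesis using assms tendsto_mult_right_zero[of "\<lambda>n. nrm X (u n - x)"]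
    by (auto simp: conv_def)
qed

lemma conv_const: "x \<in> carr X \<Longrightarrow> conv X (\<lambda>n. x) x" by (simp add: conv_def)

lemma conv_diff: assumes "conv X u x" "conv X v y" shows "conv X (\<lambda>n. u n - v n) (x - y)"
  using conv_add[OF assms(1) conv_scale[OF assms(2), of "-1"]] by simp

lemma conv_cauchy: assumes "conv X u x" shows "cauchy X u"
  unfolding cauchy_def
proof (intro conjI allI impI)
  fix e :: real assume "e > 0"
  then obtain N where N: "\<forall>n\<ge>N. nrm X (u n - x) < e/2"
    using conv_eventually[OF assms, of "e/2"] by auto
  show "\<exists>N. \<forall>m\<ge>N. \<forall>n\<ge>N. nrm X (u m - u n) < e"
  proof (intro exI allI impI)
    fix m n assume "m \<ge> N" "n \<ge> N"
    then show "nrm X (u m - u n) < e"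
      using N nrm_tri3[of "u m" x "u n"] nrm_commute[of x "u n"] convD[OF assms]
      by (smt (verit) field_sum_of_halves)
  qed
qed (rule convD[OF assms])

text \<open>A Cauchy sequence is thinned to a prescribed rate so that consecutive differences become
  summable; \<open>Sigma_complete\<close> splits these differences one at a time.\<close>

lemma cauchy_fast:
  fixes e :: "nat \<Rightarrow> real"
  assumes "cauchy X u" "\<And>k. e k > 0"
  shows "\<exists>r. strict_mono r \<and> (\<forall>k. \<forall>n\<ge>r k. nrm X (u n - u (r k)) < e k)"
proof -
  have "\<forall>k. \<exists>N. \<forall>m\<ge>N. \<forall>n\<ge>N. nrm X (u m - u n) < e k"
    using assms by (auto simp: cauchy_def)
  then obtain N where N: "\<And>k m n. m \<ge> N k \<Longrightarrow> n \<ge> N k \<Longrightarrow> nrm X (u m - u n) < e k" by metis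
  define r where "r = rec_nat (N 0) (\<lambda>k m. max (N (Suc k)) (Suc m))"
  have "r k \<ge> N k" for k by (cases k) (simp_all add: r_def)
  moreover have "strict_mono r" unfolding strict_mono_Suc_iff by (simp add: r_def less_max_iff_disj)
  ultimately show ?thesis using N by (meson le_trans order_refl)
qed

lemma cauchy_subseq_conv:
  assumes "cauchy X u" "strict_mono (r :: nat \<Rightarrow> nat)" "conv X (\<lambda>k. u (r k)) x" shows "conv X u x"
proof -
  have "(\<lambda>n. nrm X (u n - x)) \<longlonglongrightarrow> 0"
  proof (rule LIMSEQ_I)
    fix e :: real assume e: "e > 0"
    obtain N where N: "\<And>m n. m \<ge> N \<Longrightarrow> n \<ge> N \<Longrightarrow> nrm X (u m - u n) < e/2"
      using assms(1) e unfolding cauchy_def by (meson half_gt_zero)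
    obtain M where M: "\<And>k. k \<ge> M \<Longrightarrow> nrm X (u (r k) - x) < e/2"
      using conv_eventually[OF assms(3), of "e/2"] e by auto
    have rk: "k \<le> r k" for k by (rule seq_suble[OF assms(2)])
    have "nrm X (u n - x) < e" if "n \<ge> N" for n
    proof -
      define k where "k = max M N"
      have 1: "nrm X (u n - u (r k)) < e/2" using N[OF that, of "r k"] rk[of k] by (simp add: k_def)
      have 2: "nrm X (u (r k) - x) < e/2" using M[of k] by (simp add: k_def)
      have "u n \<in> carr X" "u (r k) \<in> carr X" "x \<in> carr X"
        using assms(1,3) by (auto simp: cauchy_def conv_def)
      from nrm_tri3[OF this] 1 2 show ?thesis by simp
    qed
    moreover have "0 \<le> nrm X (u n - x)" for n
      using assms(1,3) by (auto simp: cauchy_def conv_def intro!: nrm_ge0)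
    ultimately show "\<exists>N. \<forall>n\<ge>N. norm (nrm X (u n - x) - 0) < e" by (auto intro!: exI[of _ N])
  qed
  then show ?thesis using assms by (simp add: conv_def cauchy_def)
qed

lemma mcomplete_iff:
  "Metric_space.mcomplete (carr X) (ndist X) \<longleftrightarrow> (\<forall>u. cauchy X u \<longrightarrow> (\<exists>x. conv X u x))"
proof -
  interpret M: Metric_space "carr X" "ndist X" by (rule Metric_space)
  have 1: "M.MCauchy u \<longleftrightarrow> cauchy X u" for u
    unfolding M.MCauchy_def cauchy_def ndist_def image_subset_iff by (auto; metis)
  have 2: "limitin M.mtopology u x sequentially \<longleftrightarrow> conv X u x" if "cauchy X u" for u x
    using that unfolding M.limitin_metric_dist_null conv_def cauchy_def
    by (auto simp: ndist_def)
  show ?thesis unfolding M.mcomplete_def using 1 2 by blast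
qed

lemma dense_in_iff:
  "dense_in D X \<longleftrightarrow> D \<subseteq> carr X \<and> (\<forall>x\<in>carr X. \<forall>e>0. \<exists>d\<in>D. nrm X (x - d) < e)"
proof -
  interpret M: Metric_space "carr X" "ndist X" by (rule Metric_space)
  have "M.mtopology closure_of D = carr X \<longleftrightarrow> (\<forall>x\<in>carr X. \<forall>e>0. \<exists>d\<in>D. nrm X (x - d) < e)"
    if D: "D \<subseteq> carr X"
  proof -
    have "(\<exists>y\<in>D. y \<in> M.mball x e) \<longleftrightarrow> (\<exists>d\<in>D. nrm X (x - d) < e)" if "x \<in> carr X" for x e
      using D that by (auto simp: ndist_def)
    then show ?thesis unfolding M.metric_closure_of by blast
  qed
  then show ?thesis unfolding dense_in_def by blast
qed

lemma dense_seq: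
  assumes "dense_in D X" "x \<in> carr X" shows "\<exists>u. (\<forall>n. u n \<in> D) \<and> conv X u x"
proof -
  have D: "D \<subseteq> carr X" and "\<forall>n::nat. \<exists>d\<in>D. nrm X (x - d) < 1 / Suc n"
    using assms unfolding dense_in_iff by auto
  then obtain u where u: "\<And>n. u n \<in> D" "\<And>n. nrm X (x - u n) < 1 / Suc n" by metis
  have uX: "u n \<in> carr X" for n using u D by auto
  have "(\<lambda>n. nrm X (u n - x)) \<longlonglongrightarrow> 0"
  proof (rule Lim_null_comparison[OF _ LIMSEQ_inverse_real_of_nat], intro always_eventually allI)
    fix n show "norm (nrm X (u n - x)) \<le> inverse (real (Suc n))"
      using u(2)[of n] nrm_commute[OF uX assms(2)] nrm_ge0[OF in_diff[OF uX[of n] assms(2)]]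
      by (simp add: inverse_eq_divide)
  qed
  then show ?thesis using u uX assms by (auto simp: conv_def)
qed

end

lemma banach_iff:
  assumes "vector_space s"
  shows "banach_space s X \<longleftrightarrow> normed_space s X \<and> (\<forall>u. cauchy X u \<longrightarrow> (\<exists>x. conv X u x))"
proof -
  have "Metric_space.mcomplete (carr X) (ndist X) \<longleftrightarrow> (\<forall>u. cauchy X u \<longrightarrow> (\<exists>x. conv X u x))"
    if "normed_space s X"
    by (rule nvs.mcomplete_iff[of s]) (intro nvs.intro complex_vs.intro nvs_axioms.intro assms that)
  then show ?thesis by (auto simp: banach_space_def)
qed

section \<open>The parallelogram law and the inner product behind it\<close>

definition pgram :: "'v::ab_group_add nspace \<Rightarrow> bool" where
  "pgram X \<longleftrightarrow> (\<forall>x\<in>carr X. \<forall>y\<in>carr X.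
     (nrm X (x + y))\<^sup>2 + (nrm X (x - y))\<^sup>2 = 2 * (nrm X x)\<^sup>2 + 2 * (nrm X y)\<^sup>2)"

definition inner_on :: "(complex \<Rightarrow> 'v \<Rightarrow> 'v) \<Rightarrow> 'v::ab_group_add nspace \<Rightarrow> ('v \<Rightarrow> 'v \<Rightarrow> complex) \<Rightarrow> bool"
where
  "inner_on s X ip \<longleftrightarrow>
        (\<forall>x\<in>carr X. \<forall>y\<in>carr X. \<forall>z\<in>carr X. ip (x + y) z = ip x z + ip y z) \<and>
        (\<forall>c. \<forall>x\<in>carr X. \<forall>y\<in>carr X. ip (s c x) y = c * ip x y) \<and>
        (\<forall>x\<in>carr X. \<forall>y\<in>carr X. ip y x = cnj (ip x y)) \<and>
        (\<forall>x\<in>carr X. ip x x = complex_of_real ((nrm X x)\<^sup>2))"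

lemma hilbert_iff_inner: "hilbert_space s X \<longleftrightarrow> banach_space s X \<and> (\<exists>ip. inner_on s X ip)"
  unfolding hilbert_space_def inner_on_def ..

locale ips = nvs s X for s :: "complex \<Rightarrow> 'v::ab_group_add \<Rightarrow> 'v" and X +
  fixes ip :: "'v \<Rightarrow> 'v \<Rightarrow> complex" assumes inner: "inner_on s X ip"
begin

lemma ip_add_left: "x\<in>carr X \<Longrightarrow> y\<in>carr X \<Longrightarrow> z\<in>carr X \<Longrightarrow> ip (x + y) z = ip x z + ip y z"
  using inner unfolding inner_on_def by blast
lemma ip_scale_left: "x\<in>carr X \<Longrightarrow> y\<in>carr X \<Longrightarrow> ip (s c x) y = c * ip x y"
  using inner unfolding inner_on_def by blast
lemma ip_cnj: "x\<in>carr X \<Longrightarrow> y\<in>carr X \<Longrightarrow> ip y x = cnj (ip x y)"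
  using inner unfolding inner_on_def by blast
lemma ip_self: "x\<in>carr X \<Longrightarrow> ip x x = complex_of_real ((nrm X x)\<^sup>2)"
  using inner unfolding inner_on_def by blast
lemma ip_add_right: "x\<in>carr X \<Longrightarrow> y\<in>carr X \<Longrightarrow> z\<in>carr X \<Longrightarrow> ip x (y + z) = ip x y + ip x z"
  using ip_cnj[of "y + z" x] ip_cnj[of y x] ip_cnj[of z x] ip_add_left[of y z x] by (simp add: in_add)
lemma ip_scale_right: "x\<in>carr X \<Longrightarrow> y\<in>carr X \<Longrightarrow> ip x (s c y) = cnj c * ip x y"
  using ip_cnj[of "s c y" x] ip_cnj[of y x] ip_scale_left[of y x c] by (simp add: in_scale)
lemma ip_zero_left: "x \<in> carr X \<Longrightarrow> ip 0 x = 0" using ip_scale_left[of 0 x 0] by simp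
lemma ip_zero_right: "x \<in> carr X \<Longrightarrow> ip x 0 = 0" using ip_scale_right[of x 0 0] by simp
lemma ip_diff_left: "x\<in>carr X \<Longrightarrow> y\<in>carr X \<Longrightarrow> z\<in>carr X \<Longrightarrow> ip (x - y) z = ip x z - ip y z"
  using ip_add_left[of x "- y" z] ip_scale_left[of y z "-1"] by (simp add: in_neg)

lemma nrm_add_sq: "x\<in>carr X \<Longrightarrow> y\<in>carr X \<Longrightarrow>
  (nrm X (x + y))\<^sup>2 = (nrm X x)\<^sup>2 + (nrm X y)\<^sup>2 + 2 * Re (ip x y)"
proof -
  assume *: "x\<in>carr X" "y\<in>carr X"
  have "ip (x + y) (x + y) = ip x x + ip y y + ip x y + cnj (ip x y)"
    using * ip_cnj[of x y] by (simp add: ip_add_left ip_add_right in_add)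
  then have "Re (ip (x + y) (x + y)) = Re (ip x x) + Re (ip y y) + 2 * Re (ip x y)" by simp
  then show ?thesis using * by (simp add: ip_self in_add)
qed

lemma pgram: "pgram X"
  unfolding pgram_def
proof (intro ballI)
  fix x y assume *: "x\<in>carr X" "y\<in>carr X"
  have "ip x (- y) = - ip x y" using ip_scale_right[OF *, of "-1"] by simp
  then show "(nrm X (x + y))\<^sup>2 + (nrm X (x - y))\<^sup>2 = 2 * (nrm X x)\<^sup>2 + 2 * (nrm X y)\<^sup>2"
    using nrm_add_sq[OF *] nrm_add_sq[of x "- y"] * by (simp add: in_neg nrm_neg)
qed

lemma cauchy_schwarz: assumes x: "x \<in> carr X" and y: "y \<in> carr X"
  shows "cmod (ip x y) \<le> nrm X x * nrm X y"
proof (cases "y = 0")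
  case True then show ?thesis using x by (simp add: ip_zero_right)
next
  case False
  define b where "b = (nrm X y)\<^sup>2"
  have b: "b > 0" using False y nrm_eq0 by (simp add: b_def)
  \<comment> \<open>\<open>s c y\<close> is minus the orthogonal projection of \<open>x\<close> onto
    the line of \<open>y\<close>, so this \<open>c\<close> minimizes the squared norm below.\<close>
  define c where "c = - ip x y / b"
  have "0 \<le> (nrm X (x + s c y))\<^sup>2" by simp
  also have "\<dots> = (nrm X x)\<^sup>2 + (cmod c)\<^sup>2 * b + 2 * Re (cnj c * ip x y)"
    using x y by (simp add: nrm_add_sq in_scale nrm_scale ip_scale_right power_mult_distrib b_def)
  also have "cnj c * ip x y = - (cnj (ip x y) * ip x y) / b" by (simp add: c_def)
  also have "cnj (ip x y) * ip x y = complex_of_real ((cmod (ip x y))\<^sup>2)"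
    by (metis complex_norm_square mult.commute)
  also have "Re (- complex_of_real ((cmod (ip x y))\<^sup>2) / complex_of_real b) = - (cmod (ip x y))\<^sup>2 / b"
    by (simp only: of_real_minus[symmetric] of_real_divide[symmetric] Re_complex_of_real)
  also have "(cmod c)\<^sup>2 * b = (cmod (ip x y))\<^sup>2 / b"
    using b by (simp add: c_def norm_divide power_divide power2_eq_square)
  finally have "(cmod (ip x y))\<^sup>2 / b \<le> (nrm X x)\<^sup>2" by simp
  then have "(cmod (ip x y))\<^sup>2 \<le> (nrm X x * nrm X y)\<^sup>2"
    using b by (simp add: b_def field_simps power_mult_distrib)
  then show ?thesis using nrm_ge0 x y by (simp add: power2_le_iff_abs_le)
qed

lemma conv_ip:
  assumes "conv X u x" "y \<in> carr X" shows "(\<lambda>n. ip (u n) y) \<longlonglongrightarrow> ip x y"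
    "(\<lambda>n. ip y (u n)) \<longlonglongrightarrow> ip y x"
proof -
  have lim: "(\<lambda>n. nrm X (u n - x) * nrm X y) \<longlonglongrightarrow> 0"
    using assms by (auto simp: conv_def intro!: tendsto_mult_left_zero)
  have "(\<lambda>n. ip (u n) y - ip x y) \<longlonglongrightarrow> 0"
  proof (rule Lim_null_comparison[OF _ lim], intro always_eventually allI)
    fix n show "norm (ip (u n) y - ip x y) \<le> nrm X (u n - x) * nrm X y"
      using cauchy_schwarz[of "u n - x" y] convD[OF assms(1)] assms(2)
      by (simp add: ip_diff_left in_diff)
  qed
  then show 1: "(\<lambda>n. ip (u n) y) \<longlonglongrightarrow> ip x y" by (rule LIM_zero_cancel)
  have "(\<lambda>n. cnj (ip (u n) y)) \<longlonglongrightarrow> cnj (ip x y)" by (rule tendsto_cnj[OF 1])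
  then show "(\<lambda>n. ip y (u n)) \<longlonglongrightarrow> ip y x"
    by (simp only: ip_cnj[OF convD(1)[OF assms(1)] assms(2)] ip_cnj[OF convD(2)[OF assms(1)] assms(2)])
qed

end

text \<open>Additivity forces rational homogeneity and the bound near 0 gives continuity, hence real
  homogeneity. This is the analytic half of the Jordan-von Neumann theorem.\<close>

lemma additive_bounded_linear:
  fixes f :: "real \<Rightarrow> real"
  assumes add: "\<And>a b. f (a + b) = f a + f b" and bd: "\<And>a. \<bar>a\<bar> \<le> 1 \<Longrightarrow> \<bar>f a\<bar> \<le> C * \<bar>a\<bar>"
  shows "f a = a * f 1"
proof -
  have f0: "f 0 = 0" using add[of 0 0] by simp
  have neg: "f (- a) = - f a" for a using add[of a "- a"] f0 by simp
  have mult: "f (real n * a) = real n * f a" for n a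
    by (induction n) (simp_all add: f0 add algebra_simps)
  have multi: "f (of_int k * a) = of_int k * f a" for k a
    by (cases k rule: int_cases2) (simp_all add: mult neg)
  have rat: "f (of_rat q) = of_rat q * f 1" for q
  proof -
    obtain m n where q: "q = Fract m n" "n > 0" by (cases q) auto
    have "of_int n * f (of_rat q) = f (of_int n * of_rat q)" by (simp add: multi)
    also have "of_int n * of_rat q = (of_int m * 1 :: real)"
      using q by (simp add: of_rat_rat)
    also have "f \<dots> = of_int m * f 1" by (rule multi)
    finally show ?thesis using q by (simp add: of_rat_rat field_simps)
  qed
  have C0: "C \<ge> 0" using bd[of 1] by auto
  have small: "\<bar>f a - a * f 1\<bar> \<le> e" if "e > 0" for e
  proof -
    \<comment> \<open>\<open>d\<close> at most 1 makes \<open>bd\<close> applicable to the remainder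
      \<open>r\<close>; the quotient keeps the error \<open>(C + \<bar>f 1\<bar>) * d\<close> below
      \<open>e\<close>, and its added 1 avoids a zero denominator.\<close>
    define d where "d = min 1 (e / (C + \<bar>f 1\<bar> + 1))"
    have d: "d > 0" using that C0 by (simp add: d_def add_nonneg_pos)
    obtain q where q: "a - d < of_rat q" "of_rat q < a" using of_rat_dense[of "a - d" a] d by auto
    define r where "r = a - of_rat q"
    have r: "\<bar>r\<bar> \<le> d" "\<bar>r\<bar> \<le> 1" using q by (auto simp: r_def d_def)
    have "f a = f r + of_rat q * f 1" using add[of r "of_rat q"] by (simp add: r_def rat)
    then have "f a - a * f 1 = f r - r * f 1" by (simp add: r_def algebra_simps)
    then have "\<bar>f a - a * f 1\<bar> \<le> C * \<bar>r\<bar> + \<bar>r\<bar> * \<bar>f 1\<bar>"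
      using bd[OF r(2)] abs_triangle_ineq4[of "f r" "r * f 1"] by (simp add: abs_mult)
    also have "\<dots> = (C + \<bar>f 1\<bar>) * \<bar>r\<bar>" by (simp add: algebra_simps)
    also have "\<dots> \<le> (C + \<bar>f 1\<bar> + 1) * d" using r C0 by (intro mult_mono) auto
    also have "\<dots> \<le> (C + \<bar>f 1\<bar> + 1) * (e / (C + \<bar>f 1\<bar> + 1))"
      using C0 by (intro mult_left_mono) (auto simp: d_def)
    also have "\<dots> = e" using C0 by (simp add: add_nonneg_pos less_imp_neq[symmetric])
    finally show ?thesis .
  qed
  have "\<bar>f a - a * f 1\<bar> \<le> 0" by (rule field_le_epsilon) (use small in simp)
  then show ?thesis by simp
qed

text \<open>Polarization defines the candidate. The parallelogram law yields a midpoint identity,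
  hence additivity in the first argument; the estimate \<open>bd\<close> turns additivity into real
  homogeneity; invariance of the norm under multiplication by \<open>\<i>\<close> gives complex
  homogeneity.\<close>

lemma (in nvs) jordan_von_neumann:
  assumes "pgram X" shows "\<exists>ip. inner_on s X ip"
proof -
  define q where "q x = (nrm X x)\<^sup>2" for x
  define re where "re x y = (q (x + y) - q (x - y)) / 4" for x y
  \<comment> \<open>For a product linear in the first slot, the imaginary part at \<open>x\<close>,
    \<open>y\<close> is the real part at \<open>x\<close>, \<open>s \<i> y\<close>.\<close>
  define ip where "ip x y = Complex (re x y) (re x (s \<i> y))" for x y
  have pg: "q (x + y) + q (x - y) = 2 * q x + 2 * q y" if "x \<in> carr X" "y \<in> carr X" for x y
    using assms that by (simp add: pgram_def q_def)
  have qs: "q (s c x) = (cmod c)\<^sup>2 * q x" if "x \<in> carr X" for x c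
    using that by (simp add: q_def nrm_scale power_mult_distrib)
  have qn: "q (- x) = q x" if "x \<in> carr X" for x using that by (simp add: q_def nrm_neg)
  have q0: "q 0 = 0" by (simp add: q_def)
  have sym: "re y x = re x y" if "x \<in> carr X" "y \<in> carr X" for x y
    using qn[of "x - y"] that by (simp add: re_def add.commute in_diff)
  have re0: "re 0 z = 0" if "z \<in> carr X" for z using that by (simp add: re_def qn)
  have mid: "re x z + re y z = 2 * re (s (1/2) (x + y)) z"
    if *: "x \<in> carr X" "y \<in> carr X" "z \<in> carr X" for x y z
  proof -
    define a b where "a = s (1/2) (x + y)" and "b = s (1/2) (x - y)"
    have ab: "a \<in> carr X" "b \<in> carr X" unfolding a_def b_def using * by auto
    have half: "s (1/2) w + s (1/2) w = w" for w
      using scale_left_distrib[of "1/2" "1/2" w] by simp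
    have x: "x = a + b" and y: "y = a - b"
      using half[of x] half[of y] by (auto simp: a_def b_def scale_right_distrib scale_right_diff_distrib)
    have e: "a + z + b = x + z" "a + z - b = y + z" "a - z + b = x - z" "a - z - b = y - z"
      by (simp_all add: x y algebra_simps)
    \<comment> \<open>Subtracting these two identities cancels \<open>q b\<close> and leaves the
      midpoint identity.\<close>
    have "q (x + z) + q (y + z) = 2 * q (a + z) + 2 * q b"
      "q (x - z) + q (y - z) = 2 * q (a - z) + 2 * q b"
      using pg[of "a + z" b] pg[of "a - z" b] ab * unfolding e by (auto simp: in_add in_diff)
    then show ?thesis unfolding a_def[symmetric] re_def by argo
  qed
  \<comment> \<open>Taking \<open>x + y\<close> and \<open>0\<close> in \<open>mid\<close> gives the
    same right-hand side as taking \<open>x\<close> and \<open>y\<close>, so the left-hand sides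
    agree.\<close>
  have add: "re (x + y) z = re x z + re y z"
    if *: "x \<in> carr X" "y \<in> carr X" "z \<in> carr X" for x y z
    using mid[OF *] mid[of "x + y" 0 z] * re0[of z] by (auto simp: in_add)
  have neg: "re (- x) y = - re x y" if *: "x \<in> carr X" "y \<in> carr X" for x y
    using add[of x "- x" y] re0[of y] * by (simp add: in_neg)
  have bd: "\<bar>re x y\<bar> \<le> nrm X x * (nrm X x + nrm X y)" if *: "x \<in> carr X" "y \<in> carr X" for x y
  proof -
    define A B where "A = nrm X (x + y)" and "B = nrm X (x - y)"
    have 1: "A + B \<le> 2 * (nrm X x + nrm X y)" "0 \<le> A" "0 \<le> B"
      using nrm_tri[OF *] nrm_tri_diff[OF *] * by (auto simp: A_def B_def intro: nrm_ge0)
    have "(x + y) - (y - x) = s 2 x" using scale_left_distrib[of 1 1 x] by simp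
    then have 2: "\<bar>A - B\<bar> \<le> 2 * nrm X x"
      using nrm_rev[of "x + y" "y - x"] * nrm_commute[of x y]
      by (simp add: A_def B_def in_add in_diff nrm_scale)
    have "\<bar>A\<^sup>2 - B\<^sup>2\<bar> = \<bar>A - B\<bar> * (A + B)"
      using 1 by (simp add: power2_eq_square square_diff_square_factored abs_mult)
    also have "\<dots> \<le> (2 * nrm X x) * (2 * (nrm X x + nrm X y))"
      using 1 2 by (intro mult_mono) auto
    also have "\<dots> = 4 * (nrm X x * (nrm X x + nrm X y))" by (simp add: algebra_simps)
    finally show ?thesis by (simp add: re_def q_def A_def B_def)
  qed
  have homr: "re (s (of_real r) x) y = r * re x y" if *: "x \<in> carr X" "y \<in> carr X" for x y r
  proof -
    have "re (s (of_real r) x) y = r * re (s (of_real 1) x) y"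
    proof (rule additive_bounded_linear[where f = "\<lambda>r. re (s (of_real r) x) y"])
      show "re (s (of_real (a + b)) x) y = re (s (of_real a) x) y + re (s (of_real b) x) y" for a b
        using add * by (simp add: scale_left_distrib in_scale)
      fix a :: real assume a: "\<bar>a\<bar> \<le> 1"
      have "\<bar>re (s (of_real a) x) y\<bar> \<le> \<bar>a\<bar> * nrm X x * (\<bar>a\<bar> * nrm X x + nrm X y)"
        using bd[of "s (of_real a) x" y] * by (simp add: in_scale nrm_scale)
      also have "\<dots> \<le> \<bar>a\<bar> * nrm X x * (1 * nrm X x + nrm X y)"
        using a * nrm_ge0[of x] by (intro mult_left_mono add_right_mono mult_right_mono) auto
      finally show "\<bar>re (s (of_real a) x) y\<bar> \<le> (nrm X x * (nrm X x + nrm X y)) * \<bar>a\<bar>"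
        by (simp add: mult_ac)
    qed
    then show ?thesis by simp
  qed
  have rot: "re (s \<i> x) (s \<i> y) = re x y" if *: "x \<in> carr X" "y \<in> carr X" for x y
    unfolding re_def using * qs[of "x + y" \<i>] qs[of "x - y" \<i>]
    by (simp add: scale_right_distrib scale_right_diff_distrib in_add in_diff)
  have rot2: "re (s \<i> x) y = - re x (s \<i> y)" if *: "x \<in> carr X" "y \<in> carr X" for x y
    using rot[of "s \<i> x" y] neg[of x "s \<i> y"] * by (simp add: in_scale)
  have scl: "ip (s c x) y = c * ip x y" if *: "x \<in> carr X" "y \<in> carr X" for x y c
  proof -
    have c: "s c x = s (of_real (Re c)) x + s (of_real (Im c)) (s \<i> x)"
      by (subst complex_eq[of c]) (simp only: scale_left_distrib scale_scale mult.commute)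
    have "re (s c x) z = Re c * re x z - Im c * re x (s \<i> z)" if "z \<in> carr X" for z
      unfolding c using * that by (simp add: add homr rot2 in_scale del: scale_scale)
    moreover have "re x (s \<i> (s \<i> y)) = - re x y"
      using rot2[of x "s \<i> y"] rot[OF *] * by (simp add: in_scale del: scale_scale)
    ultimately show ?thesis
      using * by (simp add: ip_def complex_eq_iff in_scale del: scale_scale)
  qed
  have "inner_on s X ip"
    unfolding inner_on_def
  proof (intro conjI ballI allI)
    fix x y z assume "x \<in> carr X" "y \<in> carr X" "z \<in> carr X"
    then show "ip (x + y) z = ip x z + ip y z" by (simp add: ip_def add in_scale complex_eq_iff)
  next
    fix x y assume *: "x \<in> carr X" "y \<in> carr X"
    show "ip y x = cnj (ip x y)"
      using sym[OF *] sym[of "s \<i> x" y] rot2[OF *] * by (simp add: ip_def complex_eq_iff in_scale)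
  next
    fix x assume *: "x \<in> carr X"
    have "x + s \<i> x = s (1 + \<i>) x" "x - s \<i> x = s (1 - \<i>) x" "x + x = s 2 x"
      using scale_left_distrib[of 1 1 x] by (simp_all add: scale_left_distrib scale_left_diff_distrib)
    then show "ip x x = complex_of_real ((nrm X x)\<^sup>2)"
      using * by (simp add: ip_def re_def qs q0 complex_eq_iff cmod_power2 q_def[symmetric])
  qed (use scl in auto)
  then show ?thesis using exI[of "inner_on s X" ip] by blast
qed

text \<open>Infima, integrals and suprema of norms preserve the parallelogram law more directly than
  an explicit inner product. Interpolation spaces and duals are shown to satisfy
  \<open>hilbert_space\<close> through this equivalence.\<close>

lemma hilbert_iff:
  assumes "vector_space s" shows "hilbert_space s X \<longleftrightarrow> banach_space s X \<and> pgram X"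
proof -
  have "(\<exists>ip. inner_on s X ip) \<longleftrightarrow> pgram X" if "normed_space s X"
  proof -
    interpret nvs s X by (intro nvs.intro complex_vs.intro nvs_axioms.intro assms that)
    show ?thesis using jordan_von_neumann ips.pgram nvs_axioms ips.intro ips_axioms.intro by blast
  qed
  then show ?thesis unfolding hilbert_iff_inner by (auto simp: banach_space_def)
qed

section \<open>Riesz representation and sums of complete spaces\<close>

locale hilbert = ips s X ip for s :: "complex \<Rightarrow> 'v::ab_group_add \<Rightarrow> 'v" and X ip +
  assumes complete: "cauchy X u \<Longrightarrow> \<exists>x. conv X u x"

lemma hilbert_space_imp_hilbert:
  assumes "vector_space s" "hilbert_space s X" shows "\<exists>ip. hilbert s X ip"
proof -
  obtain ip where "inner_on s X ip" using assms(2) unfolding hilbert_iff_inner by blast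
  moreover have "normed_space s X" "\<And>u. cauchy X u \<Longrightarrow> \<exists>x. conv X u x"
    using assms(2) banach_iff[OF assms(1), of X] unfolding hilbert_iff_inner by blast+
  ultimately have "hilbert s X ip"
    by (intro hilbert.intro ips.intro nvs.intro complex_vs.intro nvs_axioms.intro ips_axioms.intro
        hilbert_axioms.intro assms(1))
  then show ?thesis by blast
qed

definition linear_on :: "(complex \<Rightarrow> 'v \<Rightarrow> 'v) \<Rightarrow> 'v::ab_group_add set \<Rightarrow> ('v \<Rightarrow> complex) \<Rightarrow> bool" where
  "linear_on s D g \<longleftrightarrow> (\<forall>x\<in>D. \<forall>y\<in>D. g (x + y) = g x + g y) \<and> (\<forall>c. \<forall>x\<in>D. g (s c x) = c * g x)"

text \<open>First-order condition at a minimum, applied to the minimizers in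
  \<open>riesz_on_subspace\<close> and \<open>rayleigh\<close>. With \<open>c = b / (q + 1)\<close>
  the value at \<open>- c\<close> is \<open>- c^2 * (q + 2)\<close>; the added 1 covers
  \<open>q = 0\<close>.\<close>

lemma nonneg_quadratic_imp_zero:
  fixes b q :: real
  assumes nn: "\<And>t. 0 \<le> t\<^sup>2 * q + 2 * t * b" shows "b = 0"
proof (rule ccontr)
  assume "b \<noteq> 0"
  have q: "q \<ge> 0" using nn[of 1] nn[of "-1"] by simp
  define c where "c = b / (q + 1)"
  have b: "b = c * (q + 1)" using q by (simp add: c_def)
  have "0 \<le> (- c)\<^sup>2 * q + 2 * (- c) * b" by (rule nn)
  also have "\<dots> = - (c\<^sup>2 * (q + 2))" unfolding b by (simp add: power2_eq_square algebra_simps)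
  also have "\<dots> < 0" using q \<open>b \<noteq> 0\<close> b by (auto intro!: mult_pos_pos)
  finally show False by simp
qed

text \<open>The representing vector is the limit of a minimizing sequence of
  \<open>\<lambda>x. \<parallel>x\<parallel>\<^sup>2 - 2 Re (g x)\<close> over \<open>D\<close>.\<close>
lemma (in hilbert) riesz_on_subspace:
  assumes D: "subspace D" "D \<subseteq> carr X" and g: "linear_on s D g"
    and B: "B \<ge> 0" "\<And>x. x \<in> D \<Longrightarrow> cmod (g x) \<le> B * nrm X x"
  shows "\<exists>e\<in>carr X. (\<forall>x\<in>D. g x = ip x e) \<and> nrm X e \<le> B"
proof -
  have gadd: "g (x + y) = g x + g y" if "x \<in> D" "y \<in> D" for x y
    using g that by (simp add: linear_on_def)
  have gsc: "g (s c x) = c * g x" if "x \<in> D" for x c using g that by (simp add: linear_on_def)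
  note Dadd = subspace_add[OF D(1)] and Dsc = subspace_scale[OF D(1)] and D0 = subspace_0[OF D(1)]
  have DX: "x \<in> carr X" if "x \<in> D" for x using D that by auto
  define J where "J x = (nrm X x)\<^sup>2 - 2 * Re (g x)" for x
  have Jlow: "J x \<ge> - B\<^sup>2" if "x \<in> D" for x
  proof -
    have "Re (g x) \<le> B * nrm X x" using B(2)[OF that] complex_Re_le_cmod[of "g x"] by linarith
    moreover have "0 \<le> (nrm X x - B)\<^sup>2" by simp
    ultimately show ?thesis by (simp add: J_def power2_diff algebra_simps)
  qed
  define m where "m = Inf (J ` D)"
  have bdd: "bdd_below (J ` D)" using Jlow by (auto intro!: bdd_belowI2)
  have mle: "m \<le> J x" if "x \<in> D" for x unfolding m_def using bdd that by (rule cINF_lower)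
  have "\<exists>x\<in>D. J x < m + 1 / Suc n" for n :: nat
  proof -
    have "Inf (J ` D) < m + 1 / Suc n" by (simp add: m_def)
    then show ?thesis using bdd D0 by (subst (asm) cInf_less_iff) auto
  qed
  then obtain u where u: "\<And>n. u n \<in> D" "\<And>n. J (u n) < m + 1 / Suc n" by metis
  have lim1: "(\<lambda>n. 1 / real (Suc n)) \<longlonglongrightarrow> 0"
    using LIMSEQ_inverse_real_of_nat by (simp add: inverse_eq_divide)
  have Jlim: "(\<lambda>n. J (u n)) \<longlonglongrightarrow> m"
  proof (rule tendsto_sandwich[where f = "\<lambda>n. m" and h = "\<lambda>n. m + 1 / real (Suc n)"])
    show "(\<lambda>n. m + 1 / real (Suc n)) \<longlonglongrightarrow> m" using tendsto_add[OF tendsto_const lim1] by simp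
    show "\<forall>\<^sub>F n in sequentially. m \<le> J (u n)" using mle[OF u(1)] by simp
    show "\<forall>\<^sub>F n in sequentially. J (u n) \<le> m + 1 / real (Suc n)"
      using u(2) by (intro always_eventually allI less_imp_le)
  qed simp
  \<comment> \<open>Parallelogram law at the midpoint \<open>w\<close>: as \<open>J w\<close> is at
    least \<open>m\<close>, two near-minimizers of \<open>J\<close> must be close to each
    other.\<close>
  have dist: "(nrm X (u k - u n))\<^sup>2 \<le> 2 / Suc k + 2 / Suc n" for k n
  proof -
    define w where "w = s (1/2) (u k + u n)"
    have w: "w \<in> D" using Dsc Dadd u(1) by (simp add: w_def)
    have sum: "u k + u n = s 2 w" by (simp add: w_def)
    have pg: "(nrm X (u k + u n))\<^sup>2 + (nrm X (u k - u n))\<^sup>2 = 2 * (nrm X (u k))\<^sup>2 + 2 * (nrm X (u n))\<^sup>2"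
      using pgram DX[OF u(1)] by (simp add: pgram_def)
    have "(nrm X (u k + u n))\<^sup>2 = 4 * (nrm X w)\<^sup>2"
      unfolding sum using DX[OF w] by (simp add: nrm_scale power_mult_distrib)
    moreover have "g (u k) + g (u n) = 2 * g w"
      using gadd[OF u(1) u(1), of k n] gsc[OF w, of 2] by (simp add: sum)
    from arg_cong[OF this, of Re] have "Re (g (u k)) + Re (g (u n)) = 2 * Re (g w)" by simp
    ultimately have "(nrm X (u k - u n))\<^sup>2 = 2 * J (u k) + 2 * J (u n) - 4 * J w"
      using pg by (simp add: J_def algebra_simps)
    also have "\<dots> \<le> 2 * (m + 1 / Suc k) + 2 * (m + 1 / Suc n) - 4 * m"
      using u(2)[of k] u(2)[of n] mle[OF w] by argo
    finally show ?thesis by (simp add: algebra_simps)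
  qed
  have "cauchy X u"
    unfolding cauchy_def
  proof (intro conjI allI impI)
    fix e :: real assume e: "e > 0"
    obtain N :: nat where N: "1 / Suc N < e\<^sup>2 / 4"
      using reals_Archimedean[of "e\<^sup>2 / 4"] e by (auto simp: inverse_eq_divide)
    show "\<exists>N. \<forall>m\<ge>N. \<forall>n\<ge>N. nrm X (u m - u n) < e"
    proof (intro exI[of _ N] allI impI)
      fix k n assume "N \<le> k" "N \<le> n"
      then have "1 / real (Suc k) \<le> 1 / Suc N" "1 / real (Suc n) \<le> 1 / Suc N"
        by (simp_all add: frac_le)
      then have "(nrm X (u k - u n))\<^sup>2 < e\<^sup>2" using dist[of k n] N by simp
      then show "nrm X (u k - u n) < e" using e by (simp add: power_less_imp_less_base)
    qed
  qed (use DX u in auto)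
  then obtain e where e: "conv X u e" using complete by blast
  have eX: "e \<in> carr X" by (rule convD(2)[OF e])
  \<comment> \<open>The limit \<open>e\<close> need not lie in \<open>D\<close>. The variations are
    therefore taken at \<open>u n\<close>, inside \<open>D\<close>, and the inequality passes to the
    limit.\<close>
  have key: "Re (ip y e) = Re (g y)" if y: "y \<in> D" for y
  proof -
    define b where "b = Re (ip y e) - Re (g y)"
    have quad: "0 \<le> t\<^sup>2 * (nrm X y)\<^sup>2 + 2 * t * b" for t
    proof -
      have t: "s (of_real t) y \<in> D" "s (of_real t) y \<in> carr X" using Dsc DX y by auto
      have "J (u n + s (of_real t) y) = J (u n) + t\<^sup>2 * (nrm X y)\<^sup>2 + 2 * t * (Re (ip (u n) y) - Re (g y))" for n
        using t y DX[OF y] DX[OF u(1)] u(1)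
        by (simp add: J_def nrm_add_sq nrm_scale gadd gsc ip_scale_right power_mult_distrib algebra_simps)
      then have 1: "m \<le> J (u n) + t\<^sup>2 * (nrm X y)\<^sup>2 + 2 * t * (Re (ip (u n) y) - Re (g y))" for n
        using mle[OF Dadd[OF u(1) t(1)], of n] by simp
      have "(\<lambda>n. J (u n) + t\<^sup>2 * (nrm X y)\<^sup>2 + 2 * t * (Re (ip (u n) y) - Re (g y)))
         \<longlonglongrightarrow> m + t\<^sup>2 * (nrm X y)\<^sup>2 + 2 * t * (Re (ip e y) - Re (g y))"
        by (intro tendsto_intros Jlim conv_ip[OF e DX[OF y]])
      from LIMSEQ_le_const[OF this] 1 have "m \<le> m + t\<^sup>2 * (nrm X y)\<^sup>2 + 2 * t * (Re (ip e y) - Re (g y))"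
        by blast
      moreover have "Re (ip e y) = Re (ip y e)" using ip_cnj[OF DX[OF y] eX] by simp
      ultimately show ?thesis by (simp add: b_def)
    qed
    have "b = 0" by (rule nonneg_quadratic_imp_zero[OF quad])
    then show ?thesis by (simp add: b_def)
  qed
  have rep: "g y = ip y e" if y: "y \<in> D" for y
    using key[OF y] key[OF Dsc[OF y], of \<i>] gsc[OF y, of \<i>] ip_scale_left[OF DX[OF y] eX, of \<i>]
    by (simp add: complex_eq_iff)
  \<comment> \<open>The bound on \<open>g\<close> is available only on \<open>D\<close>, so the test
    vector \<open>e\<close> is replaced by its approximants \<open>u n\<close>.\<close>
  have "(\<lambda>n. cmod (ip (u n) e)) \<longlonglongrightarrow> cmod (ip e e)" by (intro tendsto_norm conv_ip[OF e eX])
  moreover have "(\<lambda>n. B * nrm X (u n)) \<longlonglongrightarrow> B * nrm X e" by (intro tendsto_intros conv_nrm[OF e])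
  ultimately have "cmod (ip e e) \<le> B * nrm X e"
    by (rule LIMSEQ_le) (use B(2)[OF u(1)] rep[OF u(1)] in auto)
  then have "nrm X e * nrm X e \<le> B * nrm X e"
    using eX by (simp add: ip_self power2_eq_square norm_mult)
  then have "nrm X e \<le> B" using nrm_ge0[OF eX] B(1)
    by (cases "nrm X e = 0") (auto simp: mult_le_cancel_right)
  then show ?thesis using rep eX by blast
qed

text \<open>Sequential form of compatibility: a common sequence cannot have different limits in the
  two norms. For complete spaces this makes both the intersection and the sum Banach spaces
  (\<open>hilbert_compatible_pairI\<close>).\<close>

definition consistent :: "'v::ab_group_add nspace \<Rightarrow> 'v nspace \<Rightarrow> bool" where
  "consistent X Y \<longleftrightarrow> (\<forall>u x y. conv X u x \<longrightarrow> conv Y u y \<longrightarrow> x = y)"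

text \<open>The norms agree on differences of elements of \<open>D\<close>, so a sequence in
  \<open>D\<close> is Cauchy for one norm exactly when it is for the other. Completeness gives a
  limit in each space, and consistency makes the two limits the same vector.\<close>

lemma space_eq_of_dense:
  assumes s: "vector_space s" and X: "banach_space s X" and Y: "banach_space s Y"
    and c: "consistent X Y" and dX: "dense_in D X" and dY: "dense_in D Y"
    and eq: "\<And>x. x \<in> D \<Longrightarrow> nrm X x = nrm Y x" and D: "module.subspace s D"
  shows "space_eq X Y"
proof -
  interpret X: nvs s X using s X by (simp add: banach_space_def complex_vs_def nvs_axioms_def nvs_def)
  interpret Y: nvs s Y using s Y by (simp add: banach_space_def complex_vs_def nvs_axioms_def nvs_def)
  have half: "x \<in> carr Y \<and> nrm X x = nrm Y x"
    if x: "x \<in> carr X" and X: "nvs s X" and Y: "banach_space s Y"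
    and c: "consistent X Y" and dX: "dense_in D X" and dY: "dense_in D Y"
    and eq: "\<And>x. x \<in> D \<Longrightarrow> nrm X x = nrm Y x" for x X Y
  proof -
    interpret X: nvs s X by fact
    interpret Y: nvs s Y using s Y by (simp add: banach_space_def complex_vs_def nvs_axioms_def nvs_def)
    obtain u where u: "\<And>n. u n \<in> D" "conv X u x" using X.dense_seq[OF dX x] by blast
    have "u m - u n \<in> D" for m n using X.subspace_diff[OF D] u by blast
    moreover have "cauchy X u" using X.conv_cauchy[OF u(2)] .
    moreover have "D \<subseteq> carr Y" using dY by (simp add: Y.dense_in_iff)
    ultimately have "cauchy Y u" using eq u(1) by (auto simp: cauchy_def)
    then obtain y where y: "conv Y u y" using Y s by (auto simp: banach_iff)
    have "x = y" using c u(2) y by (auto simp: consistent_def)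
    moreover have "nrm X x = nrm Y y"
      by (rule LIMSEQ_unique[OF X.conv_nrm[OF u(2)]]) (use Y.conv_nrm[OF y] eq u(1) in simp)
    ultimately show ?thesis using Y.convD(2)[OF y] by simp
  qed
  have c': "consistent Y X" using c unfolding consistent_def by metis
  have 1: "x \<in> carr Y \<and> nrm X x = nrm Y x" if "x \<in> carr X" for x
    by (rule half[OF that X.nvs_axioms Y c dX dY eq])
  have 2: "x \<in> carr X" if "x \<in> carr Y" for x
    using half[OF that Y.nvs_axioms X c' dY dX eq[symmetric]] ..
  show ?thesis unfolding space_eq_def using 1 2 by blast
qed

section \<open>Intersection and sum of two normed spaces\<close>

locale npair = X: nvs s X + Y: nvs s Y for s :: "complex \<Rightarrow> 'v::ab_group_add \<Rightarrow> 'v" and X Y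

context npair begin

lemma Delta_normed: "normed_space s (Delta_space X Y)"
proof -
  have "X.subspace (carr X \<inter> carr Y)" by (rule X.subspace_inter[OF X.sub Y.sub])
  moreover have "max (nrm X x) (nrm Y x) = 0 \<longleftrightarrow> x = 0" if "x \<in> carr X" "x \<in> carr Y" for x
    using X.nrm_eq0[OF that(1)] Y.nrm_eq0[OF that(2)] X.nrm_ge0[OF that(1)] Y.nrm_ge0[OF that(2)]
    by (auto simp: max_def)
  moreover have "max (nrm X (x + y)) (nrm Y (x + y)) \<le> max (nrm X x) (nrm Y x) + max (nrm X y) (nrm Y y)"
    if "x \<in> carr X" "x \<in> carr Y" "y \<in> carr X" "y \<in> carr Y" for x y
    using X.nrm_tri[of x y] Y.nrm_tri[of x y] that by linarith
  ultimately show ?thesis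
    using X.nrm_ge0 Y.nrm_ge0
    by (auto simp: normed_space_def Delta_space_def X.nrm_scale Y.nrm_scale max_mult_distrib_left le_max_iff_disj)
qed

lemma Delta_complete:
  assumes c: "consistent X Y" and X: "\<And>u. cauchy X u \<Longrightarrow> \<exists>x. conv X u x"
    and Y: "\<And>u. cauchy Y u \<Longrightarrow> \<exists>x. conv Y u x" and u: "cauchy (Delta_space X Y) u"
  shows "\<exists>x. conv (Delta_space X Y) u x"
proof -
  have "cauchy X u" "cauchy Y u" using u unfolding cauchy_def Delta_space_def by (simp; meson)+
  then obtain x y where x: "conv X u x" and y: "conv Y u y" using X Y by blast
  have "x = y" using c x y by (auto simp: consistent_def)
  moreover have "(\<lambda>n. max (nrm X (u n - x)) (nrm Y (u n - y))) \<longlonglongrightarrow> max 0 0"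
    using x y by (intro tendsto_max) (auto simp: conv_def)
  ultimately have "conv (Delta_space X Y) u x"
    using x y by (auto simp: conv_def Delta_space_def)
  then show ?thesis ..
qed

lemma Sigma_carr: "carr (Sigma_space X Y) = {x + y | x y. x \<in> carr X \<and> y \<in> carr Y}"
  by (simp add: Sigma_space_def)

lemma Sigma_subspace: "X.subspace (carr (Sigma_space X Y))"
  unfolding Sigma_carr by (rule X.subspace_sums[OF X.sub Y.sub])

lemma Sigma_lower:
  assumes "x \<in> carr X" "y \<in> carr Y" shows "nrm (Sigma_space X Y) (x + y) \<le> nrm X x + nrm Y y"
  unfolding Sigma_space_def nspace.simps
  by (rule cInf_lower) (use assms X.nrm_ge0 Y.nrm_ge0 in \<open>auto intro!: bdd_belowI[of _ 0]\<close>)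

lemma Sigma_approx:
  assumes "z \<in> carr (Sigma_space X Y)" "e > 0"
  shows "\<exists>x\<in>carr X. \<exists>y\<in>carr Y. x + y = z \<and> nrm X x + nrm Y y < nrm (Sigma_space X Y) z + e"
proof -
  let ?S = "{nrm X x + nrm Y y | x y. x \<in> carr X \<and> y \<in> carr Y \<and> x + y = z}"
  have "?S \<noteq> {}" using assms by (auto simp: Sigma_carr)
  moreover have "bdd_below ?S" using X.nrm_ge0 Y.nrm_ge0 by (auto intro!: bdd_belowI[of _ 0])
  moreover have "Inf ?S < nrm (Sigma_space X Y) z + e" using assms by (simp add: Sigma_space_def)
  ultimately show ?thesis by (subst (asm) cInf_less_iff) auto
qed

lemma Sigma_ge0: assumes "z \<in> carr (Sigma_space X Y)" shows "0 \<le> nrm (Sigma_space X Y) z"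
proof (rule field_le_epsilon)
  fix e :: real assume "e > 0"
  then show "0 \<le> nrm (Sigma_space X Y) z + e"
    using Sigma_approx[OF assms] X.nrm_ge0 Y.nrm_ge0 by (smt (verit))
qed

lemma Sigma_normed:
  assumes c: "consistent X Y" shows "normed_space s (Sigma_space X Y)"
  unfolding normed_space_def
proof (intro conjI ballI allI)
  let ?S = "Sigma_space X Y"
  show "X.subspace (carr ?S)" by (rule Sigma_subspace)
  show "0 \<le> nrm ?S z" if "z \<in> carr ?S" for z using that by (rule Sigma_ge0)
  show "nrm ?S z = 0 \<longleftrightarrow> z = 0" if z: "z \<in> carr ?S" for z
  proof
    \<comment> \<open>Decompositions of \<open>z\<close> with vanishing norms yield the common
      sequence \<open>x n - x 0 = y 0 - y n\<close>, which tends to \<open>- x 0\<close> in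
      \<open>X\<close> and to \<open>y 0\<close> in \<open>Y\<close>. Consistency then forces
      \<open>x 0 + y 0 = 0\<close>.\<close>
    assume "nrm ?S z = 0"
    then have "\<exists>x\<in>carr X. \<exists>y\<in>carr Y. x + y = z \<and> nrm X x + nrm Y y < 1 / Suc n" for n :: nat
      using Sigma_approx[OF z, of "1 / Suc n"] by auto
    then obtain x y where xy: "\<And>n. x n \<in> carr X" "\<And>n. y n \<in> carr Y" "\<And>n. x n + y n = z"
      "\<And>n. nrm X (x n) + nrm Y (y n) < 1 / Suc n" by metis
    have lim: "(\<lambda>n. 1 / real (Suc n)) \<longlonglongrightarrow> 0"
      using LIMSEQ_inverse_real_of_nat by (simp add: inverse_eq_divide)
    have "(\<lambda>n. nrm X (x n)) \<longlonglongrightarrow> 0"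
    proof (rule tendsto_sandwich[OF _ _ tendsto_const lim])
      show "\<forall>\<^sub>F n in sequentially. 0 \<le> nrm X (x n)" using X.nrm_ge0 xy by auto
      have "nrm X (x n) \<le> 1 / real (Suc n)" for n using xy(4)[of n] Y.nrm_ge0[OF xy(2)[of n]] by linarith
      then show "\<forall>\<^sub>F n in sequentially. nrm X (x n) \<le> 1 / real (Suc n)" by simp
    qed
    then have "conv X x 0" using xy by (simp add: conv_def)
    from X.conv_diff[OF this X.conv_const[OF xy(1)[of 0]]]
    have cx: "conv X (\<lambda>n. x n - x 0) (- x 0)" by simp
    have "(\<lambda>n. nrm Y (y n)) \<longlonglongrightarrow> 0"
    proof (rule tendsto_sandwich[OF _ _ tendsto_const lim])
      show "\<forall>\<^sub>F n in sequentially. 0 \<le> nrm Y (y n)" using Y.nrm_ge0 xy by auto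
      have "nrm Y (y n) \<le> 1 / real (Suc n)" for n using xy(4)[of n] X.nrm_ge0[OF xy(1)[of n]] by linarith
      then show "\<forall>\<^sub>F n in sequentially. nrm Y (y n) \<le> 1 / real (Suc n)" by simp
    qed
    then have "conv Y y 0" using xy by (simp add: conv_def)
    from Y.conv_diff[OF Y.conv_const[OF xy(2)[of 0]] this]
    have cy: "conv Y (\<lambda>n. y 0 - y n) (y 0)" by simp
    have "y 0 - y n = x n - x 0" for n
    proof -
      have "x n + y n = x 0 + y 0" using xy(3) by metis
      then show ?thesis by (simp add: algebra_simps)
    qed
    with cy have "conv Y (\<lambda>n. x n - x 0) (y 0)" by simp
    then have "- x 0 = y 0" using c cx by (simp add: consistent_def)
    then show "z = 0" using xy(3)[of 0] by (metis add.right_inverse)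
  next
    assume "z = 0"
    then show "nrm ?S z = 0" using Sigma_lower[of 0 0] Sigma_ge0[OF z] by simp
  qed
  have sc: "nrm ?S (s c z) \<le> cmod c * nrm ?S z" if z: "z \<in> carr ?S" for c z
  proof (rule field_le_epsilon)
    fix e :: real assume e: "e > 0"
    obtain x y where xy: "x \<in> carr X" "y \<in> carr Y" "x + y = z"
      "nrm X x + nrm Y y < nrm ?S z + e / (cmod c + 1)"
      using Sigma_approx[OF z, of "e / (cmod c + 1)"] e by (auto simp: add_nonneg_pos)
    have "nrm ?S (s c z) \<le> cmod c * (nrm X x + nrm Y y)"
      using Sigma_lower[of "s c x" "s c y"] xy
      by (auto simp: X.scale_right_distrib X.nrm_scale Y.nrm_scale algebra_simps X.in_scale Y.in_scale)
    also have "\<dots> \<le> cmod c * (nrm ?S z + e / (cmod c + 1))" using xy(4) by (intro mult_left_mono) auto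
    also have "\<dots> = cmod c * nrm ?S z + e * (cmod c / (cmod c + 1))" by (simp add: algebra_simps)
    also have "\<dots> \<le> cmod c * nrm ?S z + e * 1"
      using e by (intro add_left_mono mult_left_mono) (auto simp: divide_le_eq_1 add_nonneg_pos)
    finally show "nrm ?S (s c z) \<le> cmod c * nrm ?S z + e" by simp
  qed
  show "nrm ?S (s c z) = cmod c * nrm ?S z" if z: "z \<in> carr ?S" for c z
  proof (cases "c = 0")
    case True
    then show ?thesis using Sigma_lower[of 0 0] Sigma_ge0[of 0] X.subspace_0[OF Sigma_subspace] by simp
  next
    case False
    have "nrm ?S (s (1/c) (s c z)) \<le> cmod (1/c) * nrm ?S (s c z)"
      by (rule sc) (rule X.subspace_scale[OF Sigma_subspace z])
    then show ?thesis using sc[OF z, of c] False by (simp add: norm_divide field_simps)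
  qed
  show "nrm ?S (a + b) \<le> nrm ?S a + nrm ?S b" if ab: "a \<in> carr ?S" "b \<in> carr ?S" for a b
  proof (rule field_le_epsilon)
    fix e :: real assume e: "e > 0"
    obtain x y where xy: "x \<in> carr X" "y \<in> carr Y" "x + y = a" "nrm X x + nrm Y y < nrm ?S a + e/2"
      using Sigma_approx[OF ab(1), of "e/2"] e by auto
    obtain x' y' where xy': "x' \<in> carr X" "y' \<in> carr Y" "x' + y' = b" "nrm X x' + nrm Y y' < nrm ?S b + e/2"
      using Sigma_approx[OF ab(2), of "e/2"] e by auto
    have "a + b = (x + x') + (y + y')" using xy xy' by (simp add: algebra_simps)
    then have "nrm ?S (a + b) \<le> nrm X (x + x') + nrm Y (y + y')"
      using Sigma_lower[of "x + x'" "y + y'"] xy xy' by (simp add: X.in_add Y.in_add)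
    then show "nrm ?S (a + b) \<le> nrm ?S a + nrm ?S b + e"
      using X.nrm_tri[OF xy(1) xy'(1)] Y.nrm_tri[OF xy(2) xy'(2)] xy(4) xy'(4) by linarith
  qed
qed

end

lemma (in nvs) fast_cauchy:
  assumes u: "\<And>n. u n \<in> carr X" and d: "\<And>n. nrm X (u (Suc n) - u n) \<le> (1/2)^n"
  shows "cauchy X u"
  unfolding cauchy_def
proof (intro conjI allI impI u)
  have le: "nrm X (u (n + k) - u n) \<le> 2 * (1/2)^n - 2 * (1/2)^(n + k)" for n k
  proof (induction k)
    case (Suc k)
    have "nrm X (u (Suc (n + k)) - u n) \<le> (1/2)^(n + k) + nrm X (u (n + k) - u n)"
      using nrm_tri3[of "u (Suc (n + k))" "u (n + k)" "u n"] d[of "n + k"] u by fastforce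
    then show ?case using Suc by simp
  qed simp
  fix e :: real assume e: "e > 0"
  obtain N where N: "(1/2)^N < e/4" using real_arch_pow_inv[of "e/4" "1/2"] e by auto
  have b: "nrm X (u m - u N) \<le> 2 * (1/2)^N" if "m \<ge> N" for m
  proof -
    have "nrm X (u m - u N) \<le> 2 * (1/2)^N - 2 * (1/2)^m" using le[of N "m - N"] that by simp
    also have "\<dots> \<le> 2 * (1/2)^N" by simp
    finally show ?thesis .
  qed
  show "\<exists>N. \<forall>m\<ge>N. \<forall>n\<ge>N. nrm X (u m - u n) < e"
  proof (intro exI[of _ N] allI impI)
    fix m n assume "m \<ge> N" "n \<ge> N"
    then show "nrm X (u m - u n) < e"
      using b[of m] b[of n] nrm_tri3[OF u[of m] u[of N] u[of n]] nrm_commute[OF u u, of n N] N by linarith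
  qed
qed

context npair begin

text \<open>Consecutive differences of a fast subsequence split into parts of norm below
  \<open>(1/2)^k\<close>. Summing the parts separately gives Cauchy sequences in \<open>X\<close>
  and in \<open>Y\<close>, and the sum of their limits is the limit sought.\<close>

lemma Sigma_complete:
  assumes c: "consistent X Y" and X: "\<And>u. cauchy X u \<Longrightarrow> \<exists>x. conv X u x"
    and Y: "\<And>u. cauchy Y u \<Longrightarrow> \<exists>x. conv Y u x" and u: "cauchy (Sigma_space X Y) u"
  shows "\<exists>x. conv (Sigma_space X Y) u x"
proof -
  let ?S = "Sigma_space X Y"
  interpret S: nvs s ?S
    using Sigma_normed[OF c] by (simp add: nvs_def X.complex_vs_axioms nvs_axioms_def)
  obtain r where r: "strict_mono r" "\<And>k n. n \<ge> r k \<Longrightarrow> nrm ?S (u n - u (r k)) < (1/2)^k"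
    using S.cauchy_fast[OF u, of "\<lambda>k. (1/2)^k"] by auto
  have uS: "u n \<in> carr ?S" for n using u by (simp add: cauchy_def)
  have "\<exists>x y. x \<in> carr X \<and> y \<in> carr Y \<and> x + y = u (r (Suc k)) - u (r k) \<and> nrm X x + nrm Y y < (1/2)^k" for k
  proof -
    have "nrm ?S (u (r (Suc k)) - u (r k)) < (1/2)^k"
      using r(2)[of k "r (Suc k)"] strict_monoD[OF r(1), of k "Suc k"] by simp
    \<comment> \<open>The strict inequality leaves a positive slack, which is exactly the tolerance
      granted to the near-optimal splitting.\<close>
    then show ?thesis
      using Sigma_approx[OF S.in_diff[OF uS uS], of "(1/2)^k - nrm ?S (u (r (Suc k)) - u (r k))" "r (Suc k)" "r k"]
      by auto
  qed
  then obtain x y where xy: "\<And>k. x k \<in> carr X" "\<And>k. y k \<in> carr Y"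
    "\<And>k. x k + y k = u (r (Suc k)) - u (r k)" "\<And>k. nrm X (x k) + nrm Y (y k) < (1/2)^k" by metis
  obtain x0 y0 where xy0: "x0 \<in> carr X" "y0 \<in> carr Y" "x0 + y0 = u (r 0)"
    using uS[of "r 0"] by (auto simp: Sigma_carr)
  define a where "a = rec_nat x0 (\<lambda>k z. z + x k)"
  define b where "b = rec_nat y0 (\<lambda>k z. z + y k)"
  have a: "a 0 = x0" "a (Suc k) = a k + x k" and b: "b 0 = y0" "b (Suc k) = b k + y k" for k
    by (simp_all add: a_def b_def)
  have aX: "a k \<in> carr X" and bY: "b k \<in> carr Y" for k
    by (induction k) (auto simp: a b xy xy0)
  have sum: "a k + b k = u (r k)" for k
  proof (induction k)
    case (Suc k)
    have "a (Suc k) + b (Suc k) = (a k + b k) + (x k + y k)" by (simp add: a b algebra_simps)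
    then show ?case using Suc xy(3)[of k] by simp
  qed (simp add: a b xy0)
  have "nrm X (x k) \<le> (1/2)^k" "nrm Y (y k) \<le> (1/2)^k" for k
    using xy(4)[of k] X.nrm_ge0[OF xy(1)[of k]] Y.nrm_ge0[OF xy(2)[of k]] by linarith+
  then have "cauchy X a" "cauchy Y b"
    using aX bY by (auto simp: a b intro!: X.fast_cauchy Y.fast_cauchy)
  then obtain p q where p: "conv X a p" and q: "conv Y b q" using X Y by blast
  have pq: "p \<in> carr X" "q \<in> carr Y" using X.convD[OF p] Y.convD[OF q] by auto
  have "(\<lambda>k. nrm ?S (u (r k) - (p + q))) \<longlonglongrightarrow> 0"
  proof (rule tendsto_sandwich[OF _ _ tendsto_const])
    show "(\<lambda>k. nrm X (a k - p) + nrm Y (b k - q)) \<longlonglongrightarrow> 0"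
      using tendsto_add[of _ 0 _ _ 0] p q by (auto simp: conv_def)
    have pqS: "p + q \<in> carr ?S" using pq by (auto simp: Sigma_carr)
    then show "\<forall>\<^sub>F k in sequentially. 0 \<le> nrm ?S (u (r k) - (p + q))"
      using uS by (auto intro!: always_eventually Sigma_ge0)
    have "nrm ?S (u (r k) - (p + q)) \<le> nrm X (a k - p) + nrm Y (b k - q)" for k
    proof -
      have e: "u (r k) - (p + q) = (a k - p) + (b k - q)" by (simp add: sum[symmetric])
      show ?thesis unfolding e using aX bY pq by (intro Sigma_lower) auto
    qed
    then show "\<forall>\<^sub>F k in sequentially. nrm ?S (u (r k) - (p + q)) \<le> nrm X (a k - p) + nrm Y (b k - q)"
      by simp
  qed
  then have "conv ?S (\<lambda>k. u (r k)) (p + q)" using uS pq by (auto simp: conv_def Sigma_carr)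
  from S.cauchy_subseq_conv[OF u r(1) this] show ?thesis ..
qed

end

lemma hilbert_compatible_pairI:
  assumes s: "vector_space s" and X: "hilbert_space s X" and Y: "hilbert_space s Y"
    and c: "consistent X Y"
  shows "hilbert_compatible_pair s X Y"
proof -
  have bX: "banach_space s X" and bY: "banach_space s Y" using X Y by (auto simp: hilbert_space_def)
  interpret npair s X Y
    using s bX bY by (auto simp: npair_def nvs_def complex_vs_def nvs_axioms_def banach_space_def)
  have "\<And>u. cauchy X u \<Longrightarrow> \<exists>x. conv X u x" "\<And>u. cauchy Y u \<Longrightarrow> \<exists>x. conv Y u x"
    using bX bY by (auto simp: banach_iff[OF s])
  then show ?thesis
    unfolding hilbert_compatible_pair_def banach_iff[OF s]
    using s X Y Delta_normed Sigma_normed[OF c] Delta_complete[OF c] Sigma_complete[OF c] by blast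
qed

section \<open>Integrals of K-functionals\<close>

text \<open>The integral in \<open>K_integral\<close> as a functional of an arbitrary function of
  \<open>t\<close>, so that scalar models, K-functionals on spans and their limits can be compared
  with one another.\<close>

definition wint :: "real \<Rightarrow> (real \<Rightarrow> real) \<Rightarrow> ennreal" where
  "wint \<theta> f = (\<integral>\<^sup>+t\<in>{0<..}. ennreal (\<bar>t powr (- \<theta>) * f t\<bar>\<^sup>2 / t) \<partial>lborel)"

text \<open>K-functionals are controlled only for \<open>t > 0\<close>, which is all that the
  integral sees; the indicator masks the remaining values.\<close>

definition posmeas :: "(real \<Rightarrow> real) \<Rightarrow> bool" where
  "posmeas f \<longleftrightarrow> (\<lambda>t. indicator {0<..} t * f t) \<in> borel_measurable borel"

text \<open>The monotonicity properties shared by all K-functionals as functions of \<open>t\<close>.\<close>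
definition klike :: "(real \<Rightarrow> real) \<Rightarrow> bool" where
  "klike f \<longleftrightarrow> (\<forall>t>0. 0 \<le> f t) \<and> (\<forall>s t. 0 < s \<longrightarrow> s \<le> t \<longrightarrow> f s \<le> f t \<and> s * f t \<le> t * f s)"

lemma klikeD:
  assumes "klike f"
  shows "t > 0 \<Longrightarrow> 0 \<le> f t" "0 < s \<Longrightarrow> s \<le> t \<Longrightarrow> f s \<le> f t" "0 < s \<Longrightarrow> s \<le> t \<Longrightarrow> s * f t \<le> t * f s"
  using assms by (auto simp: klike_def)

lemma klike_posmeas: assumes "klike f" shows "posmeas f"
proof -
  have "mono_on {0<..} f" using assms by (auto simp: klike_def mono_on_def)
  then have "f \<in> borel_measurable (restrict_space borel {0<..})" by (rule borel_measurable_mono_on_fnc)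
  then show ?thesis unfolding posmeas_def by (subst (asm) borel_measurable_restrict_space_iff) simp_all
qed

lemma wint_alt: "wint \<theta> f = (\<integral>\<^sup>+t. ennreal (t powr (- (2 * \<theta>) - 1) * (indicator {0<..} t * f t)\<^sup>2) \<partial>lborel)"
  unfolding wint_def
proof (rule nn_integral_cong)
  fix t :: real
  show "ennreal (\<bar>t powr (- \<theta>) * f t\<bar>\<^sup>2 / t) * indicator {0<..} t
    = ennreal (t powr (- (2 * \<theta>) - 1) * (indicator {0<..} t * f t)\<^sup>2)"
  proof (cases "t > 0")
    case True
    have "(t powr (- \<theta>))\<^sup>2 = t powr (- 2 * \<theta>)"
      using True by (simp add: power2_eq_square powr_add[symmetric])
    moreover have "t powr (- (2 * \<theta>) - 1) = t powr (- 2 * \<theta>) / t"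
      using True by (simp add: powr_diff)
    ultimately show ?thesis using True by (simp add: power_mult_distrib)
  qed simp
qed

lemma wint_mono: assumes "\<And>t. t > 0 \<Longrightarrow> \<bar>f t\<bar> \<le> \<bar>g t\<bar>" shows "wint \<theta> f \<le> wint \<theta> g"
  unfolding wint_def
proof (rule nn_integral_mono)
  fix t :: real
  show "ennreal (\<bar>t powr (- \<theta>) * f t\<bar>\<^sup>2 / t) * indicator {0<..} t
    \<le> ennreal (\<bar>t powr (- \<theta>) * g t\<bar>\<^sup>2 / t) * indicator {0<..} t"
  proof (cases "t > 0")
    case True
    have "\<bar>t powr (- \<theta>) * f t\<bar>\<^sup>2 / t \<le> \<bar>t powr (- \<theta>) * g t\<bar>\<^sup>2 / t"
      using True assms[OF True] by (intro divide_right_mono power_mono) (auto simp: abs_mult intro!: mult_left_mono)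
    then show ?thesis using True by (simp add: ennreal_leI)
  qed simp
qed

lemma wint_integrand_measurable:
  assumes "posmeas f"
  shows "(\<lambda>t. t powr (- (2 * \<theta>) - 1) * (indicator {0<..} t * f t)\<^sup>2) \<in> borel_measurable borel"
proof -
  have [measurable]: "(\<lambda>t. indicator {0<..} t * f t) \<in> borel_measurable borel"
    using assms by (simp add: posmeas_def)
  show ?thesis by measurable
qed

lemma wint_square_sum:
  assumes "posmeas f" "posmeas g" "\<alpha> \<ge> 0" "\<beta> \<ge> 0"
    and h: "\<And>t. t > 0 \<Longrightarrow> (h t)\<^sup>2 = \<alpha> * (f t)\<^sup>2 + \<beta> * (g t)\<^sup>2"
  shows "wint \<theta> h = ennreal \<alpha> * wint \<theta> f + ennreal \<beta> * wint \<theta> g"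
proof -
  define W where "W u t = ennreal (t powr (- (2 * \<theta>) - 1) * (indicator {0<..} t * u t)\<^sup>2)" for u t
  have wint: "wint \<theta> u = (\<integral>\<^sup>+t. W u t \<partial>lborel)" for u unfolding wint_alt W_def ..
  have [measurable]: "W f \<in> borel_measurable borel" "W g \<in> borel_measurable borel"
    unfolding W_def using assms(1,2) by (simp_all only: wint_integrand_measurable[THEN measurable_compose, OF _ measurable_ennreal])
  have "W h t = ennreal \<alpha> * W f t + ennreal \<beta> * W g t" for t
  proof -
    have "t powr (- (2 * \<theta>) - 1) * (indicator {0<..} t * h t)\<^sup>2
       = \<alpha> * (t powr (- (2 * \<theta>) - 1) * (indicator {0<..} t * f t)\<^sup>2) + \<beta> * (t powr (- (2 * \<theta>) - 1) * (indicator {0<..} t * g t)\<^sup>2)"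
      by (cases "t > 0") (simp_all add: h algebra_simps)
    then show ?thesis using assms(3,4) by (simp add: W_def ennreal_plus ennreal_mult)
  qed
  then show ?thesis by (simp add: wint nn_integral_add nn_integral_cmult)
qed

lemma wint_cmult: assumes "posmeas f" shows "wint \<theta> (\<lambda>t. c * f t) = ennreal (c\<^sup>2) * wint \<theta> f"
  using wint_square_sum[OF assms assms, of "c\<^sup>2" 0 "\<lambda>t. c * f t" \<theta>] by (simp add: power_mult_distrib)

lemma wint_zero[simp]: "wint \<theta> (\<lambda>t. 0) = 0" by (simp add: wint_def)

lemma wint_sum:
  assumes "finite E" "\<And>e. e \<in> E \<Longrightarrow> posmeas (f e)" "\<And>e. e \<in> E \<Longrightarrow> \<alpha> e \<ge> 0"
  shows "wint \<theta> (\<lambda>t. sqrt (\<Sum>e\<in>E. \<alpha> e * (f e t)\<^sup>2)) = (\<Sum>e\<in>E. ennreal (\<alpha> e) * wint \<theta> (f e))"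
proof -
  define W where "W u t = ennreal (t powr (- (2 * \<theta>) - 1) * (indicator {0<..} t * u t)\<^sup>2)" for u t
  have wint: "wint \<theta> u = (\<integral>\<^sup>+t. W u t \<partial>lborel)" for u unfolding wint_alt W_def ..
  have W: "W (f e) \<in> borel_measurable borel" if "e \<in> E" for e
    unfolding W_def using assms(2)[OF that] by (simp only: wint_integrand_measurable[THEN measurable_compose, OF _ measurable_ennreal])
  have "W (\<lambda>t. sqrt (\<Sum>e\<in>E. \<alpha> e * (f e t)\<^sup>2)) t = (\<Sum>e\<in>E. ennreal (\<alpha> e) * W (f e) t)" for t
  proof -
    have 0: "(\<Sum>e\<in>E. \<alpha> e * (f e t)\<^sup>2) \<ge> 0" using assms(3) by (intro sum_nonneg) auto
    have "t powr (- (2 * \<theta>) - 1) * (indicator {0<..} t * sqrt (\<Sum>e\<in>E. \<alpha> e * (f e t)\<^sup>2))\<^sup>2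
       = (\<Sum>e\<in>E. \<alpha> e * (t powr (- (2 * \<theta>) - 1) * (indicator {0<..} t * f e t)\<^sup>2))"
      using 0 by (cases "t > 0") (simp_all add: sum_distrib_left mult_ac)
    then show ?thesis using assms(3) by (simp add: W_def sum_ennreal[symmetric] ennreal_mult)
  qed
  then show ?thesis using W by (simp add: wint nn_integral_sum nn_integral_cmult)
qed

text \<open>On \<open>{s..2 * s}\<close>, an interval of length \<open>s\<close>, the function is at
  least \<open>f s\<close> and the power is at least its value at \<open>2 * s\<close>. This
  controls a K-functional at single points by its integral.\<close>

lemma wint_lower:
  assumes f: "klike f" and s: "s > 0" and \<theta>: "\<theta> \<ge> 0"
  shows "ennreal (2 powr (- (2 * \<theta>) - 1) * (s powr (- \<theta>) * f s)\<^sup>2) \<le> wint \<theta> f"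
proof -
  define c where "c = (2 * s) powr (- (2 * \<theta>) - 1) * (f s)\<^sup>2"
  have c0: "c \<ge> 0" by (simp add: c_def)
  have "2 powr (- (2 * \<theta>) - 1) * (s powr (- \<theta>) * f s)\<^sup>2 = c * s"
  proof -
    have "(s powr (- \<theta>))\<^sup>2 = s powr (- (2 * \<theta>) - 1) * s"
      using s by (simp add: power2_eq_square powr_add[symmetric] powr_diff)
    then show ?thesis using s by (simp add: c_def powr_mult power_mult_distrib)
  qed
  also have "ennreal (c * s) = (\<integral>\<^sup>+t. ennreal c * indicator {s..2 * s} t \<partial>lborel)"
    using c0 s by (simp add: nn_integral_cmult_indicator ennreal_mult)
  also have "\<dots> \<le> wint \<theta> f"
    unfolding wint_alt
  proof (rule nn_integral_mono)
    fix t :: real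
    show "ennreal c * indicator {s..2 * s} t \<le> ennreal (t powr (- (2 * \<theta>) - 1) * (indicator {0<..} t * f t)\<^sup>2)"
    proof (cases "t \<in> {s..2 * s}")
      case True
      have "c \<le> t powr (- (2 * \<theta>) - 1) * (f t)\<^sup>2"
        unfolding c_def using True s \<theta> klikeD[OF f]
        by (intro mult_mono powr_mono2' power_mono) auto
      then show ?thesis using True s by (simp add: ennreal_leI)
    qed simp
  qed
  finally show ?thesis .
qed

lemma wint_dominated:
  assumes f: "\<And>n. posmeas (f n)" and f': "posmeas f'" and g: "posmeas g" "wint \<theta> g < \<infinity>"
    and bd: "\<And>n t. t > 0 \<Longrightarrow> \<bar>f n t\<bar> \<le> \<bar>g t\<bar>" and lim: "\<And>t. t > 0 \<Longrightarrow> (\<lambda>n. f n t) \<longlonglongrightarrow> f' t"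
  shows "(\<lambda>n. wint \<theta> (f n)) \<longlonglongrightarrow> wint \<theta> f'"
  unfolding wint_alt
proof (rule nn_integral_dominated_convergence[where w = "\<lambda>t. ennreal (t powr (- (2 * \<theta>) - 1) * (indicator {0<..} t * g t)\<^sup>2)"])
  show "AE t in lborel. ennreal (t powr (- (2 * \<theta>) - 1) * (indicator {0<..} t * f n t)\<^sup>2)
          \<le> ennreal (t powr (- (2 * \<theta>) - 1) * (indicator {0<..} t * g t)\<^sup>2)" for n
  proof (intro AE_I2 ennreal_leI mult_left_mono)
    fix t show "(indicator {0<..} t * f n t)\<^sup>2 \<le> (indicator {0<..} t * g t)\<^sup>2"
      using bd[of t n] by (cases "t > 0") (auto simp: abs_le_square_iff)
  qed simp
  show "AE t in lborel. (\<lambda>n. ennreal (t powr (- (2 * \<theta>) - 1) * (indicator {0<..} t * f n t)\<^sup>2))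
     \<longlonglongrightarrow> ennreal (t powr (- (2 * \<theta>) - 1) * (indicator {0<..} t * f' t)\<^sup>2)"
  proof (rule AE_I2)
    fix t :: real
    show "(\<lambda>n. ennreal (t powr (- (2 * \<theta>) - 1) * (indicator {0<..} t * f n t)\<^sup>2))
     \<longlonglongrightarrow> ennreal (t powr (- (2 * \<theta>) - 1) * (indicator {0<..} t * f' t)\<^sup>2)"
      by (cases "t > 0") (auto intro!: tendsto_ennrealI tendsto_intros lim)
  qed
  show "(\<integral>\<^sup>+t. ennreal (t powr (- (2 * \<theta>) - 1) * (indicator {0<..} t * g t)\<^sup>2) \<partial>lborel) < \<infinity>"
    using g(2) by (simp add: wint_alt)
qed (use f f' g in \<open>auto intro: wint_integrand_measurable\<close>)

lemma wint_fatou: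
  assumes f: "\<And>n. posmeas (f n)" and bd: "\<And>n. wint \<theta> (f n) \<le> C"
    and lim: "\<And>t. t > 0 \<Longrightarrow> (\<lambda>n. f n t) \<longlonglongrightarrow> f' t"
  shows "wint \<theta> f' \<le> C"
proof -
  let ?w = "\<lambda>f t. ennreal (t powr (- (2 * \<theta>) - 1) * (indicator {0<..} t * f t)\<^sup>2)"
  have "(\<lambda>n. ?w (f n) t) \<longlonglongrightarrow> ?w f' t" for t :: real
    by (cases "t > 0") (auto intro!: tendsto_ennrealI tendsto_intros lim)
  then have "liminf (\<lambda>n. ?w (f n) t) = ?w f' t" for t by (intro lim_imp_Liminf) auto
  then have "wint \<theta> f' = (\<integral>\<^sup>+t. liminf (\<lambda>n. ?w (f n) t) \<partial>lborel)" by (simp add: wint_alt)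
  also have "\<dots> \<le> liminf (\<lambda>n. \<integral>\<^sup>+t. ?w (f n) t \<partial>lborel)"
    using f by (intro nn_integral_liminf) (auto intro: wint_integrand_measurable)
  also have "\<dots> \<le> C"
  proof -
    have "(\<integral>\<^sup>+t. ?w (f n) t \<partial>lborel) \<le> C" for n using bd[of n] by (simp add: wint_alt)
    then have "liminf (\<lambda>n. \<integral>\<^sup>+t. ?w (f n) t \<partial>lborel) \<le> liminf (\<lambda>n. C)"
      by (intro Liminf_mono) auto
    then show ?thesis by (simp add: Liminf_const)
  qed
  finally show ?thesis .
qed

text \<open>The right-hand side is smallest at \<delta> equal to \<open>sqrt G / sqrt F\<close>,
  where it is the square of \<open>sqrt F + sqrt G\<close>. The shifts by
  \<open>\<epsilon>/2\<close> keep this ratio defined and positive when \<open>F\<close> or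
  \<open>G\<close> vanishes.\<close>

lemma sqrt_subadd_of_weighted:
  fixes H F G :: real
  assumes "F \<ge> 0" "G \<ge> 0" "\<And>\<delta>. \<delta> > 0 \<Longrightarrow> H \<le> (1 + \<delta>) * F + (1 + 1/\<delta>) * G"
  shows "sqrt H \<le> sqrt F + sqrt G"
proof (rule field_le_epsilon)
  fix \<epsilon> :: real assume e: "\<epsilon> > 0"
  define p q where "p = sqrt F + \<epsilon>/2" and "q = sqrt G + \<epsilon>/2"
  have pq: "p > 0" "q > 0" using assms e by (auto simp: p_def q_def add_nonneg_pos)
  have "F \<le> p\<^sup>2" "G \<le> q\<^sup>2"
    using power_mono[of "sqrt F" p 2] power_mono[of "sqrt G" q 2] assms e by (auto simp: p_def q_def)
  have "H \<le> (1 + q/p) * F + (1 + 1/(q/p)) * G" using assms(3)[of "q/p"] pq by simp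
  also have "\<dots> \<le> (1 + q/p) * p\<^sup>2 + (1 + 1/(q/p)) * q\<^sup>2"
    using pq \<open>F \<le> p\<^sup>2\<close> \<open>G \<le> q\<^sup>2\<close> by (intro add_mono mult_left_mono) auto
  also have "\<dots> = (p + q)\<^sup>2" using pq by (simp add: field_simps power2_eq_square)
  finally have "sqrt H \<le> p + q" using pq by (simp add: real_le_lsqrt)
  then show "sqrt H \<le> sqrt F + sqrt G + \<epsilon>" by (simp add: p_def q_def)
qed

text \<open>Minkowski's inequality: the pointwise bound with weights \<open>1 + \<delta>\<close> and
  \<open>1 + 1/\<delta>\<close> integrates term by term, and \<open>sqrt_subadd_of_weighted\<close>
  optimizes \<delta> afterwards.\<close>

lemma wint_triangle:
  assumes f: "posmeas f" "wint \<theta> f < \<infinity>" and g: "posmeas g" "wint \<theta> g < \<infinity>"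
    and h: "\<And>t. t > 0 \<Longrightarrow> 0 \<le> h t" "\<And>t. t > 0 \<Longrightarrow> h t \<le> f t + g t"
  shows "wint \<theta> h < \<infinity>"
    "sqrt (enn2real (wint \<theta> h)) \<le> sqrt (enn2real (wint \<theta> f)) + sqrt (enn2real (wint \<theta> g))"
proof -
  define F G where "F = enn2real (wint \<theta> f)" and "G = enn2real (wint \<theta> g)"
  have FG: "wint \<theta> f = ennreal F" "wint \<theta> g = ennreal G" "F \<ge> 0" "G \<ge> 0"
    using f(2) g(2) by (auto simp: F_def G_def)
  have le: "wint \<theta> h \<le> ennreal ((1 + \<delta>) * F + (1 + 1/\<delta>) * G)" if d: "\<delta> > 0" for \<delta>
  proof -
    have "wint \<theta> h \<le> wint \<theta> (\<lambda>t. sqrt ((1 + \<delta>) * (f t)\<^sup>2 + (1 + 1/\<delta>) * (g t)\<^sup>2))"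
    proof (rule wint_mono)
      fix t :: real assume t: "t > 0"
      have "0 \<le> (\<delta> * f t - g t)\<^sup>2 / \<delta>" using d by simp
      also have "\<dots> = \<delta> * (f t)\<^sup>2 + (1/\<delta>) * (g t)\<^sup>2 - 2 * f t * g t"
        using d by (simp add: field_simps power2_eq_square)
      finally have "(f t + g t)\<^sup>2 \<le> (1 + \<delta>) * (f t)\<^sup>2 + (1 + 1/\<delta>) * (g t)\<^sup>2"
        by (simp add: power2_eq_square algebra_simps)
      moreover have "(h t)\<^sup>2 \<le> (f t + g t)\<^sup>2" using h[OF t] by (intro power_mono) auto
      ultimately show "\<bar>h t\<bar> \<le> \<bar>sqrt ((1 + \<delta>) * (f t)\<^sup>2 + (1 + 1/\<delta>) * (g t)\<^sup>2)\<bar>"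
        using h(1)[OF t] d by (simp add: real_le_rsqrt)
    qed
    also have "\<dots> = ennreal (1 + \<delta>) * wint \<theta> f + ennreal (1 + 1/\<delta>) * wint \<theta> g"
      by (rule wint_square_sum[OF f(1) g(1)]) (use d in auto)
    also have "\<dots> = ennreal ((1 + \<delta>) * F + (1 + 1/\<delta>) * G)"
      using FG d by (simp add: ennreal_mult ennreal_plus del: ennreal_plus)
         (metis ennreal_mult ennreal_plus add_nonneg_nonneg mult_nonneg_nonneg divide_nonneg_nonneg less_imp_le zero_le_one)
    finally show ?thesis .
  qed
  show fin: "wint \<theta> h < \<infinity>" using le[of 1] by (auto intro: le_less_trans)
  have "enn2real (wint \<theta> h) \<le> (1 + \<delta>) * F + (1 + 1/\<delta>) * G" if d: "\<delta> > 0" for \<delta>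
    using enn2real_mono[OF le[OF d]] d FG by (simp del: ennreal_plus)
  then show "sqrt (enn2real (wint \<theta> h)) \<le> sqrt (enn2real (wint \<theta> f)) + sqrt (enn2real (wint \<theta> g))"
    unfolding F_def[symmetric] G_def[symmetric] by (rule sqrt_subadd_of_weighted[OF FG(3,4)])
qed

section \<open>The scalar model and its Beta integral\<close>

lemma Gamma_reflection_real: "Gamma x * Gamma (1 - x) = pi / sin (pi * x)" for x :: real
proof -
  have "complex_of_real (Gamma x * Gamma (1 - x)) = Gamma (complex_of_real x) * Gamma (1 - complex_of_real x)"
    by (simp add: Gamma_complex_of_real[symmetric])
  also have "\<dots> = complex_of_real (pi / sin (pi * x))"
    unfolding Gamma_reflection_complex by (simp add: sin_of_real[symmetric])
  finally show ?thesis by (simp only: of_real_eq_iff)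
qed

text \<open>The K-functional of two scalar multiples of one norm; the substitution
  \<open>s = t\<^sup>2b / (a + t\<^sup>2b)\<close> turns its integral into \<open>B(1 - \<theta>, \<theta>)\<close>.\<close>
definition kscal :: "real \<Rightarrow> real \<Rightarrow> real \<Rightarrow> real" where
  "kscal a b t = sqrt (t\<^sup>2 * a * b / (a + t\<^sup>2 * b))"

lemma klike_kscal: assumes "a > 0" "b > 0" shows "klike (kscal a b)"
  unfolding klike_def
proof (intro conjI allI impI)
  fix t :: real assume "t > 0" then show "0 \<le> kscal a b t" using assms by (simp add: kscal_def)
next
  fix s t :: real assume st: "0 < s" "s \<le> t"
  have sq: "s\<^sup>2 \<le> t\<^sup>2" using st by (intro power_mono) auto
  have pos: "0 < a + s\<^sup>2 * b" "0 < a + t\<^sup>2 * b" using assms by (auto intro!: add_pos_nonneg)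
  have "s\<^sup>2 * a * b * (a + t\<^sup>2 * b) \<le> t\<^sup>2 * a * b * (a + s\<^sup>2 * b)"
    using mult_left_mono[OF sq, of "a * a * b"] assms by (simp add: algebra_simps)
  then show "kscal a b s \<le> kscal a b t"
    using pos by (simp add: kscal_def frac_le_eq divide_le_0_iff field_simps)
  have e1: "s * kscal a b t = sqrt (s\<^sup>2 * t\<^sup>2 * (a * b) / (a + t\<^sup>2 * b))"
    using st by (simp add: kscal_def real_sqrt_mult real_sqrt_divide mult_ac)
  have e2: "t * kscal a b s = sqrt (s\<^sup>2 * t\<^sup>2 * (a * b) / (a + s\<^sup>2 * b))"
    using st by (simp add: kscal_def real_sqrt_mult real_sqrt_divide mult_ac)
  show "s * kscal a b t \<le> t * kscal a b s"
    unfolding e1 e2 using pos assms sq by (intro real_sqrt_le_mono divide_left_mono) auto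
qed

lemma wint_kscal:
  assumes a: "a > 0" and b: "b > 0" and th: "0 < \<theta>" "\<theta> < 1"
  shows "wint \<theta> (kscal a b) = ennreal (a powr (1 - \<theta>) * b powr \<theta> * (pi / (2 * sin (pi * \<theta>))))"
proof -
  define D where "D t = a + t\<^sup>2 * b" for t
  define g where "g t = t\<^sup>2 * b / D t" for t
  define g' where "g' t = 2 * a * b * t / (D t)\<^sup>2" for t
  \<comment> \<open>The integrand of \<open>Beta (1 - \<theta>) \<theta>\<close>, to be pulled back
    along the substitution \<open>g\<close>.\<close>
  define f where "f u = u powr (- \<theta>) * (1 - u) powr (\<theta> - 1)" for u :: real
  have D: "D t > 0" for t using a b by (auto simp: D_def intro!: add_pos_nonneg)
  have der: "(g has_field_derivative g' t) (at t within {0<..})" for t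
  proof -
    have "D t \<noteq> 0" using D[of t] by simp
    then have "a + t\<^sup>2 * b \<noteq> 0" by (simp add: D_def)
    then show ?thesis
      unfolding g_def g'_def D_def
      by (auto intro!: derivative_eq_intros simp: power2_eq_square algebra_simps)
  qed
  have g1: "1 - g t = a / D t" for t using D[of t] by (simp add: g_def field_simps) (simp add: D_def)
  have inj: "inj_on g {0<..}"
  proof (rule inj_onI)
    fix x y assume xy: "x \<in> {0<..}" "y \<in> {0<..}" "g x = g y"
    then have "a / D x = a / D y" by (simp only: g1[symmetric])
    then have "D x = D y" using a by (metis divide_cancel_left less_irrefl)
    then have "x\<^sup>2 = y\<^sup>2" using b by (simp add: D_def)
    then show "x = y" using xy by (simp add: power2_eq_iff_nonneg)
  qed
  have img: "g ` {0<..} = {0<..<1}"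
  proof (intro equalityI subsetI)
    fix u assume "u \<in> g ` {0<..}"
    then obtain t where t: "t > 0" "u = g t" by auto
    have "g t > 0" using t D[of t] b by (simp add: g_def)
    moreover have "1 - g t > 0" unfolding g1 using a D[of t] by simp
    ultimately show "u \<in> {0<..<1}" using t by simp
  next
    fix u :: real assume u: "u \<in> {0<..<1}"
    \<comment> \<open>The positive solution of \<open>g t = u\<close>.\<close>
    define t where "t = sqrt (a * u / (b * (1 - u)))"
    have t: "t > 0" using u a b by (simp add: t_def)
    have t2: "t\<^sup>2 = a * u / (b * (1 - u))" using u a b by (simp add: t_def)
    have Dt: "D t = a / (1 - u)" unfolding D_def t2 using u b by (simp add: field_simps)
    have "g t = u" unfolding g_def Dt t2 using u a b by (simp add: field_simps)
    then show "u \<in> g ` {0<..}" using t by auto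
  qed
  have "Beta (1 - \<theta>) \<theta> = pi / sin (pi * \<theta>)"
    using Gamma_reflection_real[of \<theta>] by (simp add: Beta_def mult.commute)
  then have fint: "(f has_integral pi / sin (pi * \<theta>)) {0<..<1}"
    using has_integral_Beta_real[of "1 - \<theta>" \<theta>] th unfolding f_def
    by (simp add: has_integral_Icc_iff_Ioo)
  then have "f absolutely_integrable_on {0<..<1}"
    by (intro nonnegative_absolutely_integrable_1) (auto simp: f_def integrable_on_def)
  then have "(\<lambda>t. \<bar>g' t\<bar> * f (g t)) absolutely_integrable_on {0<..}"
     "integral {0<..} (\<lambda>t. \<bar>g' t\<bar> * f (g t)) = pi / sin (pi * \<theta>)"
    using has_absolute_integral_change_of_variables_1'[of "{0<..}" g g' f "pi / sin (pi * \<theta>)"]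
      der inj img fint by (auto simp: integral_unique)
  then have "((\<lambda>t. \<bar>g' t\<bar> * f (g t)) has_integral pi / sin (pi * \<theta>)) {0<..}"
    by (metis absolutely_integrable_on_def integrable_integral)
  \<comment> \<open>The factor compares the two integrands: its powers of \<open>a\<close> and
    \<open>b\<close> cancel those in \<open>f (g t)\<close>, and the 2 is the one in
    \<open>g'\<close>.\<close>
  from has_integral_mult_right[OF this, of "a powr (1 - \<theta>) * b powr \<theta> / 2"]
  have hi: "((\<lambda>t. \<bar>t powr (- \<theta>) * kscal a b t\<bar>\<^sup>2 / t)
     has_integral a powr (1 - \<theta>) * b powr \<theta> / 2 * (pi / sin (pi * \<theta>))) {0<..}"
  proof (rule has_integral_eq[rotated])
    fix t :: real assume "t \<in> {0<..}"
    then have t: "t > 0" by simp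
    note Dt = D[of t]
    have t2: "(t\<^sup>2) powr (- \<theta>) = (t powr (- \<theta>))\<^sup>2"
      using t by (simp add: power2_eq_square powr_mult)
    have DD: "D t powr \<theta> * D t powr (1 - \<theta>) = D t" using Dt by (simp add: powr_add[symmetric])
    have gp: "g t powr (- \<theta>) = (t powr (- \<theta>))\<^sup>2 * b powr (- \<theta>) * D t powr \<theta>"
    proof -
      have "g t powr (- \<theta>) = (t\<^sup>2) powr (- \<theta>) * b powr (- \<theta>) / D t powr (- \<theta>)"
        unfolding g_def using t b Dt by (simp only: powr_divide powr_mult mult_nonneg_nonneg less_imp_le zero_le_power2)
      then show ?thesis unfolding t2 using powr_minus[of "D t" \<theta>] by (simp add: divide_inverse)
    qed
    have ap: "(1 - g t) powr (\<theta> - 1) = a powr (\<theta> - 1) * D t powr (1 - \<theta>)"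
      unfolding g1 using a Dt powr_minus_divide[of "D t" "1 - \<theta>"] by (simp add: powr_divide)
    have aa: "a powr (1 - \<theta>) * a powr (\<theta> - 1) = 1" using a by (simp add: powr_add[symmetric])
    have bb: "b powr \<theta> * b powr (- \<theta>) = 1" using b by (simp add: powr_add[symmetric])
    have "f (g t) = (t powr (- \<theta>))\<^sup>2 * b powr (- \<theta>) * a powr (\<theta> - 1) * (D t powr \<theta> * D t powr (1 - \<theta>))"
      unfolding f_def gp ap by (simp add: mult_ac)
    then have fg: "f (g t) = (t powr (- \<theta>))\<^sup>2 * b powr (- \<theta>) * a powr (\<theta> - 1) * D t" unfolding DD .
    have "a powr (1 - \<theta>) * b powr \<theta> / 2 * (\<bar>g' t\<bar> * f (g t))
      = (a powr (1 - \<theta>) * a powr (\<theta> - 1)) * (b powr \<theta> * b powr (- \<theta>)) * ((t powr (- \<theta>))\<^sup>2 * (g' t * D t / 2))"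
      unfolding fg using t a b by (simp add: g'_def mult_ac)
    also have "g' t * D t / 2 = t * a * b / D t" using Dt by (simp add: g'_def power2_eq_square)
    also have "(a powr (1 - \<theta>) * a powr (\<theta> - 1)) * (b powr \<theta> * b powr (- \<theta>)) * ((t powr (- \<theta>))\<^sup>2 * (t * a * b / D t))
      = (t powr (- \<theta>))\<^sup>2 * (t\<^sup>2 * a * b / D t) / t"
      unfolding aa bb using t by (simp add: power2_eq_square)
    also have "t\<^sup>2 * a * b / D t = (kscal a b t)\<^sup>2" using Dt a b by (simp add: kscal_def D_def)
    finally show "a powr (1 - \<theta>) * b powr \<theta> / 2 * (\<bar>g' t\<bar> * f (g t)) = \<bar>t powr (- \<theta>) * kscal a b t\<bar>\<^sup>2 / t"
      by (simp add: power_mult_distrib)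
  qed
  have "wint \<theta> (kscal a b) = ennreal (a powr (1 - \<theta>) * b powr \<theta> / 2 * (pi / sin (pi * \<theta>)))"
    unfolding wint_def by (rule nn_integral_has_integral_lebesgue'[OF _ hi]) simp
  then show ?thesis by simp
qed

lemma sin_pi_pos: "0 < \<theta> \<Longrightarrow> \<theta> < 1 \<Longrightarrow> sin (pi * \<theta>) > 0"
  by (rule sin_gt_zero) auto

lemma N_const_pos: "0 < \<theta> \<Longrightarrow> \<theta> < 1 \<Longrightarrow> N_const \<theta> > 0"
  using sin_pi_pos by (simp add: N_const_def)

text \<open>This identity is the reason for the normalization: it cancels the value of the Beta
  integral in \<open>wint_kscal\<close>, so that interpolating weights leaves no constant
  behind.\<close>

lemma N_const_sq: "0 < \<theta> \<Longrightarrow> \<theta> < 1 \<Longrightarrow> (N_const \<theta>)\<^sup>2 * (pi / (2 * sin (pi * \<theta>))) = 1"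
  using sin_pi_pos[of \<theta>] by (simp add: N_const_def field_simps)

text \<open>Adding the squares of \<open>\<bar>f t\<bar> \<le> t * M\<close> and
  \<open>t * \<bar>f t\<bar> \<le> t * M\<close> gives
  \<open>(f t)^2 * (1 + t^2) \<le> 2 * M^2 * t^2\<close>, the origin of \<open>sqrt 2\<close> and
  \<open>kscal 1 1\<close>. The pointwise bound serves as a majorant in dominated convergence, the
  integrated one embeds the intersection into the interpolation spaces.\<close>

lemma wint_min_bound:
  assumes th: "0 < \<theta>" "\<theta> < 1"
    and f: "\<And>t. t > 0 \<Longrightarrow> \<bar>f t\<bar> \<le> M" "\<And>t. t > 0 \<Longrightarrow> \<bar>f t\<bar> \<le> t * M"
  shows "\<And>t. t > 0 \<Longrightarrow> \<bar>f t\<bar> \<le> sqrt 2 * M * kscal 1 1 t"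
    "wint \<theta> f \<le> ennreal (2 * M\<^sup>2 * (pi / (2 * sin (pi * \<theta>))))"
proof -
  have M: "M \<ge> 0" using f(1)[of 1] by auto
  show le: "\<bar>f t\<bar> \<le> sqrt 2 * M * kscal 1 1 t" if t: "t > 0" for t
  proof -
    have "(\<bar>f t\<bar>)\<^sup>2 \<le> M\<^sup>2" "(\<bar>f t\<bar>)\<^sup>2 \<le> (t * M)\<^sup>2"
      using f[OF t] by (intro power_mono; simp)+
    then have "(f t)\<^sup>2 * (1 + t\<^sup>2) \<le> 2 * M\<^sup>2 * t\<^sup>2"
      using mult_right_mono[of "(f t)\<^sup>2" "M\<^sup>2" "t\<^sup>2"] by (simp add: algebra_simps)
    then have "(f t)\<^sup>2 \<le> 2 * M\<^sup>2 * (t\<^sup>2 / (1 + t\<^sup>2))"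
      by (simp add: pos_le_divide_eq add_pos_nonneg)
    then have "\<bar>f t\<bar> \<le> sqrt (2 * M\<^sup>2 * (t\<^sup>2 / (1 + t\<^sup>2)))" by (intro real_le_rsqrt) simp
    also have "\<dots> = sqrt 2 * M * sqrt (t\<^sup>2 / (1 + t\<^sup>2))"
      using M by (simp only: real_sqrt_mult real_sqrt_abs abs_of_nonneg)
    finally show ?thesis by (simp add: kscal_def)
  qed
  have "wint \<theta> f \<le> wint \<theta> (\<lambda>t. sqrt 2 * M * kscal 1 1 t)"
    using le by (intro wint_mono) (auto intro: order_trans abs_ge_self)
  also have "\<dots> = ennreal (2 * M\<^sup>2 * (pi / (2 * sin (pi * \<theta>))))"
    using th sin_pi_pos[OF th]
    by (simp add: wint_cmult[OF klike_posmeas[OF klike_kscal]] wint_kscal power_mult_distrib ennreal_mult[symmetric])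
  finally show "wint \<theta> f \<le> ennreal (2 * M\<^sup>2 * (pi / (2 * sin (pi * \<theta>))))" .
qed

text \<open>Convergence at rational points spreads to all points by the monotonicity of \<open>f\<close> and
  \<open>f t / t\<close>, so countably many finite sets suffice.\<close>
lemma klike_selection:
  fixes \<kappa> :: "'b set \<Rightarrow> real \<Rightarrow> real"
  assumes k: "klike k" and \<kappa>: "\<And>B. finite B \<Longrightarrow> B \<subseteq> D \<Longrightarrow> klike (\<kappa> B)"
    and ap: "\<And>t e. t > 0 \<Longrightarrow> e > 0 \<Longrightarrow>
      \<exists>B. finite B \<and> B \<subseteq> D \<and> (\<forall>B'. finite B' \<longrightarrow> B \<subseteq> B' \<longrightarrow> B' \<subseteq> D \<longrightarrow> \<bar>\<kappa> B' t - k t\<bar> < e)"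
  shows "\<exists>B :: nat \<Rightarrow> 'b set. (\<forall>n. finite (B n) \<and> B n \<subseteq> D) \<and> (\<forall>t>0. (\<lambda>n. \<kappa> (B n) t) \<longlonglongrightarrow> k t)"
proof -
  obtain S where S: "\<And>t e. t > 0 \<Longrightarrow> e > 0 \<Longrightarrow> finite (S t e) \<and> S t e \<subseteq> D \<and>
      (\<forall>B'. finite B' \<longrightarrow> S t e \<subseteq> B' \<longrightarrow> B' \<subseteq> D \<longrightarrow> \<bar>\<kappa> B' t - k t\<bar> < e)"
    using ap by metis
  \<comment> \<open>All pairs of a rational point and a tolerance \<open>1 / Suc m\<close> are
    enumerated; nonpositive rationals contribute the empty set.\<close>
  define T where "T i = (let (r, m) = (from_nat i :: rat \<times> nat) in
     if r > 0 then S (of_rat r) (1 / Suc m) else {})" for i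
  have T: "finite (T i)" "T i \<subseteq> D" for i
    using S by (auto simp: T_def Let_def split: prod.split)
  \<comment> \<open>Cumulative unions: a set that is good for one pair stays good when enlarged, so
    every pair is served from its index onwards.\<close>
  define B where "B n = (\<Union>i\<le>n. T i)" for n
  have B: "finite (B n)" "B n \<subseteq> D" for n using T by (auto simp: B_def)
  have rat: "(\<lambda>n. \<kappa> (B n) (of_rat r)) \<longlonglongrightarrow> k (of_rat r)" if r: "r > 0" for r :: rat
  proof (rule LIMSEQ_I)
    fix e :: real assume e: "e > 0"
    obtain m :: nat where m: "1 / Suc m < e" using reals_Archimedean[OF e] by (auto simp: inverse_eq_divide)
    define N where "N = to_nat (r, m)"
    have TN: "T N = S (of_rat r) (1 / Suc m)" using r by (simp add: T_def N_def)
    show "\<exists>no. \<forall>n\<ge>no. norm (\<kappa> (B n) (of_rat r) - k (of_rat r)) < e"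
    proof (intro exI[of _ N] allI impI)
      fix n assume "n \<ge> N"
      then have "T N \<subseteq> B n" by (auto simp: B_def)
      then have "\<bar>\<kappa> (B n) (of_rat r) - k (of_rat r)\<bar> < 1 / Suc m"
        using S[of "of_rat r" "1 / Suc m"] r B TN by simp
      then show "norm (\<kappa> (B n) (of_rat r) - k (of_rat r)) < e" using m by simp
    qed
  qed
  have "(\<lambda>n. \<kappa> (B n) t) \<longlonglongrightarrow> k t" if t: "t > 0" for t
  proof (rule LIMSEQ_I)
    fix e :: real assume e: "e > 0"
    have kt: "k t \<ge> 0" using klikeD(1)[OF k t] .
    \<comment> \<open>Relative width of the rational bracket around \<open>t\<close>: the two
      monotonicity properties bound \<open>k\<close> at its lower end from below by
      \<open>(1 - d) * k t\<close> and at its upper end from above by \<open>(1 + d) * k t\<close>.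
      The added 1 in the denominator covers \<open>k t = 0\<close>.\<close>
    define d where "d = min (1/2) (e / (2 * (k t + 1)))"
    have d: "d > 0" "d < 1" using e kt by (auto simp: d_def)
    have dk: "d * k t \<le> e/2"
    proof -
      have "d * k t \<le> (e / (2 * (k t + 1))) * (k t + 1)" using kt d e by (intro mult_mono) (auto simp: d_def)
      also have "\<dots> = e / 2"
      proof -
        have "k t + 1 \<noteq> 0" using kt by simp
        then show ?thesis by (metis nonzero_mult_div_cancel_right times_divide_eq_left divide_divide_eq_left mult.commute)
      qed
      finally show ?thesis .
    qed
    have "t * (1 - d) < t" "t < t * (1 + d)" using t d by auto
    then obtain r1 r2 where r: "t * (1 - d) < of_rat r1" "of_rat r1 < t" "t < of_rat r2" "of_rat r2 < t * (1 + d)"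
      using of_rat_dense by metis
    have pos: "0 < real_of_rat r1" "0 < real_of_rat r2"
    proof -
      have "0 < t * (1 - d)" using t d by simp
      then show "0 < real_of_rat r1" "0 < real_of_rat r2" using r t by linarith+
    qed
    have "t * ((1 - d) * k t) \<le> of_rat r1 * k t" using r(1) kt by (simp add: mult_right_mono flip: mult.assoc)
    also have "\<dots> \<le> t * k (of_rat r1)" using klikeD(3)[OF k pos(1)] r by simp
    finally have "(1 - d) * k t \<le> k (of_rat r1)" using t by simp
    then have k1: "k t - e/2 \<le> k (of_rat r1)" using dk by (simp add: algebra_simps)
    have "t * k (of_rat r2) \<le> of_rat r2 * k t" using klikeD(3)[OF k t] r by simp
    also have "\<dots> \<le> t * ((1 + d) * k t)" using r(4) kt by (simp add: mult_right_mono flip: mult.assoc)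
    finally have "k (of_rat r2) \<le> (1 + d) * k t" using t by simp
    then have k2: "k (of_rat r2) \<le> k t + e/2" using dk by (simp add: algebra_simps)
    obtain N1 where N1: "\<And>n. n \<ge> N1 \<Longrightarrow> \<bar>\<kappa> (B n) (of_rat r1) - k (of_rat r1)\<bar> < e/2"
      using LIMSEQ_D[OF rat, of r1 "e/2"] pos e by auto
    obtain N2 where N2: "\<And>n. n \<ge> N2 \<Longrightarrow> \<bar>\<kappa> (B n) (of_rat r2) - k (of_rat r2)\<bar> < e/2"
      using LIMSEQ_D[OF rat, of r2 "e/2"] pos e by auto
    show "\<exists>no. \<forall>n\<ge>no. norm (\<kappa> (B n) t - k t) < e"
    proof (intro exI[of _ "max N1 N2"] allI impI)
      fix n assume n: "n \<ge> max N1 N2"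
      have "\<kappa> (B n) (of_rat r1) \<le> \<kappa> (B n) t" "\<kappa> (B n) t \<le> \<kappa> (B n) (of_rat r2)"
        using klikeD(2)[OF \<kappa>[OF B]] r pos t by auto
      then show "norm (\<kappa> (B n) t - k t) < e"
        using N1[of n] N2[of n] n k1 k2 unfolding real_norm_def by linarith
    qed
  qed
  then show ?thesis using B by blast
qed

section \<open>K-functionals and the interpolation spaces\<close>

lemma Sigma_iff: "z \<in> carr (Sigma_space X Y) \<longleftrightarrow> (\<exists>x\<in>carr X. \<exists>y\<in>carr Y. x + y = z)"
  by (auto simp: Sigma_space_def)

lemma K_lower:
  assumes "x \<in> carr X" "y \<in> carr Y" "x + y = z"
  shows "K_functional X Y t z \<le> sqrt ((nrm X x)\<^sup>2 + t\<^sup>2 * (nrm Y y)\<^sup>2)"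
  unfolding K_functional_def
  by (rule cInf_lower) (use assms in \<open>auto intro!: bdd_belowI[of _ 0]\<close>)

lemma K_approx:
  assumes "z \<in> carr (Sigma_space X Y)" "e > 0"
  shows "\<exists>x\<in>carr X. \<exists>y\<in>carr Y. x + y = z \<and> sqrt ((nrm X x)\<^sup>2 + t\<^sup>2 * (nrm Y y)\<^sup>2) < K_functional X Y t z + e"
proof -
  let ?S = "{sqrt ((nrm X x)\<^sup>2 + t\<^sup>2 * (nrm Y y)\<^sup>2) | x y. x \<in> carr X \<and> y \<in> carr Y \<and> x + y = z}"
  have "?S \<noteq> {}" using assms(1) unfolding Sigma_iff by blast
  moreover have "bdd_below ?S" by (auto intro!: bdd_belowI[of _ 0])
  moreover have "Inf ?S < K_functional X Y t z + e" using assms(2) by (simp add: K_functional_def)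
  ultimately show ?thesis by (subst (asm) cInf_less_iff) auto
qed

lemma K_greatest:
  assumes "z \<in> carr (Sigma_space X Y)"
    and "\<And>x y. x \<in> carr X \<Longrightarrow> y \<in> carr Y \<Longrightarrow> x + y = z \<Longrightarrow> c \<le> sqrt ((nrm X x)\<^sup>2 + t\<^sup>2 * (nrm Y y)\<^sup>2)"
  shows "c \<le> K_functional X Y t z"
proof (rule field_le_epsilon)
  fix e :: real assume "e > 0"
  then show "c \<le> K_functional X Y t z + e" using K_approx[OF assms(1), of e t] assms(2) by fastforce
qed

lemma K_ge0: "z \<in> carr (Sigma_space X Y) \<Longrightarrow> 0 \<le> K_functional X Y t z"
  by (rule K_greatest) auto

lemma K_approx_sq:
  assumes z: "z \<in> carr (Sigma_space X Y)" and e: "e > 0"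
  shows "\<exists>x\<in>carr X. \<exists>y\<in>carr Y. x + y = z \<and> (nrm X x)\<^sup>2 + t\<^sup>2 * (nrm Y y)\<^sup>2 < (K_functional X Y t z)\<^sup>2 + e"
proof -
  define k where "k = K_functional X Y t z"
  have k: "k \<ge> 0" using K_ge0[OF z] by (simp add: k_def)
  \<comment> \<open>For \<open>d \<le> 1\<close> the increase \<open>2 * k * d + d^2\<close> of the
    square is at most \<open>(2 * k + 1) * d\<close>, hence at most \<open>e\<close>.\<close>
  define d where "d = min 1 (e / (2 * k + 1))"
  have d: "d > 0" "d \<le> 1" using k e by (auto simp: d_def)
  have "d \<le> e / (2 * k + 1)" by (simp add: d_def)
  then have "d * (2 * k + 1) \<le> e" using k by (subst (asm) pos_le_divide_eq) auto
  moreover have "d * d \<le> d * 1" using d by (intro mult_left_mono) auto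
  ultimately have kd: "(k + d)\<^sup>2 \<le> k\<^sup>2 + e" by (simp add: power2_eq_square algebra_simps)
  obtain x y where xy: "x \<in> carr X" "y \<in> carr Y" "x + y = z"
    "sqrt ((nrm X x)\<^sup>2 + t\<^sup>2 * (nrm Y y)\<^sup>2) < k + d"
    using K_approx[OF z d(1), of t] by (auto simp: k_def)
  have "(sqrt ((nrm X x)\<^sup>2 + t\<^sup>2 * (nrm Y y)\<^sup>2))\<^sup>2 < (k + d)\<^sup>2"
    using xy(4) by (intro power_strict_mono) auto
  then have "(nrm X x)\<^sup>2 + t\<^sup>2 * (nrm Y y)\<^sup>2 < k\<^sup>2 + e" using kd by simp
  then show ?thesis using xy by (auto simp: k_def)
qed

text \<open>For a fixed decomposition the cost increases with \<open>t\<close>, while the cost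
  divided by \<open>t\<close> decreases; the infimum inherits both.\<close>

lemma K_klike:
  assumes z: "z \<in> carr (Sigma_space X Y)" shows "klike (\<lambda>t. K_functional X Y t z)"
  unfolding klike_def
proof (intro conjI allI impI)
  fix t show "0 \<le> K_functional X Y t z" by (rule K_ge0[OF z])
next
  fix s t :: real assume st: "0 < s" "s \<le> t"
  have sq: "s\<^sup>2 \<le> t\<^sup>2" using st by (intro power_mono) auto
  show "K_functional X Y s z \<le> K_functional X Y t z"
  proof (rule K_greatest[OF z])
    fix x y assume *: "x \<in> carr X" "y \<in> carr Y" "x + y = z"
    have "sqrt ((nrm X x)\<^sup>2 + s\<^sup>2 * (nrm Y y)\<^sup>2) \<le> sqrt ((nrm X x)\<^sup>2 + t\<^sup>2 * (nrm Y y)\<^sup>2)"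
      using sq by (simp add: mult_right_mono)
    with K_lower[OF *, of s] show "K_functional X Y s z \<le> sqrt ((nrm X x)\<^sup>2 + t\<^sup>2 * (nrm Y y)\<^sup>2)"
      by (rule order_trans)
  qed
  have "s / t * K_functional X Y t z \<le> K_functional X Y s z"
  proof (rule K_greatest[OF z])
    fix x y assume *: "x \<in> carr X" "y \<in> carr Y" "x + y = z"
    have "s * K_functional X Y t z \<le> s * sqrt ((nrm X x)\<^sup>2 + t\<^sup>2 * (nrm Y y)\<^sup>2)"
      using K_lower[OF *, of t] st by (intro mult_left_mono) auto
    also have "\<dots> = sqrt (s\<^sup>2 * (nrm X x)\<^sup>2 + s\<^sup>2 * (t\<^sup>2 * (nrm Y y)\<^sup>2))"
      using st by (simp add: real_sqrt_mult flip: distrib_left)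
    also have "\<dots> \<le> sqrt (t\<^sup>2 * (nrm X x)\<^sup>2 + s\<^sup>2 * (t\<^sup>2 * (nrm Y y)\<^sup>2))"
      using sq by (simp add: mult_right_mono)
    also have "\<dots> = sqrt (t\<^sup>2 * ((nrm X x)\<^sup>2 + s\<^sup>2 * (nrm Y y)\<^sup>2))" by (simp add: algebra_simps)
    also have "\<dots> = t * sqrt ((nrm X x)\<^sup>2 + s\<^sup>2 * (nrm Y y)\<^sup>2)"
      using st by (simp add: real_sqrt_mult)
    finally show "s / t * K_functional X Y t z \<le> sqrt ((nrm X x)\<^sup>2 + s\<^sup>2 * (nrm Y y)\<^sup>2)"
      using st by (simp add: field_simps)
  qed
  then show "s * K_functional X Y t z \<le> t * K_functional X Y s z" using st by (simp add: field_simps)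
qed

lemma K_integral_eq: "K_integral X Y \<theta> z = wint \<theta> (\<lambda>t. K_functional X Y t z)"
  by (simp add: K_integral_def wint_def)

lemma sq_le_of_le_sqrt: "0 \<le> k \<Longrightarrow> k \<le> sqrt a \<Longrightarrow> k\<^sup>2 \<le> a"
  by (metis real_sqrt_le_iff real_sqrt_unique)

lemma sqrt_sum_triangle:
  "sqrt ((a + b)\<^sup>2 + t\<^sup>2 * (c + d)\<^sup>2) \<le> sqrt (a\<^sup>2 + t\<^sup>2 * c\<^sup>2) + sqrt (b\<^sup>2 + t\<^sup>2 * d\<^sup>2)" for t :: real
  using real_sqrt_sum_squares_triangle_ineq[of a b "t * c" "t * d"]
  by (simp add: power_mult_distrib flip: distrib_left)

context npair begin

abbreviation "S \<equiv> Sigma_space X Y"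
abbreviation "K \<equiv> K_functional X Y"

lemma S_X: "x \<in> carr X \<Longrightarrow> x \<in> carr S" using Y.in0 by (force simp: Sigma_iff)
lemma S_Y: "y \<in> carr Y \<Longrightarrow> y \<in> carr S" using X.in0 by (force simp: Sigma_iff)
lemma S_add: "x \<in> carr S \<Longrightarrow> y \<in> carr S \<Longrightarrow> x + y \<in> carr S"
  by (rule X.subspace_add[OF Sigma_subspace])
lemma S_diff: "x \<in> carr S \<Longrightarrow> y \<in> carr S \<Longrightarrow> x - y \<in> carr S"
  by (rule X.subspace_diff[OF Sigma_subspace])
lemma S_scale: "x \<in> carr S \<Longrightarrow> s c x \<in> carr S"
  by (rule X.subspace_scale[OF Sigma_subspace])

lemma K_le_X: "x \<in> carr X \<Longrightarrow> K t x \<le> nrm X x"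
  using K_lower[of x X 0 Y x t] X.nrm_ge0[of x] by simp
lemma K_le_Y: "y \<in> carr Y \<Longrightarrow> t \<ge> 0 \<Longrightarrow> K t y \<le> t * nrm Y y"
  using K_lower[of 0 X y Y y t] Y.nrm_ge0[of y] by (simp add: real_sqrt_mult)

lemma K_tri: assumes "a \<in> carr S" "b \<in> carr S" shows "K t (a + b) \<le> K t a + K t b"
proof (rule field_le_epsilon)
  fix e :: real assume e: "e > 0"
  obtain x y where xy: "x \<in> carr X" "y \<in> carr Y" "x + y = a"
    "sqrt ((nrm X x)\<^sup>2 + t\<^sup>2 * (nrm Y y)\<^sup>2) < K t a + e/2" using K_approx[OF assms(1), of "e/2" t] e by auto
  obtain x' y' where xy': "x' \<in> carr X" "y' \<in> carr Y" "x' + y' = b"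
    "sqrt ((nrm X x')\<^sup>2 + t\<^sup>2 * (nrm Y y')\<^sup>2) < K t b + e/2" using K_approx[OF assms(2), of "e/2" t] e by auto
  have "K t (a + b) \<le> sqrt ((nrm X (x + x'))\<^sup>2 + t\<^sup>2 * (nrm Y (y + y'))\<^sup>2)"
    using xy xy' by (intro K_lower) (auto simp: algebra_simps)
  also have "\<dots> \<le> sqrt ((nrm X x + nrm X x')\<^sup>2 + t\<^sup>2 * (nrm Y y + nrm Y y')\<^sup>2)"
    using xy xy' by (intro real_sqrt_le_mono add_mono mult_left_mono power_mono X.nrm_tri Y.nrm_tri X.nrm_ge0 Y.nrm_ge0) auto
  also have "\<dots> \<le> sqrt ((nrm X x)\<^sup>2 + t\<^sup>2 * (nrm Y y)\<^sup>2) + sqrt ((nrm X x')\<^sup>2 + t\<^sup>2 * (nrm Y y')\<^sup>2)"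
    by (rule sqrt_sum_triangle)
  finally show "K t (a + b) \<le> K t a + K t b + e" using xy(4) xy'(4) by simp
qed

lemma K_zero[simp]: "K t 0 = 0"
  using K_le_X[of 0 t] K_ge0[of 0 X Y t] S_X[of 0] by simp

lemma K_scale: assumes z: "z \<in> carr S" shows "K t (s c z) = cmod c * K t z"
proof -
  have le: "K t (s c z) \<le> cmod c * K t z" if z: "z \<in> carr S" for c z
  proof (rule field_le_epsilon)
    fix e :: real assume e: "e > 0"
    define d where "d = e / (cmod c + 1)"
    have d: "d > 0" using e by (simp add: d_def add_nonneg_pos)
    obtain x y where xy: "x \<in> carr X" "y \<in> carr Y" "x + y = z"
      "sqrt ((nrm X x)\<^sup>2 + t\<^sup>2 * (nrm Y y)\<^sup>2) < K t z + d" using K_approx[OF z d, of t] by auto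
    have "K t (s c z) \<le> sqrt ((nrm X (s c x))\<^sup>2 + t\<^sup>2 * (nrm Y (s c y))\<^sup>2)"
      using xy by (intro K_lower) (auto simp: X.scale_right_distrib)
    also have "\<dots> = sqrt ((cmod c)\<^sup>2 * ((nrm X x)\<^sup>2 + t\<^sup>2 * (nrm Y y)\<^sup>2))"
      using xy by (simp add: X.nrm_scale Y.nrm_scale power_mult_distrib algebra_simps)
    also have "\<dots> = cmod c * sqrt ((nrm X x)\<^sup>2 + t\<^sup>2 * (nrm Y y)\<^sup>2)" by (simp add: real_sqrt_mult)
    also have "\<dots> \<le> cmod c * (K t z + d)" using xy(4) by (intro mult_left_mono) auto
    also have "\<dots> \<le> cmod c * K t z + e"
    proof -
      have "cmod c * d \<le> (cmod c + 1) * d" using d by simp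
      also have "\<dots> = e" using norm_ge_zero[of c] by (simp add: d_def add_nonneg_pos less_imp_neq[symmetric])
      finally show ?thesis by (simp add: algebra_simps)
    qed
    finally show "K t (s c z) \<le> cmod c * K t z + e" .
  qed
  show ?thesis
  proof (cases "c = 0")
    case False
    have "K t (s (1/c) (s c z)) \<le> cmod (1/c) * K t (s c z)" by (rule le[OF S_scale[OF z]])
    then show ?thesis using le[OF z, of c] False by (simp add: norm_divide field_simps)
  qed simp
qed

lemma K_neg: "z \<in> carr S \<Longrightarrow> K t (- z) = K t z" using K_scale[of z t "-1"] by simp

lemma K_tri_diff: "x \<in> carr S \<Longrightarrow> y \<in> carr S \<Longrightarrow> K t (x - y) \<le> K t x + K t y"
  using K_tri[of x "- y" t] K_neg[of y t] X.subspace_neg[OF Sigma_subspace] by simp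

text \<open>Adding and subtracting near-optimal decompositions proves only one inequality. Applied
  to \<open>a + b\<close> and \<open>a - b\<close>, whose sum and difference are the doubles of
  \<open>a\<close> and \<open>b\<close>, that inequality becomes the reverse one.\<close>

lemma K_pgram:
  assumes pg: "pgram X" "pgram Y" and ab: "a \<in> carr S" "b \<in> carr S"
  shows "(K t (a + b))\<^sup>2 + (K t (a - b))\<^sup>2 = 2 * (K t a)\<^sup>2 + 2 * (K t b)\<^sup>2"
proof -
  have le: "(K t (a + b))\<^sup>2 + (K t (a - b))\<^sup>2 \<le> 2 * (K t a)\<^sup>2 + 2 * (K t b)\<^sup>2"
    if ab: "a \<in> carr S" "b \<in> carr S" for a b
  proof (rule field_le_epsilon)
    fix e :: real assume e: "e > 0"
    obtain x y where xy: "x \<in> carr X" "y \<in> carr Y" "x + y = a"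
      "(nrm X x)\<^sup>2 + t\<^sup>2 * (nrm Y y)\<^sup>2 < (K t a)\<^sup>2 + e/4" using K_approx_sq[OF ab(1), of "e/4" t] e by auto
    obtain x' y' where xy': "x' \<in> carr X" "y' \<in> carr Y" "x' + y' = b"
      "(nrm X x')\<^sup>2 + t\<^sup>2 * (nrm Y y')\<^sup>2 < (K t b)\<^sup>2 + e/4" using K_approx_sq[OF ab(2), of "e/4" t] e by auto
    have "K t (a + b) \<le> sqrt ((nrm X (x + x'))\<^sup>2 + t\<^sup>2 * (nrm Y (y + y'))\<^sup>2)"
      using xy xy' by (intro K_lower) (auto simp: algebra_simps)
    then have 1: "(K t (a + b))\<^sup>2 \<le> (nrm X (x + x'))\<^sup>2 + t\<^sup>2 * (nrm Y (y + y'))\<^sup>2"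
      using K_ge0[OF S_add[OF ab], of t] by (intro sq_le_of_le_sqrt)
    have "K t (a - b) \<le> sqrt ((nrm X (x - x'))\<^sup>2 + t\<^sup>2 * (nrm Y (y - y'))\<^sup>2)"
      using xy xy' by (intro K_lower) (auto simp: algebra_simps)
    then have 2: "(K t (a - b))\<^sup>2 \<le> (nrm X (x - x'))\<^sup>2 + t\<^sup>2 * (nrm Y (y - y'))\<^sup>2"
      using K_ge0[OF S_diff[OF ab], of t] by (intro sq_le_of_le_sqrt)
    have X: "(nrm X (x + x'))\<^sup>2 + (nrm X (x - x'))\<^sup>2 = 2 * (nrm X x)\<^sup>2 + 2 * (nrm X x')\<^sup>2"
      using pg(1) xy(1) xy'(1) by (simp add: pgram_def)
    have Y: "(nrm Y (y + y'))\<^sup>2 + (nrm Y (y - y'))\<^sup>2 = 2 * (nrm Y y)\<^sup>2 + 2 * (nrm Y y')\<^sup>2"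
      using pg(2) xy(2) xy'(2) by (simp add: pgram_def)
    have "t\<^sup>2 * (nrm Y (y + y'))\<^sup>2 + t\<^sup>2 * (nrm Y (y - y'))\<^sup>2 = 2 * (t\<^sup>2 * (nrm Y y)\<^sup>2) + 2 * (t\<^sup>2 * (nrm Y y')\<^sup>2)"
      using arg_cong[OF Y, of "\<lambda>v. t\<^sup>2 * v"] by (simp add: algebra_simps)
    then show "(K t (a + b))\<^sup>2 + (K t (a - b))\<^sup>2 \<le> 2 * (K t a)\<^sup>2 + 2 * (K t b)\<^sup>2 + e"
      using 1 2 X xy(4) xy'(4) by linarith
  qed
  have "(K t ((a + b) + (a - b)))\<^sup>2 + (K t ((a + b) - (a - b)))\<^sup>2 \<le> 2 * (K t (a + b))\<^sup>2 + 2 * (K t (a - b))\<^sup>2"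
    using ab by (intro le S_add S_diff)
  moreover have "(a + b) + (a - b) = s 2 a" "(a + b) - (a - b) = s 2 b"
    using X.scale_left_distrib[of 1 1 a] X.scale_left_distrib[of 1 1 b] by (simp_all add: algebra_simps)
  ultimately show ?thesis using le[OF ab] ab by (simp add: K_scale power_mult_distrib)
qed

text \<open>Together with \<open>K_le_Sigma\<close> this makes \<open>K t\<close> equivalent to
  \<open>nrm S\<close> for each fixed \<open>t > 0\<close>, so that separation of points and
  convergence in the sum can be tested at \<open>t = 1\<close>.\<close>

lemma Sigma_le_K: assumes z: "z \<in> carr S" and t: "t > 0" shows "nrm S z \<le> (1 + 1/t) * K t z"
proof -
  have "t / (t + 1) * nrm S z \<le> K t z"
  proof (rule K_greatest[OF z])
    fix x y assume *: "x \<in> carr X" "y \<in> carr Y" "x + y = z"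
    let ?r = "sqrt ((nrm X x)\<^sup>2 + t\<^sup>2 * (nrm Y y)\<^sup>2)"
    have 1: "nrm X x \<le> ?r" by (rule real_le_rsqrt) simp
    have 2: "t * nrm Y y \<le> ?r" by (rule real_le_rsqrt) (simp add: power_mult_distrib)
    have "t * nrm X x \<le> t * ?r" using 1 t by (intro mult_left_mono) auto
    with 2 have "t * (nrm X x + nrm Y y) \<le> t * ?r + ?r" unfolding distrib_left by linarith
    moreover have "nrm S z \<le> nrm X x + nrm Y y" using Sigma_lower * by auto
    then have "t * nrm S z \<le> t * (nrm X x + nrm Y y)" using t by simp
    ultimately have "t * nrm S z \<le> (t + 1) * ?r" by (simp add: algebra_simps)
    then show "t / (t + 1) * nrm S z \<le> ?r" using t by (simp add: pos_divide_le_eq mult.commute)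
  qed
  then have "t * nrm S z \<le> (t + 1) * K t z" using t by (simp add: pos_divide_le_eq mult.commute)
  then show ?thesis using t by (simp add: field_simps)
qed

lemma K_le_Sigma: assumes z: "z \<in> carr S" and t: "t > 0" shows "K t z \<le> (1 + t) * nrm S z"
proof (rule field_le_epsilon)
  fix e :: real assume e: "e > 0"
  then obtain x y where xy: "x \<in> carr X" "y \<in> carr Y" "x + y = z" "nrm X x + nrm Y y < nrm S z + e / (1 + t)"
    using Sigma_approx[OF z, of "e / (1 + t)"] t by auto
  have "K t z \<le> K t x + K t y" using K_tri S_X S_Y xy by blast
  also have "\<dots> \<le> nrm X x + t * nrm Y y" using K_le_X K_le_Y xy t by (intro add_mono) auto
  also have "\<dots> \<le> (1 + t) * (nrm X x + nrm Y y)"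
    using t X.nrm_ge0[OF xy(1)] Y.nrm_ge0[OF xy(2)] by (simp add: algebra_simps)
  also have "\<dots> \<le> (1 + t) * (nrm S z + e / (1 + t))" using xy(4) t by (intro mult_left_mono) auto
  also have "\<dots> = (1 + t) * nrm S z + e" using t by (simp add: distrib_left)
  finally show "K t z \<le> (1 + t) * nrm S z + e" .
qed

text \<open>A near-optimal decomposition at \<open>N\<close> is stable: both parts have K-functional at most
  \<open>3 K(t, z)\<close> for every \<open>t\<close>, by the monotonicity of \<open>K\<close> and \<open>K / t\<close>.\<close>
lemma K_split:
  assumes z: "z \<in> carr S" and N: "N > 0" and def0: "K N z = 0 \<Longrightarrow> z = 0"
  shows "\<exists>x\<in>carr X. \<exists>y\<in>carr Y. x + y = z \<and> nrm X x \<le> 2 * K N z \<and> N * nrm Y y \<le> 2 * K N z \<and>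
     (\<forall>t>0. K t x \<le> 3 * K t z \<and> K t y \<le> 3 * K t z)"
proof (cases "K N z = 0")
  case True
  then show ?thesis using def0 by (intro bexI[of _ 0]) auto
next
  case False
  note kl = K_klike[OF z]
  have "K N z > 0" using False K_ge0[OF z, of N] by simp
  then obtain x y where xy: "x \<in> carr X" "y \<in> carr Y" "x + y = z"
      "sqrt ((nrm X x)\<^sup>2 + N\<^sup>2 * (nrm Y y)\<^sup>2) < K N z + K N z" using K_approx[OF z, of "K N z" N] by auto
  let ?r = "sqrt ((nrm X x)\<^sup>2 + N\<^sup>2 * (nrm Y y)\<^sup>2)"
  have "nrm X x \<le> ?r" by (rule real_le_rsqrt) simp
  then have x: "nrm X x \<le> 2 * K N z" using xy(4) by simp
  have "N * nrm Y y \<le> ?r" by (rule real_le_rsqrt) (simp add: power_mult_distrib)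
  then have y: "N * nrm Y y \<le> 2 * K N z" using xy(4) by simp
  have eqs: "x = z - y" "y = z - x" using xy(3) by auto
  have "K t x \<le> 3 * K t z \<and> K t y \<le> 3 * K t z" if t: "t > 0" for t
  \<comment> \<open>Below \<open>N\<close> the \<open>Y\<close>-part is bounded directly by
    \<open>2 * K t z\<close>, above \<open>N\<close> the \<open>X\<close>-part. The triangle
    inequality handles the other part, whence the factor 3.\<close>
  proof (cases "t \<le> N")
    case True
    have "K t y \<le> t * nrm Y y" using K_le_Y[OF xy(2)] t by simp
    moreover have "N * (t * nrm Y y) \<le> N * (2 * K t z)"
    proof -
      have "t * (N * nrm Y y) \<le> t * (2 * K N z)" using y t by (intro mult_left_mono) auto
      moreover have "N * (t * nrm Y y) = t * (N * nrm Y y)" "t * (2 * K N z) = 2 * (t * K N z)"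
        "N * (2 * K t z) = 2 * (N * K t z)" by simp_all
      ultimately show ?thesis using klikeD(3)[OF kl t True] by linarith
    qed
    then have "t * nrm Y y \<le> 2 * K t z" using N by simp
    ultimately have "K t y \<le> 2 * K t z" by simp
    moreover have "K t x \<le> K t z + K t y" by (subst eqs(1)) (rule K_tri_diff[OF z S_Y[OF xy(2)]])
    ultimately show ?thesis using K_ge0[OF z, of t] by simp
  next
    case False
    have "K N z \<le> K t z" using klikeD(2)[OF kl N, of t] False by simp
    then have "K t x \<le> 2 * K t z" using K_le_X[OF xy(1), of t] x by simp
    moreover have "K t y \<le> K t z + K t x" by (subst eqs(2)) (rule K_tri_diff[OF z S_X[OF xy(1)]])
    ultimately show ?thesis using K_ge0[OF z, of t] by simp
  qed
  then show ?thesis using xy x y by blast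
qed

end

section \<open>The interpolation spaces as Hilbert spaces\<close>

locale hpair = npair s X Y for s :: "complex \<Rightarrow> 'v::ab_group_add \<Rightarrow> 'v" and X Y +
  assumes pX: "pgram X" and pY: "pgram Y"
    and cX: "cauchy X u \<Longrightarrow> \<exists>x. conv X u x" and cY: "cauchy Y u \<Longrightarrow> \<exists>x. conv Y u x"
    and nS: "normed_space s (Sigma_space X Y)"
    and cS: "cauchy (Sigma_space X Y) u \<Longrightarrow> \<exists>x. conv (Sigma_space X Y) u x"

lemma hpair_of_compatible: "hilbert_compatible_pair s X Y \<Longrightarrow> hpair s X Y"
proof -
  assume *: "hilbert_compatible_pair s X Y"
  then have s: "vector_space s" and X: "hilbert_space s X" and Y: "hilbert_space s Y"
    and S: "banach_space s (Sigma_space X Y)" by (auto simp: hilbert_compatible_pair_def)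
  have "npair s X Y" using s X Y
    by (auto simp: hilbert_space_def banach_space_def npair_def nvs_def complex_vs_def nvs_axioms_def)
  then show ?thesis
    using s X Y S by (auto simp: hpair_def hpair_axioms_def hilbert_iff banach_iff)
qed

context hpair begin

lemma vs: "vector_space s" by (rule X.vector_space_axioms)

lemma hX: "hilbert_space s X" and hY: "hilbert_space s Y"
  using X.normed Y.normed pX pY cX cY by (auto simp: hilbert_iff[OF vs] banach_iff[OF vs])

sublocale Sg: nvs s S by unfold_locales (rule nS)

lemma K_eq0: assumes "z \<in> carr S" "t > 0" "K t z = 0" shows "z = 0"
  using Sigma_le_K[OF assms(1,2)] Sg.nrm_ge0[OF assms(1)] Sg.nrm_eq0[OF assms(1)] assms(3) by simp

abbreviation "W \<theta> z \<equiv> wint \<theta> (\<lambda>t. K t z)"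
abbreviation "KS \<theta> \<equiv> K_space X Y \<theta>"

lemma posK: "z \<in> carr S \<Longrightarrow> posmeas (\<lambda>t. K t z)" by (intro klike_posmeas K_klike)

lemma KS_carr: "z \<in> carr (KS \<theta>) \<longleftrightarrow> z \<in> carr S \<and> W \<theta> z < \<infinity>"
  by (simp add: K_space_def K_integral_eq)

lemma KS_nrm: "nrm (KS \<theta>) z = N_const \<theta> * sqrt (enn2real (W \<theta> z))"
  by (simp add: K_space_def K_integral_eq)

context fixes \<theta> :: real assumes th: "0 < \<theta>" "\<theta> < 1" begin

lemma N_pos: "N_const \<theta> > 0" using N_const_pos th by simp

lemma W_eq: "z \<in> carr (KS \<theta>) \<Longrightarrow> W \<theta> z = ennreal ((nrm (KS \<theta>) z / N_const \<theta>)\<^sup>2)"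
  using N_pos by (simp add: KS_carr KS_nrm less_top)

lemma KS_le:
  assumes "z \<in> carr S" "W \<theta> z \<le> ennreal ((e / N_const \<theta>)\<^sup>2)" "e \<ge> 0"
  shows "z \<in> carr (KS \<theta>)" "nrm (KS \<theta>) z \<le> e"
proof -
  show z: "z \<in> carr (KS \<theta>)" using assms by (auto simp: KS_carr intro: le_less_trans)
  have "enn2real (W \<theta> z) \<le> (e / N_const \<theta>)\<^sup>2" using enn2real_mono[OF assms(2)] by simp
  then have "sqrt (enn2real (W \<theta> z)) \<le> sqrt ((e / N_const \<theta>)\<^sup>2)" by (rule real_sqrt_le_mono)
  also have "\<dots> = e / N_const \<theta>" using N_pos assms(3) by simp
  finally show "nrm (KS \<theta>) z \<le> e" using N_pos by (simp add: KS_nrm field_simps)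
qed

lemma KS_ge0: "0 \<le> nrm (KS \<theta>) z" using N_pos by (simp add: KS_nrm)

text \<open>The embedding of the interpolation space with second index 2 into the one with second
  index \<open>\<infinity>\<close>. It yields definiteness of the norm, convergence of Cauchy
  sequences in the sum, and the growth rate of \<open>K t z\<close> in \<open>t\<close>.\<close>

lemma K_le_KS:
  assumes z: "z \<in> carr (KS \<theta>)" and t: "t > 0"
  shows "t powr (- \<theta>) * K t z \<le> nrm (KS \<theta>) z / (N_const \<theta> * sqrt (2 powr (- (2 * \<theta>) - 1)))"
proof -
  have zS: "z \<in> carr S" using z by (simp add: KS_carr)
  let ?c = "2 powr (- (2 * \<theta>) - 1)"
  have "ennreal (?c * (t powr (- \<theta>) * K t z)\<^sup>2) \<le> ennreal ((nrm (KS \<theta>) z / N_const \<theta>)\<^sup>2)"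
    using wint_lower[OF K_klike[OF zS] t, of \<theta>] th W_eq[OF z] by simp
  then have "?c * (t powr (- \<theta>) * K t z)\<^sup>2 \<le> (nrm (KS \<theta>) z / N_const \<theta>)\<^sup>2"
    by (subst (asm) ennreal_le_iff) auto
  from real_sqrt_le_mono[OF this] have "sqrt ?c * (t powr (- \<theta>) * K t z) \<le> nrm (KS \<theta>) z / N_const \<theta>"
    using K_ge0[OF zS, of t] N_pos KS_ge0[of z] by (simp add: real_sqrt_mult)
  then show ?thesis using N_pos by (simp add: field_simps)
qed

lemma KS_subspace: "X.subspace (carr (KS \<theta>))"
proof (rule X.subspaceI)
  show "0 \<in> carr (KS \<theta>)" using Sg.in0 by (simp add: KS_carr)
  fix x y assume xy: "x \<in> carr (KS \<theta>)" "y \<in> carr (KS \<theta>)"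
  then have xyS: "x \<in> carr S" "y \<in> carr S" "x + y \<in> carr S" using S_add by (auto simp: KS_carr)
  have "W \<theta> (x + y) < \<infinity>"
    by (rule wint_triangle(1)[OF posK[OF xyS(1)] _ posK[OF xyS(2)]])
       (use xy xyS K_tri K_ge0 in \<open>auto simp: KS_carr\<close>)
  then show "x + y \<in> carr (KS \<theta>)" using xyS by (simp add: KS_carr)
next
  fix c x assume x: "x \<in> carr (KS \<theta>)"
  then have xS: "x \<in> carr S" by (simp add: KS_carr)
  have "W \<theta> (s c x) = ennreal ((cmod c)\<^sup>2) * W \<theta> x"
    using wint_cmult[OF posK[OF xS], of \<theta> "cmod c"] xS by (simp add: K_scale)
  then show "s c x \<in> carr (KS \<theta>)" using x S_scale[OF xS]
    by (simp add: KS_carr ennreal_mult_less_top)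
qed

lemma KS_normed: "normed_space s (KS \<theta>)"
  unfolding normed_space_def
proof (intro conjI ballI allI KS_subspace KS_ge0)
  fix x assume x: "x \<in> carr (KS \<theta>)"
  then have xS: "x \<in> carr S" by (simp add: KS_carr)
  show "(nrm (KS \<theta>) x = 0) = (x = 0)"
  proof
    assume "nrm (KS \<theta>) x = 0"
    then have "K 1 x \<le> 0" using K_le_KS[OF x, of 1] by simp
    then show "x = 0" using K_eq0[OF xS, of 1] K_ge0[OF xS, of 1] by simp
  qed (simp add: KS_nrm)
  fix c
  have "W \<theta> (s c x) = ennreal ((cmod c)\<^sup>2) * W \<theta> x"
    using wint_cmult[OF posK[OF xS], of \<theta> "cmod c"] xS by (simp add: K_scale)
  then show "nrm (KS \<theta>) (s c x) = cmod c * nrm (KS \<theta>) x"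
    by (simp add: KS_nrm enn2real_mult real_sqrt_mult)
next
  fix x y assume xy: "x \<in> carr (KS \<theta>)" "y \<in> carr (KS \<theta>)"
  then have xyS: "x \<in> carr S" "y \<in> carr S" "x + y \<in> carr S" using S_add by (auto simp: KS_carr)
  have "sqrt (enn2real (W \<theta> (x + y))) \<le> sqrt (enn2real (W \<theta> x)) + sqrt (enn2real (W \<theta> y))"
    by (rule wint_triangle(2)[OF posK[OF xyS(1)] _ posK[OF xyS(2)]])
       (use xy xyS K_tri K_ge0 in \<open>auto simp: KS_carr\<close>)
  then show "nrm (KS \<theta>) (x + y) \<le> nrm (KS \<theta>) x + nrm (KS \<theta>) y"
    using N_pos by (simp add: KS_nrm flip: distrib_left)
qed

lemma KS_nvs: "nvs s (KS \<theta>)" by unfold_locales (rule KS_normed)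

lemma KS_pgram: "pgram (KS \<theta>)"
  unfolding pgram_def
proof (intro ballI)
  fix x y assume xy: "x \<in> carr (KS \<theta>)" "y \<in> carr (KS \<theta>)"
  interpret k: nvs s "KS \<theta>" by (rule KS_nvs)
  have xyS: "x \<in> carr S" "y \<in> carr S" using xy by (auto simp: KS_carr)
  have xyk: "x + y \<in> carr (KS \<theta>)" "x - y \<in> carr (KS \<theta>)" using xy by auto
  let ?h = "\<lambda>t. sqrt (2 * (K t x)\<^sup>2 + 2 * (K t y)\<^sup>2)"
  have "wint \<theta> ?h = ennreal 2 * W \<theta> x + ennreal 2 * W \<theta> y"
    by (rule wint_square_sum[OF posK[OF xyS(1)] posK[OF xyS(2)]]) auto
  moreover have "wint \<theta> ?h = ennreal 1 * W \<theta> (x + y) + ennreal 1 * W \<theta> (x - y)"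
    by (rule wint_square_sum[OF posK[OF S_add[OF xyS]] posK[OF S_diff[OF xyS]]])
       (use K_pgram[OF pX pY xyS] in auto)
  ultimately have "ennreal ((nrm (KS \<theta>) (x + y) / N_const \<theta>)\<^sup>2 + (nrm (KS \<theta>) (x - y) / N_const \<theta>)\<^sup>2)
    = ennreal (2 * (nrm (KS \<theta>) x / N_const \<theta>)\<^sup>2 + 2 * (nrm (KS \<theta>) y / N_const \<theta>)\<^sup>2)"
    using xy xyk by (simp add: W_eq ennreal_mult)
  then have "(nrm (KS \<theta>) (x + y) / N_const \<theta>)\<^sup>2 + (nrm (KS \<theta>) (x - y) / N_const \<theta>)\<^sup>2
    = 2 * (nrm (KS \<theta>) x / N_const \<theta>)\<^sup>2 + 2 * (nrm (KS \<theta>) y / N_const \<theta>)\<^sup>2"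
    by (subst (asm) ennreal_inj) auto
  then show "(nrm (KS \<theta>) (x + y))\<^sup>2 + (nrm (KS \<theta>) (x - y))\<^sup>2 = 2 * (nrm (KS \<theta>) x)\<^sup>2 + 2 * (nrm (KS \<theta>) y)\<^sup>2"
    using N_pos by (simp add: power_divide field_simps)
qed

text \<open>By \<open>K_le_KS\<close> a Cauchy sequence converges in the sum. There
  \<open>K t (u n - u m)\<close> tends to \<open>K t (u n - z)\<close> for every
  \<open>t > 0\<close>, and Fatou's lemma carries the norm bound over to the limit in
  \<open>m\<close>.\<close>

lemma KS_complete: assumes u: "cauchy (KS \<theta>) u" shows "\<exists>x. conv (KS \<theta>) u x"
proof -
  interpret k: nvs s "KS \<theta>" by (rule KS_nvs)
  have uk: "u n \<in> carr (KS \<theta>)" for n using u by (simp add: cauchy_def)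
  then have uS: "u n \<in> carr S" for n by (simp add: KS_carr)
  define C where "C = 1 / (N_const \<theta> * sqrt (2 powr (- (2 * \<theta>) - 1)))"
  have C: "C > 0" using N_pos by (simp add: C_def)
  have "cauchy S u"
    unfolding cauchy_def
  proof (intro conjI allI impI uS)
    fix e :: real assume e: "e > 0"
    then have "\<exists>N. \<forall>m\<ge>N. \<forall>n\<ge>N. nrm (KS \<theta>) (u m - u n) < e / (2 * C)"
      using u C by (simp add: cauchy_def)
    then obtain N where N: "\<And>m n. m \<ge> N \<Longrightarrow> n \<ge> N \<Longrightarrow> nrm (KS \<theta>) (u m - u n) < e / (2 * C)" by blast
    show "\<exists>N. \<forall>m\<ge>N. \<forall>n\<ge>N. nrm S (u m - u n) < e"
    proof (intro exI[of _ N] allI impI)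
      fix m n assume "N \<le> m" "N \<le> n"
      have "nrm S (u m - u n) \<le> 2 * K 1 (u m - u n)"
        using Sigma_le_K[OF S_diff[OF uS uS], of 1] by simp
      also have "\<dots> \<le> 2 * (nrm (KS \<theta>) (u m - u n) * C)"
        using K_le_KS[OF k.in_diff[OF uk uk], of 1 m n] by (simp add: C_def)
      also have "\<dots> < e" using N[OF \<open>N \<le> m\<close> \<open>N \<le> n\<close>] C by (simp add: field_simps)
      finally show "nrm S (u m - u n) < e" .
    qed
  qed
  then obtain z where z: "conv S u z" using cS by blast
  have zS: "z \<in> carr S" using Sg.convD[OF z] by simp
  have lim: "(\<lambda>m. K t (u n - u m)) \<longlonglongrightarrow> K t (u n - z)" if t: "t > 0" for t n
  proof -
    have l0: "(\<lambda>m. (1 + t) * nrm S (u m - z)) \<longlonglongrightarrow> 0"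
      using z by (auto simp: conv_def intro!: tendsto_mult_right_zero)
    have "(\<lambda>m. K t (u n - u m) - K t (u n - z)) \<longlonglongrightarrow> 0"
    proof (rule Lim_null_comparison[OF _ l0], intro always_eventually allI)
      fix m
      have s: "u n - u m \<in> carr S" "u n - z \<in> carr S" "u m - z \<in> carr S" using uS zS by (auto intro: S_diff)
      have "K t (u n - z) \<le> K t (u n - u m) + K t (u m - z)" using K_tri[OF s(1,3), of t] by simp
      moreover have "K t (u n - u m) \<le> K t (u n - z) + K t (u m - z)"
        using K_tri_diff[OF s(2,3), of t] by simp
      ultimately have "\<bar>K t (u n - u m) - K t (u n - z)\<bar> \<le> K t (u m - z)" by simp
      then show "norm (K t (u n - u m) - K t (u n - z)) \<le> (1 + t) * nrm S (u m - z)"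
        using K_le_Sigma[OF s(3) t] by simp
    qed
    then show ?thesis by (rule LIM_zero_cancel)
  qed
  have ev: "\<exists>N. \<forall>n\<ge>N. u n - z \<in> carr (KS \<theta>) \<and> nrm (KS \<theta>) (u n - z) \<le> e" if e: "e > 0" for e
  proof -
    obtain N where N: "\<And>m n. m \<ge> N \<Longrightarrow> n \<ge> N \<Longrightarrow> nrm (KS \<theta>) (u m - u n) < e"
      using u e unfolding cauchy_def by blast
    have "W \<theta> (u n - z) \<le> ennreal ((e / N_const \<theta>)\<^sup>2)" if n: "n \<ge> N" for n
    proof (rule wint_fatou[where f = "\<lambda>m t. K t (u n - u (m + N))"])
      show "posmeas (\<lambda>t. K t (u n - u (m + N)))" for m by (intro posK S_diff uS)
      show "(\<lambda>m. K t (u n - u (m + N))) \<longlonglongrightarrow> K t (u n - z)" if "t > 0" for t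
        using LIMSEQ_ignore_initial_segment[OF lim[OF that]] .
      show "W \<theta> (u n - u (m + N)) \<le> ennreal ((e / N_const \<theta>)\<^sup>2)" for m
        unfolding W_eq[OF k.in_diff[OF uk uk]] using N[OF n, of "m + N"] N_pos KS_ge0
        by (intro ennreal_leI power_mono divide_right_mono) auto
    qed
    then show ?thesis using KS_le[OF S_diff[OF uS zS]] e by (meson less_imp_le)
  qed
  obtain N where "u N - z \<in> carr (KS \<theta>)" using ev[of 1] by auto
  from k.in_diff[OF uk[of N] this] have zk: "z \<in> carr (KS \<theta>)" by simp
  have "(\<lambda>n. nrm (KS \<theta>) (u n - z)) \<longlonglongrightarrow> 0"
  proof (rule LIMSEQ_I)
    fix e :: real assume "e > 0"
    then obtain N where "\<forall>n\<ge>N. nrm (KS \<theta>) (u n - z) \<le> e/2" using ev[of "e/2"] by auto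
    then show "\<exists>N. \<forall>n\<ge>N. norm (nrm (KS \<theta>) (u n - z) - 0) < e"
      using \<open>e > 0\<close> KS_ge0 by (intro exI[of _ N]) fastforce
  qed
  then show ?thesis using uk zk by (auto simp: conv_def)
qed

lemma KS_hilbert: "hilbert_space s (KS \<theta>)"
  using KS_normed KS_complete KS_pgram by (auto simp: hilbert_iff[OF vs] banach_iff[OF vs])

lemma KS_Delta:
  assumes x: "x \<in> carr X" "x \<in> carr Y" and M: "nrm X x \<le> M" "nrm Y x \<le> M"
  shows "x \<in> carr (KS \<theta>)" "nrm (KS \<theta>) x \<le> sqrt 2 * M"
proof -
  have M0: "M \<ge> 0" using X.nrm_ge0[OF x(1)] M by simp
  have xS: "x \<in> carr S" using x S_X by simp
  have "W \<theta> x \<le> ennreal (2 * M\<^sup>2 * (pi / (2 * sin (pi * \<theta>))))"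
  proof (rule wint_min_bound(2)[OF th])
    fix t :: real assume t: "t > 0"
    show "\<bar>K t x\<bar> \<le> M" using K_le_X[OF x(1), of t] K_ge0[OF xS, of t] M by simp
    have "t * nrm Y x \<le> t * M" using M t by simp
    then have "K t x \<le> t * M" using K_le_Y[OF x(2), of t] t by linarith
    then show "\<bar>K t x\<bar> \<le> t * M" using K_ge0[OF xS, of t] by simp
  qed
  also have "2 * M\<^sup>2 * (pi / (2 * sin (pi * \<theta>))) = (sqrt 2 * M / N_const \<theta>)\<^sup>2"
    using N_const_sq[OF th] N_pos by (simp add: power_divide power_mult_distrib field_simps)
  finally show "x \<in> carr (KS \<theta>)" "nrm (KS \<theta>) x \<le> sqrt 2 * M" using KS_le[OF xS] M0 by auto
qed

text \<open>The majorant \<open>3 * K t z\<close> is what \<open>K_split\<close> supplies. Dominated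
  convergence then makes the parts cut off from \<open>z\<close> small in norm as soon as their
  K-functionals vanish pointwise.\<close>

lemma KS_small:
  assumes z: "z \<in> carr (KS \<theta>)" and u: "\<And>n. u n \<in> carr S"
    and bd: "\<And>n t. t > 0 \<Longrightarrow> K t (u n) \<le> 3 * K t z" and lim: "\<And>t. t > 0 \<Longrightarrow> (\<lambda>n. K t (u n)) \<longlonglongrightarrow> 0"
  shows "u n \<in> carr (KS \<theta>)" "(\<lambda>n. nrm (KS \<theta>) (u n)) \<longlonglongrightarrow> 0"
proof -
  have zS: "z \<in> carr S" using z by (simp add: KS_carr)
  have g: "posmeas (\<lambda>t. 3 * K t z)" using posK[OF zS] unfolding posmeas_def
    by (subst mult.left_commute) (rule borel_measurable_times[OF borel_measurable_const])
  have gf: "wint \<theta> (\<lambda>t. 3 * K t z) < \<infinity>"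
    using z by (simp add: wint_cmult[OF posK[OF zS]] KS_carr ennreal_mult_less_top)
  have b: "\<bar>K t (u n)\<bar> \<le> \<bar>3 * K t z\<bar>" if "t > 0" for n t
    using bd[OF that, of n] K_ge0[OF u, of t n] K_ge0[OF zS, of t] by simp
  have "W \<theta> (u n) < \<infinity>" for n using wint_mono[of "\<lambda>t. K t (u n)" "\<lambda>t. 3 * K t z" \<theta>] b gf by (auto intro: le_less_trans)
  then show uk: "u n \<in> carr (KS \<theta>)" for n using u by (simp add: KS_carr)
  have "(\<lambda>n. W \<theta> (u n)) \<longlonglongrightarrow> wint \<theta> (\<lambda>t. 0)"
    by (rule wint_dominated[OF posK[OF u] _ g gf]) (use b lim in \<open>auto simp: posmeas_def\<close>)
  then have "(\<lambda>n. W \<theta> (u n)) \<longlonglongrightarrow> ennreal 0" by simp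
  then have "(\<lambda>n. enn2real (W \<theta> (u n))) \<longlonglongrightarrow> 0" by (rule tendsto_enn2real) simp
  then have "(\<lambda>n. N_const \<theta> * sqrt (enn2real (W \<theta> (u n)))) \<longlonglongrightarrow> N_const \<theta> * sqrt 0"
    by (intro tendsto_mult tendsto_const tendsto_real_sqrt)
  then show "(\<lambda>n. nrm (KS \<theta>) (u n)) \<longlonglongrightarrow> 0" by (simp add: KS_nrm)
qed

end

end

section \<open>Density of the intersection and diagonal spaces\<close>

lemma tendsto_Suc_powr: "p < 0 \<Longrightarrow> (\<lambda>n. real (Suc n) powr p) \<longlonglongrightarrow> 0"
  by (rule tendsto_neg_powr) (simp_all only: filterlim_compose[OF filterlim_real_sequentially filterlim_Suc])

lemma (in nvs) hilbert_space_nvs: "hilbert_space s Z \<Longrightarrow> nvs s Z"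
  by unfold_locales (simp add: hilbert_space_def banach_space_def)

context hpair begin

abbreviation "J \<theta> \<equiv> interp X Y \<theta>"

lemma J_hilbert: assumes "\<theta> \<in> {0..1}" shows "hilbert_space s (J \<theta>)"
  using hX hY KS_hilbert[of \<theta>] assms by (auto simp: interp_def)

lemma J_nvs: "\<theta> \<in> {0..1} \<Longrightarrow> nvs s (J \<theta>)" by (rule X.hilbert_space_nvs[OF J_hilbert])

lemma J_S: "\<theta> \<in> {0..1} \<Longrightarrow> z \<in> carr (J \<theta>) \<Longrightarrow> z \<in> carr S"
  using S_X S_Y by (auto simp: interp_def KS_carr split: if_splits)

text \<open>At the endpoints the trivial decomposition gives the constant 1; in between this is
  \<open>K_le_KS\<close>. One form for all exponents lets endpoint and interior spaces be treated
  alike.\<close>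

lemma J_K:
  assumes th: "\<theta> \<in> {0..1}"
  shows "\<exists>C\<ge>0. \<forall>z\<in>carr (J \<theta>). \<forall>t>0. K t z \<le> C * nrm (J \<theta>) z * t powr \<theta>"
proof -
  consider "\<theta> = 0" | "\<theta> = 1" | "0 < \<theta>" "\<theta> < 1" using th by fastforce
  then show ?thesis
  proof cases
    case 1 then show ?thesis using K_le_X by (intro exI[of _ 1]) (auto simp: interp_def)
  next
    case 2 then show ?thesis using K_le_Y by (intro exI[of _ 1]) (auto simp: interp_def mult.commute)
  next
    case 3
    define C where "C = 1 / (N_const \<theta> * sqrt (2 powr (- (2 * \<theta>) - 1)))"
    have "C \<ge> 0" using N_pos[OF 3] by (simp add: C_def)
    moreover have "K t z \<le> C * nrm (KS \<theta>) z * t powr \<theta>" if "z \<in> carr (KS \<theta>)" "t > 0" for t z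
    proof -
      have "t powr \<theta> * (t powr (- \<theta>) * K t z) \<le> t powr \<theta> * (C * nrm (KS \<theta>) z)"
        using K_le_KS[OF 3 that] by (intro mult_left_mono) (auto simp: C_def)
      moreover have "t powr \<theta> * t powr (- \<theta>) = 1" using that by (simp flip: powr_add)
      ultimately show ?thesis by (simp add: mult_ac flip: mult.assoc)
    qed
    ultimately show ?thesis using 3 by (auto simp: interp_def)
  qed
qed

lemma J_Delta:
  assumes th: "\<theta> \<in> {0..1}" and x: "x \<in> carr X" "x \<in> carr Y" and M: "nrm X x \<le> M" "nrm Y x \<le> M"
  shows "x \<in> carr (J \<theta>)" "nrm (J \<theta>) x \<le> sqrt 2 * M"
proof -
  have "M \<ge> 0" using X.nrm_ge0[OF x(1)] M by simp
  then have "M \<le> sqrt 2 * M" using mult_right_mono[of 1 "sqrt 2" M] by simp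
  then show "x \<in> carr (J \<theta>)" "nrm (J \<theta>) x \<le> sqrt 2 * M"
    using x M KS_Delta[OF _ _ x M, of \<theta>] th by (auto simp: interp_def)
qed

lemma J_conv_K:
  assumes th: "\<theta> \<in> {0..1}" and u: "conv (J \<theta>) u z" shows "(\<lambda>n. K 1 (u n - z)) \<longlonglongrightarrow> 0"
proof -
  interpret j: nvs s "J \<theta>" by (rule J_nvs[OF th])
  obtain C where C: "\<And>z t. z \<in> carr (J \<theta>) \<Longrightarrow> t > 0 \<Longrightarrow> K t z \<le> C * nrm (J \<theta>) z * t powr \<theta>"
    using J_K[OF th] by blast
  have i: "u n - z \<in> carr (J \<theta>)" for n using j.convD[OF u] by auto
  have l0: "(\<lambda>n. C * nrm (J \<theta>) (u n - z)) \<longlonglongrightarrow> 0"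
    using u by (auto simp: conv_def intro!: tendsto_mult_right_zero)
  show ?thesis
  proof (rule Lim_null_comparison[OF _ l0], intro always_eventually allI)
    fix n show "norm (K 1 (u n - z)) \<le> C * nrm (J \<theta>) (u n - z)"
      using C[OF i, of 1 n] K_ge0[OF J_S[OF th i], of 1 n] by simp
  qed
qed

text \<open>Both limits are also limits with respect to \<open>K 1\<close> in the common sum, and
  \<open>K 1\<close> separates points there.\<close>

lemma J_consistent:
  assumes th: "\<theta>0 \<in> {0..1}" "\<theta>1 \<in> {0..1}" shows "consistent (J \<theta>0) (J \<theta>1)"
  unfolding consistent_def
proof (intro allI impI)
  fix u x y assume x: "conv (J \<theta>0) u x" and y: "conv (J \<theta>1) u y"
  have S: "u n \<in> carr S" "x \<in> carr S" "y \<in> carr S" for n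
    using nvs.convD[OF J_nvs[OF th(1)] x] nvs.convD[OF J_nvs[OF th(2)] y] J_S[OF th(1)] J_S[OF th(2)] by auto
  have "(\<lambda>n. K 1 (u n - y) + K 1 (u n - x)) \<longlonglongrightarrow> 0 + 0"
    by (intro tendsto_add J_conv_K[OF th(1) x] J_conv_K[OF th(2) y])
  moreover have "K 1 (x - y) \<le> K 1 (u n - y) + K 1 (u n - x)" for n
    using K_tri_diff[OF S_diff[OF S(1) S(3)] S_diff[OF S(1) S(2)], of 1 n n] by simp
  ultimately have "K 1 (x - y) \<le> 0"
    using LIMSEQ_le_const[of "\<lambda>n. K 1 (u n - y) + K 1 (u n - x)" 0 "K 1 (x - y)"] by auto
  then have "K 1 (x - y) = 0" using K_ge0[OF S_diff[OF S(2,3)], of 1] by simp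
  then show "x = y" using K_eq0[OF S_diff[OF S(2,3)], of 1] by simp
qed

lemma J_pair:
  assumes "\<theta>0 \<in> {0..1}" "\<theta>1 \<in> {0..1}" shows "hilbert_compatible_pair s (J \<theta>0) (J \<theta>1)"
  by (rule hilbert_compatible_pairI[OF vs J_hilbert J_hilbert J_consistent]) (use assms in auto)

text \<open>By \<open>J_K\<close>, \<open>K t z\<close> is of order \<open>t powr \<theta>'\<close>,
  so the \<open>Y\<close>-part of a decomposition at \<open>t = n + 1\<close> has norm of order
  \<open>(n + 1) powr (\<theta>' - 1)\<close>, which tends to 0. The sequence is fixed before
  \<theta>, hence works for all admissible exponents at once; this is what approximation in two
  norms requires.\<close>

lemma high_part:
  assumes z: "z \<in> carr (J \<theta>')" and th': "\<theta>' \<in> {0..1}" "\<theta>' < 1"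
  shows "\<exists>h. (\<forall>n. h n \<in> carr Y \<and> z - h n \<in> carr X) \<and>
    (\<forall>\<theta>\<in>{0<..1}. z \<in> carr (J \<theta>) \<longrightarrow> (\<forall>n. h n \<in> carr (J \<theta>)) \<and> (\<lambda>n. nrm (J \<theta>) (h n)) \<longlonglongrightarrow> 0)"
proof -
  have zS: "z \<in> carr S" by (rule J_S[OF th'(1) z])
  have "\<exists>h. h \<in> carr Y \<and> z - h \<in> carr X \<and> real (Suc n) * nrm Y h \<le> 2 * K (Suc n) z \<and> (\<forall>t>0. K t h \<le> 3 * K t z)" for n
  proof -
    obtain x y where *: "x \<in> carr X" "y \<in> carr Y" "x + y = z" "real (Suc n) * nrm Y y \<le> 2 * K (Suc n) z"
       "\<forall>t>0. K t y \<le> 3 * K t z"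
      using K_split[OF zS, of "real (Suc n)"] K_eq0[OF zS, of "real (Suc n)"] by auto
    have "z - y = x" using *(3) by auto
    then show ?thesis using * by (intro exI[of _ y]) auto
  qed
  then obtain h where h: "\<And>n. h n \<in> carr Y" "\<And>n. z - h n \<in> carr X"
    "\<And>n. real (Suc n) * nrm Y (h n) \<le> 2 * K (Suc n) z" "\<And>n t. t > 0 \<Longrightarrow> K t (h n) \<le> 3 * K t z"
    by metis
  obtain C where C: "\<And>t. t > 0 \<Longrightarrow> K t z \<le> C * nrm (J \<theta>') z * t powr \<theta>'" using J_K[OF th'(1)] z by blast
  have l0: "(\<lambda>n. 2 * (C * nrm (J \<theta>') z) * real (Suc n) powr (\<theta>' - 1)) \<longlonglongrightarrow> 0"
    using th' by (intro tendsto_mult_right_zero tendsto_Suc_powr) auto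
  have hY0: "(\<lambda>n. nrm Y (h n)) \<longlonglongrightarrow> 0"
  proof (rule Lim_null_comparison[OF _ l0], intro always_eventually allI)
    fix n
    have "real (Suc n) * nrm Y (h n) \<le> 2 * (C * nrm (J \<theta>') z) * real (Suc n) powr \<theta>'"
      using h(3)[of n] C[of "real (Suc n)"] by simp
    moreover have "real (Suc n) powr (\<theta>' - 1) = real (Suc n) powr \<theta>' / real (Suc n)" by (simp add: powr_diff)
    ultimately show "norm (nrm Y (h n)) \<le> 2 * (C * nrm (J \<theta>') z) * real (Suc n) powr (\<theta>' - 1)"
      using Y.nrm_ge0[OF h(1)[of n]] by (simp add: pos_le_divide_eq mult.commute)
  qed
  have hS: "h n \<in> carr S" for n using h S_Y by blast
  have K0: "(\<lambda>n. K t (h n)) \<longlonglongrightarrow> 0" if t: "t > 0" for t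
  proof (rule Lim_null_comparison[OF _ tendsto_mult_right_zero[OF hY0]], intro always_eventually allI)
    fix n show "norm (K t (h n)) \<le> t * nrm Y (h n)" using K_le_Y[OF h(1)] K_ge0[OF hS, of t n] t by simp
  qed
  have "(\<forall>n. h n \<in> carr (J \<theta>)) \<and> (\<lambda>n. nrm (J \<theta>) (h n)) \<longlonglongrightarrow> 0" if "\<theta> \<in> {0<..1}" "z \<in> carr (J \<theta>)" for \<theta>
  proof (cases "\<theta> = 1")
    case True then show ?thesis using h hY0 by (simp add: interp_def)
  next
    case False
    then have th: "0 < \<theta>" "\<theta> < 1" and J: "J \<theta> = KS \<theta>" using that by (auto simp: interp_def)
    show ?thesis unfolding J using KS_small[OF th _ hS h(4) K0] that J by simp
  qed
  then show ?thesis using h by blast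
qed

text \<open>The mirror image of \<open>high_part\<close>: at \<open>t = 1 / (n + 1)\<close> the
  \<open>X\<close>-part has norm of order \<open>(n + 1) powr (- \<theta>')\<close>, and again one
  sequence serves all admissible exponents.\<close>

lemma low_part:
  assumes z: "z \<in> carr (J \<theta>')" and th': "\<theta>' \<in> {0..1}" "\<theta>' > 0"
  shows "\<exists>l. (\<forall>n. l n \<in> carr X \<and> z - l n \<in> carr Y) \<and>
    (\<forall>\<theta>\<in>{0..<1}. z \<in> carr (J \<theta>) \<longrightarrow> (\<forall>n. l n \<in> carr (J \<theta>)) \<and> (\<lambda>n. nrm (J \<theta>) (l n)) \<longlonglongrightarrow> 0)"
proof -
  have zS: "z \<in> carr S" by (rule J_S[OF th'(1) z])
  have "\<exists>l. l \<in> carr X \<and> z - l \<in> carr Y \<and> nrm X l \<le> 2 * K (1 / Suc n) z \<and> (\<forall>t>0. K t l \<le> 3 * K t z)" for n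
  proof -
    obtain x y where *: "x \<in> carr X" "y \<in> carr Y" "x + y = z" "nrm X x \<le> 2 * K (1 / Suc n) z"
       "\<forall>t>0. K t x \<le> 3 * K t z"
      using K_split[OF zS, of "1 / real (Suc n)"] K_eq0[OF zS, of "1 / real (Suc n)"] by auto
    have "z - x = y" using *(3) by auto
    then show ?thesis using * by (intro exI[of _ x]) auto
  qed
  then obtain l where l: "\<And>n. l n \<in> carr X" "\<And>n. z - l n \<in> carr Y"
    "\<And>n. nrm X (l n) \<le> 2 * K (1 / Suc n) z" "\<And>n t. t > 0 \<Longrightarrow> K t (l n) \<le> 3 * K t z"
    by metis
  obtain C where C: "\<And>t. t > 0 \<Longrightarrow> K t z \<le> C * nrm (J \<theta>') z * t powr \<theta>'" using J_K[OF th'(1)] z by blast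
  have l0: "(\<lambda>n. 2 * (C * nrm (J \<theta>') z) * real (Suc n) powr (- \<theta>')) \<longlonglongrightarrow> 0"
    using th' by (intro tendsto_mult_right_zero tendsto_Suc_powr) auto
  have lX0: "(\<lambda>n. nrm X (l n)) \<longlonglongrightarrow> 0"
  proof (rule Lim_null_comparison[OF _ l0], intro always_eventually allI)
    fix n
    have "(1 / real (Suc n)) powr \<theta>' = real (Suc n) powr (- \<theta>')"
      by (simp only: powr_divide powr_one_eq_one powr_minus_divide of_nat_0_le_iff zero_le_one)
    then show "norm (nrm X (l n)) \<le> 2 * (C * nrm (J \<theta>') z) * real (Suc n) powr (- \<theta>')"
      using X.nrm_ge0[OF l(1)[of n]] l(3)[of n] C[of "1 / real (Suc n)"] by (simp del: of_nat_Suc)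
  qed
  have lS: "l n \<in> carr S" for n using l S_X by blast
  have K0: "(\<lambda>n. K t (l n)) \<longlonglongrightarrow> 0" if t: "t > 0" for t
  proof (rule Lim_null_comparison[OF _ lX0], intro always_eventually allI)
    fix n show "norm (K t (l n)) \<le> nrm X (l n)" using K_le_X[OF l(1)] K_ge0[OF lS, of t n] by simp
  qed
  have "(\<forall>n. l n \<in> carr (J \<theta>)) \<and> (\<lambda>n. nrm (J \<theta>) (l n)) \<longlonglongrightarrow> 0" if "\<theta> \<in> {0..<1}" "z \<in> carr (J \<theta>)" for \<theta>
  proof (cases "\<theta> = 0")
    case True then show ?thesis using l lX0 by (simp add: interp_def)
  next
    case False
    then have th: "0 < \<theta>" "\<theta> < 1" and J: "J \<theta> = KS \<theta>" using that by (auto simp: interp_def)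
    show ?thesis unfolding J using KS_small[OF th _ lS l(4) K0] that J by simp
  qed
  then show ?thesis using l by blast
qed

text \<open>The approximant is \<open>z - h - l\<close>, where \<open>h\<close> is the \<open>Y\<close>-part of \<open>z\<close> at a large \<open>t\<close> and
  \<open>l\<close> its \<open>X\<close>-part at a small \<open>t\<close>; if \<open>z \<in> X\<close> take \<open>h = 0\<close>, if \<open>z \<in> Y\<close> take \<open>l = 0\<close>.\<close>
lemma Delta_approx:
  assumes th: "\<theta>0 \<in> {0..1}" "\<theta>1 \<in> {0..1}" "\<not> (\<theta>0 = 0 \<and> \<theta>1 = 0)" "\<not> (\<theta>0 = 1 \<and> \<theta>1 = 1)"
    and z: "z \<in> carr (J \<theta>0)" "z \<in> carr (J \<theta>1)" and e: "e > 0"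
  shows "\<exists>d. d \<in> carr X \<and> d \<in> carr Y \<and> nrm (J \<theta>0) (z - d) < e \<and> nrm (J \<theta>1) (z - d) < e"
proof -
  interpret j0: nvs s "J \<theta>0" by (rule J_nvs[OF th(1)])
  interpret j1: nvs s "J \<theta>1" by (rule J_nvs[OF th(2)])
  have lim: "\<exists>n. a n < e/2 \<and> b n < e/2" if "a \<longlonglongrightarrow> 0" "b \<longlonglongrightarrow> 0" for a b :: "nat \<Rightarrow> real"
  proof -
    have "\<forall>\<^sub>F n in sequentially. a n < e/2 \<and> b n < e/2"
      using e by (intro eventually_conj order_tendstoD(2)[OF that(1)] order_tendstoD(2)[OF that(2)]) auto
    then show ?thesis using eventually_happens by fastforce
  qed
  have "\<exists>h. h \<in> carr Y \<and> z - h \<in> carr X \<and> h \<in> carr (J \<theta>0) \<and> h \<in> carr (J \<theta>1)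
      \<and> nrm (J \<theta>0) h < e/2 \<and> nrm (J \<theta>1) h < e/2"
  proof (cases "\<theta>0 = 0 \<or> \<theta>1 = 0")
    case True
    then have "z \<in> carr X" using z by (auto simp: interp_def)
    then show ?thesis using e by (intro exI[of _ 0]) auto
  next
    case False
    then have pos: "\<theta>0 \<in> {0<..1}" "\<theta>1 \<in> {0<..1}" using th by auto
    have "\<exists>h. (\<forall>n. h n \<in> carr Y \<and> z - h n \<in> carr X) \<and>
       (\<forall>\<theta>\<in>{0<..1}. z \<in> carr (J \<theta>) \<longrightarrow> (\<forall>n. h n \<in> carr (J \<theta>)) \<and> (\<lambda>n. nrm (J \<theta>) (h n)) \<longlonglongrightarrow> 0)"
    \<comment> \<open>An exponent below 1 supplies the decay rate in \<open>high_part\<close>; as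
      the exponents are not both 1, one of them qualifies.\<close>
    proof (cases "\<theta>0 = 1")
      case True then show ?thesis using high_part[OF z(2) th(2)] th by auto
    next
      case False then show ?thesis using high_part[OF z(1) th(1)] th by auto
    qed
    then obtain h where h: "\<forall>n. h n \<in> carr Y \<and> z - h n \<in> carr X"
      "\<forall>\<theta>\<in>{0<..1}. z \<in> carr (J \<theta>) \<longrightarrow> (\<forall>n. h n \<in> carr (J \<theta>)) \<and> (\<lambda>n. nrm (J \<theta>) (h n)) \<longlonglongrightarrow> 0"
      by blast
    have h0: "(\<forall>n. h n \<in> carr (J \<theta>0)) \<and> (\<lambda>n. nrm (J \<theta>0) (h n)) \<longlonglongrightarrow> 0"
      and h1: "(\<forall>n. h n \<in> carr (J \<theta>1)) \<and> (\<lambda>n. nrm (J \<theta>1) (h n)) \<longlonglongrightarrow> 0"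
      using h(2) pos z by auto
    obtain n where "nrm (J \<theta>0) (h n) < e/2" "nrm (J \<theta>1) (h n) < e/2"
      using lim[OF conjunct2[OF h0] conjunct2[OF h1]] by blast
    then show ?thesis using h(1) h0 h1 by blast
  qed
  then obtain h where h: "h \<in> carr Y" "z - h \<in> carr X" "h \<in> carr (J \<theta>0)" "h \<in> carr (J \<theta>1)"
      "nrm (J \<theta>0) h < e/2" "nrm (J \<theta>1) h < e/2" by blast
  have "\<exists>l. l \<in> carr X \<and> z - l \<in> carr Y \<and> l \<in> carr (J \<theta>0) \<and> l \<in> carr (J \<theta>1)
      \<and> nrm (J \<theta>0) l < e/2 \<and> nrm (J \<theta>1) l < e/2"
  proof (cases "\<theta>0 = 1 \<or> \<theta>1 = 1")
    case True
    then have "z \<in> carr Y" using z by (auto simp: interp_def)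
    then show ?thesis using e by (intro exI[of _ 0]) auto
  next
    case False
    then have pos: "\<theta>0 \<in> {0..<1}" "\<theta>1 \<in> {0..<1}" using th by auto
    have "\<exists>h. (\<forall>n. h n \<in> carr X \<and> z - h n \<in> carr Y) \<and>
       (\<forall>\<theta>\<in>{0..<1}. z \<in> carr (J \<theta>) \<longrightarrow> (\<forall>n. h n \<in> carr (J \<theta>)) \<and> (\<lambda>n. nrm (J \<theta>) (h n)) \<longlonglongrightarrow> 0)"
    proof (cases "\<theta>0 = 0")
      case True then show ?thesis using low_part[OF z(2) th(2)] th by auto
    next
      case False then show ?thesis using low_part[OF z(1) th(1)] th by auto
    qed
    then obtain h where h: "\<forall>n. h n \<in> carr X \<and> z - h n \<in> carr Y"
      "\<forall>\<theta>\<in>{0..<1}. z \<in> carr (J \<theta>) \<longrightarrow> (\<forall>n. h n \<in> carr (J \<theta>)) \<and> (\<lambda>n. nrm (J \<theta>) (h n)) \<longlonglongrightarrow> 0"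
      by blast
    have h0: "(\<forall>n. h n \<in> carr (J \<theta>0)) \<and> (\<lambda>n. nrm (J \<theta>0) (h n)) \<longlonglongrightarrow> 0"
      and h1: "(\<forall>n. h n \<in> carr (J \<theta>1)) \<and> (\<lambda>n. nrm (J \<theta>1) (h n)) \<longlonglongrightarrow> 0"
      using h(2) pos z by auto
    obtain n where "nrm (J \<theta>0) (h n) < e/2" "nrm (J \<theta>1) (h n) < e/2"
      using lim[OF conjunct2[OF h0] conjunct2[OF h1]] by blast
    then show ?thesis using h(1) h0 h1 by blast
  qed
  then obtain l where l: "l \<in> carr X" "z - l \<in> carr Y" "l \<in> carr (J \<theta>0)" "l \<in> carr (J \<theta>1)"
      "nrm (J \<theta>0) l < e/2" "nrm (J \<theta>1) l < e/2" by blast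
  \<comment> \<open>Both cuts are made in the same \<open>z\<close>: reading \<open>d\<close> as
    \<open>(z - h) - l\<close> shows membership in \<open>X\<close>, as \<open>(z - l) - h\<close>
    membership in \<open>Y\<close>.\<close>
  define d where "d = z - h - l"
  have "d \<in> carr X" unfolding d_def using h(2) l(1) by (rule X.in_diff)
  moreover have "d = (z - l) - h" by (simp add: d_def algebra_simps)
  then have "d \<in> carr Y" using Y.in_diff[OF l(2) h(1)] by simp
  moreover have zd: "z - d = h + l" by (simp add: d_def)
  have "nrm (J \<theta>0) (z - d) < e" unfolding zd using j0.nrm_tri[OF h(3) l(3)] h(5) l(5) by simp
  moreover have "nrm (J \<theta>1) (z - d) < e" unfolding zd using j1.nrm_tri[OF h(4) l(4)] h(6) l(6) by simp
  ultimately show ?thesis by blast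
qed

lemma Delta_dense_J:
  assumes "0 < \<theta>" "\<theta> < 1" shows "dense_in (carr X \<inter> carr Y) (J \<theta>)"
proof -
  have th: "\<theta> \<in> {0..1}" using assms by simp
  interpret j: nvs s "J \<theta>" by (rule J_nvs[OF th])
  show ?thesis unfolding j.dense_in_iff
    using J_Delta(1)[OF th _ _ max.cobounded1 max.cobounded2] Delta_approx[OF th th] assms by (auto simp: Bex_def)
qed

end

section \<open>K-functionals in diagonal coordinates\<close>

lemma kscal_le: "a > 0 \<Longrightarrow> b > 0 \<Longrightarrow> (p + q)\<^sup>2 * (kscal a b t)\<^sup>2 \<le> a * p\<^sup>2 + t\<^sup>2 * (b * q\<^sup>2)"
proof -
  assume a: "a > 0" and b: "b > 0"
  have D: "a + t\<^sup>2 * b > 0" using a b by (intro add_pos_nonneg) auto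
  have "(a * p\<^sup>2 + t\<^sup>2 * (b * q\<^sup>2)) * (a + t\<^sup>2 * b) - (p + q)\<^sup>2 * (t\<^sup>2 * a * b) = (a * p - t\<^sup>2 * b * q)\<^sup>2"
    by (simp add: power2_eq_square algebra_simps)
  then have "(p + q)\<^sup>2 * (t\<^sup>2 * a * b) \<le> (a * p\<^sup>2 + t\<^sup>2 * (b * q\<^sup>2)) * (a + t\<^sup>2 * b)"
    using zero_le_power2[of "a * p - t\<^sup>2 * b * q"] by linarith
  moreover have "(kscal a b t)\<^sup>2 = t\<^sup>2 * a * b / (a + t\<^sup>2 * b)" using a b D by (simp add: kscal_def)
  ultimately show ?thesis using D by (simp add: pos_divide_le_eq)
qed

text \<open>The defect in \<open>kscal_le\<close>, multiplied by \<open>a + t^2 * b\<close>, is the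
  square of \<open>a * p - t^2 * b * q\<close>, which vanishes at this proportion. Hence
  \<open>kscal\<close> is the K-functional of a unit vector in a one-dimensional pair with squared
  weights \<open>a\<close> and \<open>b\<close>.\<close>

lemma kscal_attained:
  assumes "a > 0" "b > 0"
  shows "a * (t\<^sup>2 * b / (a + t\<^sup>2 * b))\<^sup>2 + t\<^sup>2 * (b * (1 - t\<^sup>2 * b / (a + t\<^sup>2 * b))\<^sup>2) = (kscal a b t)\<^sup>2"
proof -
  define D where "D = a + t\<^sup>2 * b"
  have D: "D > 0" unfolding D_def using assms by (intro add_pos_nonneg) auto
  have 1: "1 - t\<^sup>2 * b / D = a / D" using D by (simp add: field_simps) (simp add: D_def)
  have "(kscal a b t)\<^sup>2 = t\<^sup>2 * a * b / D" using assms D by (simp add: kscal_def D_def)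
  moreover have "a * (t\<^sup>2 * b / D)\<^sup>2 + t\<^sup>2 * (b * (a / D)\<^sup>2) = (t\<^sup>2 * a * b) * (a + t\<^sup>2 * b) / D\<^sup>2"
    by (simp add: power_divide add_divide_distrib[symmetric]) (simp add: power2_eq_square algebra_simps)
  moreover have "(t\<^sup>2 * a * b) * (a + t\<^sup>2 * b) / D\<^sup>2 = t\<^sup>2 * a * b / D"
    unfolding D_def[symmetric] using D by (simp add: power2_eq_square)
  ultimately show ?thesis unfolding D_def[symmetric] 1 by simp
qed

text \<open>The triangle inequality reduces decompositions in \<open>X\<close> to proportions of one
  vector, that is, to the scalar model with equal weights. This settles equal exponents in the
  reiteration, where the intersection need not be dense if both are 0 or both are 1.\<close>

lemma interp_same:
  assumes s: "vector_space s" and X: "normed_space s X" and th: "0 < \<theta>" "\<theta> < 1"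
  shows "space_eq (interp X X \<theta>) X"
proof -
  interpret npair s X X using s X by (auto simp: npair_def nvs_def complex_vs_def nvs_axioms_def)
  have S: "carr (Sigma_space X X) = carr X" using X.in0 by (force simp: Sigma_iff set_eq_iff)
  have K: "K t x = nrm X x * kscal 1 1 t" if x: "x \<in> carr X" for x t
  proof (rule antisym)
    have k0: "kscal 1 1 t \<ge> 0" by (simp add: kscal_def)
    define r where "r = t\<^sup>2 * 1 / (1 + t\<^sup>2 * 1)"
    have r: "0 \<le> r" "r \<le> 1" by (auto simp: r_def divide_le_eq_1 add_pos_nonneg)
    have "s (of_real r) x + s (of_real (1 - r)) x = x" by (simp flip: X.scale_left_distrib)
    then have "K t x \<le> sqrt ((nrm X (s (of_real r) x))\<^sup>2 + t\<^sup>2 * (nrm X (s (of_real (1 - r)) x))\<^sup>2)"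
      using x by (intro K_lower) auto
    also have "\<dots> = sqrt ((nrm X x)\<^sup>2 * (1 * r\<^sup>2 + t\<^sup>2 * (1 * (1 - r)\<^sup>2)))"
      unfolding X.nrm_scale[OF x] norm_of_real by (simp add: power_mult_distrib algebra_simps)
    also have "1 * r\<^sup>2 + t\<^sup>2 * (1 * (1 - r)\<^sup>2) = (kscal 1 1 t)\<^sup>2"
      unfolding r_def by (rule kscal_attained) auto
    also have "sqrt ((nrm X x)\<^sup>2 * (kscal 1 1 t)\<^sup>2) = nrm X x * kscal 1 1 t"
      using X.nrm_ge0[OF x] k0 by (simp add: real_sqrt_mult)
    finally show "K t x \<le> nrm X x * kscal 1 1 t" .
    show "nrm X x * kscal 1 1 t \<le> K t x"
    proof (rule K_greatest)
      show "x \<in> carr S" using x S by simp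
      fix y z assume yz: "y \<in> carr X" "z \<in> carr X" "y + z = x"
      have "(nrm X x * kscal 1 1 t)\<^sup>2 \<le> ((nrm X y + nrm X z) * kscal 1 1 t)\<^sup>2"
        using X.nrm_tri[OF yz(1,2)] X.nrm_ge0[OF x] k0 yz(3) by (intro power_mono mult_right_mono) auto
      also have "\<dots> \<le> (nrm X y)\<^sup>2 + t\<^sup>2 * (nrm X z)\<^sup>2"
        using kscal_le[of 1 1 "nrm X y" "nrm X z" t] by (simp add: power_mult_distrib)
      finally show "nrm X x * kscal 1 1 t \<le> sqrt ((nrm X y)\<^sup>2 + t\<^sup>2 * (nrm X z)\<^sup>2)" by (rule real_le_rsqrt)
    qed
  qed
  have W: "K_integral X X \<theta> x = ennreal ((nrm X x)\<^sup>2 * (pi / (2 * sin (pi * \<theta>))))" if x: "x \<in> carr X" for x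
  proof -
    have "K_integral X X \<theta> x = ennreal ((nrm X x)\<^sup>2) * ennreal (pi / (2 * sin (pi * \<theta>)))"
      using wint_cmult[OF klike_posmeas[OF klike_kscal], of 1 1 \<theta> "nrm X x"] wint_kscal[OF _ _ th, of 1 1]
      by (simp add: K_integral_eq K[OF x])
    also have "\<dots> = ennreal ((nrm X x)\<^sup>2 * (pi / (2 * sin (pi * \<theta>))))"
      using sin_pi_pos[OF th] by (intro ennreal_mult[symmetric]) auto
    finally show ?thesis .
  qed
  have "carr (K_space X X \<theta>) = carr X" using W by (auto simp: K_space_def S)
  moreover have "nrm (K_space X X \<theta>) x = nrm X x" if x: "x \<in> carr X" for x
  proof -
    have "nrm (K_space X X \<theta>) x = N_const \<theta> * sqrt ((nrm X x)\<^sup>2 * (pi / (2 * sin (pi * \<theta>))))"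
      using sin_pi_pos[OF th] by (simp add: K_space_def W[OF x])
    also have "\<dots> = sqrt ((N_const \<theta>)\<^sup>2 * ((nrm X x)\<^sup>2 * (pi / (2 * sin (pi * \<theta>)))))"
      using N_const_pos[OF th] by (simp only: real_sqrt_mult real_sqrt_abs abs_of_pos)
    also have "(N_const \<theta>)\<^sup>2 * ((nrm X x)\<^sup>2 * (pi / (2 * sin (pi * \<theta>)))) = (nrm X x)\<^sup>2 * ((N_const \<theta>)\<^sup>2 * (pi / (2 * sin (pi * \<theta>))))"
      by (rule mult.left_commute)
    also have "\<dots> = (nrm X x)\<^sup>2" unfolding N_const_sq[OF th] by simp
    finally show ?thesis using X.nrm_ge0[OF x] by simp
  qed
  ultimately show ?thesis using th by (simp add: space_eq_def interp_def)
qed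

text \<open>Just enough linear structure for coordinatewise minimization: splittings act additively
  on coordinates, and arbitrary coordinate values are realized, so optimal splittings of the single
  coordinates assemble to a vector of \<open>F\<close>.\<close>

definition coord :: "'v::ab_group_add set \<Rightarrow> 'e set \<Rightarrow> ('v \<Rightarrow> 'e \<Rightarrow> complex) \<Rightarrow> bool" where
  "coord F E c \<longleftrightarrow> finite E \<and> 0 \<in> F \<and> (\<forall>x\<in>F. \<forall>y\<in>F. x + y \<in> F \<and> x - y \<in> F) \<and>
     (\<forall>x\<in>F. \<forall>y\<in>F. \<forall>e\<in>E. c (x + y) e = c x e + c y e) \<and> (\<forall>h. \<exists>x\<in>F. \<forall>e\<in>E. c x e = h e)"

definition diagonal :: "'v::ab_group_add set \<Rightarrow> 'e set \<Rightarrow> ('v \<Rightarrow> 'e \<Rightarrow> complex) \<Rightarrow> ('e \<Rightarrow> real) \<Rightarrow> 'v nspace \<Rightarrow> bool"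
  where "diagonal F E c a Z \<longleftrightarrow> carr Z = F \<and> (\<forall>x\<in>F. nrm Z x = sqrt (\<Sum>e\<in>E. a e * (cmod (c x e))\<^sup>2))"

text \<open>The cost of a splitting is a sum over coordinates, so the minimization decouples:
  \<open>kscal_le\<close> bounds each term, and one vector attains the optimal shares of all
  coordinates together.\<close>

lemma diagonal_K:
  assumes co: "coord F E c" and X: "diagonal F E c a X" and Y: "diagonal F E c b Y"
    and pos: "\<And>e. e \<in> E \<Longrightarrow> a e > 0" "\<And>e. e \<in> E \<Longrightarrow> b e > 0" and x: "x \<in> F"
  shows "K_functional X Y t x = sqrt (\<Sum>e\<in>E. (cmod (c x e))\<^sup>2 * (kscal (a e) (b e) t)\<^sup>2)"
proof (rule antisym)
  have XF: "carr X = F" and YF: "carr Y = F" using X Y by (auto simp: diagonal_def)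
  have nX: "(nrm X y)\<^sup>2 = (\<Sum>e\<in>E. a e * (cmod (c y e))\<^sup>2)" if "y \<in> F" for y
    using X that pos(1) by (simp add: diagonal_def sum_nonneg less_imp_le)
  have nY: "(nrm Y y)\<^sup>2 = (\<Sum>e\<in>E. b e * (cmod (c y e))\<^sup>2)" if "y \<in> F" for y
    using Y that pos(2) by (simp add: diagonal_def sum_nonneg less_imp_le)
  have N: "(nrm X y)\<^sup>2 + t\<^sup>2 * (nrm Y z)\<^sup>2 = (\<Sum>e\<in>E. a e * (cmod (c y e))\<^sup>2 + t\<^sup>2 * (b e * (cmod (c z e))\<^sup>2))"
    if "y \<in> F" "z \<in> F" for y z
    using that by (simp add: nX nY sum.distrib sum_distrib_left)
  have add: "c (y + z) e = c y e + c z e" if "y \<in> F" "z \<in> F" "e \<in> E" for y z e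
    using co that by (simp add: coord_def)
  show "sqrt (\<Sum>e\<in>E. (cmod (c x e))\<^sup>2 * (kscal (a e) (b e) t)\<^sup>2) \<le> K_functional X Y t x"
  proof (rule K_greatest)
    show "x \<in> carr (Sigma_space X Y)" unfolding Sigma_iff XF YF
      using x co by (intro bexI[of _ x] bexI[of _ 0]) (auto simp: coord_def)
    fix y z assume "y \<in> carr X" "z \<in> carr Y" and yz: "y + z = x"
    then have F: "y \<in> F" "z \<in> F" by (simp_all add: XF YF)
    show "sqrt (\<Sum>e\<in>E. (cmod (c x e))\<^sup>2 * (kscal (a e) (b e) t)\<^sup>2) \<le> sqrt ((nrm X y)\<^sup>2 + t\<^sup>2 * (nrm Y z)\<^sup>2)"
      unfolding N[OF F]
    proof (intro real_sqrt_le_mono sum_mono)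
      fix e assume e: "e \<in> E"
      have "cmod (c x e) \<le> cmod (c y e) + cmod (c z e)"
        using add[OF F e] norm_triangle_ineq yz by metis
      then have "(cmod (c x e))\<^sup>2 * (kscal (a e) (b e) t)\<^sup>2 \<le> (cmod (c y e) + cmod (c z e))\<^sup>2 * (kscal (a e) (b e) t)\<^sup>2"
        by (intro mult_right_mono power_mono) auto
      also have "\<dots> \<le> a e * (cmod (c y e))\<^sup>2 + t\<^sup>2 * (b e * (cmod (c z e))\<^sup>2)"
        using pos e by (intro kscal_le)
      finally show "(cmod (c x e))\<^sup>2 * (kscal (a e) (b e) t)\<^sup>2 \<le> a e * (cmod (c y e))\<^sup>2 + t\<^sup>2 * (b e * (cmod (c z e))\<^sup>2)" .
    qed
  qed
  \<comment> \<open>The optimal share of the \<open>X\<close>-part in each coordinate, taken from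
    \<open>kscal_attained\<close>.\<close>
  define r where "r e = t\<^sup>2 * b e / (a e + t\<^sup>2 * b e)" for e
  have "\<exists>y\<in>F. \<forall>e\<in>E. c y e = of_real (r e) * c x e"
    using co unfolding coord_def by (elim conjE allE[of _ "\<lambda>e. of_real (r e) * c x e"]) blast
  then obtain y where y: "y \<in> F" "\<And>e. e \<in> E \<Longrightarrow> c y e = of_real (r e) * c x e" by blast
  have z: "x - y \<in> F" using co x y by (simp add: coord_def)
  have cz: "c (x - y) e = of_real (1 - r e) * c x e" if e: "e \<in> E" for e
    using add[OF z y(1) e] y(2)[OF e] by (simp add: algebra_simps)
  have "K_functional X Y t x \<le> sqrt ((nrm X y)\<^sup>2 + t\<^sup>2 * (nrm Y (x - y))\<^sup>2)"
    using y z by (intro K_lower) (auto simp: XF YF)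
  also have "\<dots> = sqrt (\<Sum>e\<in>E. (cmod (c x e))\<^sup>2 * (kscal (a e) (b e) t)\<^sup>2)"
    unfolding N[OF y(1) z]
  proof (intro arg_cong[where f = sqrt] sum.cong refl)
    fix e assume e: "e \<in> E"
    have "a e * (cmod (c y e))\<^sup>2 + t\<^sup>2 * (b e * (cmod (c (x - y) e))\<^sup>2)
      = (cmod (c x e))\<^sup>2 * (a e * (r e)\<^sup>2 + t\<^sup>2 * (b e * (1 - r e)\<^sup>2))"
      unfolding y(2)[OF e] cz[OF e] norm_mult norm_of_real by (simp add: power_mult_distrib algebra_simps)
    also have "a e * (r e)\<^sup>2 + t\<^sup>2 * (b e * (1 - r e)\<^sup>2) = (kscal (a e) (b e) t)\<^sup>2"
      unfolding r_def using pos e by (intro kscal_attained) auto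
    finally show "a e * (cmod (c y e))\<^sup>2 + t\<^sup>2 * (b e * (cmod (c (x - y) e))\<^sup>2)
      = (cmod (c x e))\<^sup>2 * (kscal (a e) (b e) t)\<^sup>2" .
  qed
  finally show "K_functional X Y t x \<le> sqrt (\<Sum>e\<in>E. (cmod (c x e))\<^sup>2 * (kscal (a e) (b e) t)\<^sup>2)" .
qed

text \<open>By \<open>diagonal_K\<close> the square of the K-functional is a sum of scalar terms.
  Integrating each by \<open>wint_kscal\<close> produces the geometric mean of its weights, and
  \<open>N_const\<close> removes the common constant. At the endpoints the powers reduce to
  \<open>a\<close> or \<open>b\<close>.\<close>

lemma diagonal_interp:
  assumes co: "coord F E c" and X: "diagonal F E c a X" and Y: "diagonal F E c b Y"
    and pos: "\<And>e. e \<in> E \<Longrightarrow> a e > 0" "\<And>e. e \<in> E \<Longrightarrow> b e > 0" and th: "\<theta> \<in> {0..1}"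
  shows "diagonal F E c (\<lambda>e. a e powr (1 - \<theta>) * b e powr \<theta>) (interp X Y \<theta>)"
proof -
  consider "\<theta> = 0" | "\<theta> = 1" | "0 < \<theta>" "\<theta> < 1" using th by fastforce
  then show ?thesis
  proof cases
    case 1
    have "(\<Sum>e\<in>E. a e powr (1 - \<theta>) * b e powr \<theta> * (cmod (c x e))\<^sup>2) = (\<Sum>e\<in>E. a e * (cmod (c x e))\<^sup>2)" for x
      by (intro sum.cong refl) (use pos 1 in \<open>simp add: less_imp_neq[symmetric] less_imp_le\<close>)
    then show ?thesis using X 1 by (simp add: interp_def diagonal_def)
  next
    case 2
    have "(\<Sum>e\<in>E. a e powr (1 - \<theta>) * b e powr \<theta> * (cmod (c x e))\<^sup>2) = (\<Sum>e\<in>E. b e * (cmod (c x e))\<^sup>2)" for x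
      by (intro sum.cong refl) (use pos 2 in \<open>simp add: less_imp_neq[symmetric] less_imp_le\<close>)
    then show ?thesis using Y 2 by (simp add: interp_def diagonal_def)
  next
    case 3
    define p where "p = pi / (2 * sin (pi * \<theta>))"
    have p: "p > 0" using sin_pi_pos[OF 3] by (simp add: p_def)
    have S: "carr (Sigma_space X Y) = F"
    proof -
      have "carr X = F" "carr Y = F" using X Y by (auto simp: diagonal_def)
      moreover have "0 \<in> F" "\<And>x y. x \<in> F \<Longrightarrow> y \<in> F \<Longrightarrow> x + y \<in> F" using co by (auto simp: coord_def)
      ultimately show ?thesis by (auto simp: set_eq_iff Sigma_iff) (metis add.right_neutral)
    qed
    have fE: "finite E" using co by (simp add: coord_def)
    have W: "K_integral X Y \<theta> x = ennreal ((\<Sum>e\<in>E. a e powr (1 - \<theta>) * b e powr \<theta> * (cmod (c x e))\<^sup>2) * p)" if x: "x \<in> F" for x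
    proof -
      have Kx: "K_functional X Y t x = sqrt (\<Sum>e\<in>E. (cmod (c x e))\<^sup>2 * (kscal (a e) (b e) t)\<^sup>2)" for t
        by (rule diagonal_K[OF co X Y _ _ x]) (use pos in auto)
      have "K_integral X Y \<theta> x = (\<Sum>e\<in>E. ennreal ((cmod (c x e))\<^sup>2) * wint \<theta> (kscal (a e) (b e)))"
        unfolding K_integral_eq Kx by (rule wint_sum) (use fE pos in \<open>auto intro!: klike_posmeas klike_kscal\<close>)
      also have "\<dots> = (\<Sum>e\<in>E. ennreal (a e powr (1 - \<theta>) * b e powr \<theta> * (cmod (c x e))\<^sup>2 * p))"
        using pos 3 p by (intro sum.cong refl) (simp add: wint_kscal p_def[symmetric] ennreal_mult[symmetric] mult_ac)
      also have "\<dots> = ennreal ((\<Sum>e\<in>E. a e powr (1 - \<theta>) * b e powr \<theta> * (cmod (c x e))\<^sup>2) * p)"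
        using p by (subst sum_ennreal) (auto simp: sum_distrib_right)
      finally show ?thesis .
    qed
    have "carr (K_space X Y \<theta>) = F" using W by (auto simp: K_space_def S)
    moreover have "nrm (K_space X Y \<theta>) x = sqrt (\<Sum>e\<in>E. a e powr (1 - \<theta>) * b e powr \<theta> * (cmod (c x e))\<^sup>2)" if x: "x \<in> F" for x
    proof -
      let ?q = "\<Sum>e\<in>E. a e powr (1 - \<theta>) * b e powr \<theta> * (cmod (c x e))\<^sup>2"
      have q: "?q \<ge> 0" by (intro sum_nonneg) auto
      have "nrm (K_space X Y \<theta>) x = sqrt ((N_const \<theta>)\<^sup>2 * (?q * p))"
        using p q N_const_pos[OF 3] by (simp add: K_space_def W[OF x] real_sqrt_mult)
      also have "(N_const \<theta>)\<^sup>2 * (?q * p) = ?q * ((N_const \<theta>)\<^sup>2 * p)" by (rule mult.left_commute)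
      also have "\<dots> = ?q" unfolding p_def N_const_sq[OF 3] by simp
      finally show ?thesis .
    qed
    ultimately show ?thesis using 3 by (simp add: diagonal_def interp_def)
  qed
qed

section \<open>Simultaneous orthogonal bases\<close>

context ips begin

lemma in_sum: "(\<And>i. i \<in> A \<Longrightarrow> f i \<in> carr X) \<Longrightarrow> sum f A \<in> carr X"
  by (rule subspace_sum[OF sub])

lemma ip_sum_left:
  assumes "finite A" "\<And>i. i \<in> A \<Longrightarrow> f i \<in> carr X" "z \<in> carr X"
  shows "ip (sum f A) z = (\<Sum>i\<in>A. ip (f i) z)"
  using assms by (induction A) (auto simp: ip_zero_left ip_add_left in_sum)

lemma ip_sum_right:
  assumes "finite A" "\<And>i. i \<in> A \<Longrightarrow> f i \<in> carr X" "z \<in> carr X"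
  shows "ip z (sum f A) = (\<Sum>i\<in>A. ip z (f i))"
  using assms by (induction A) (auto simp: ip_zero_right ip_add_right in_sum)

text \<open>As a polynomial in the coefficients and their conjugates, the squared norm is visibly
  continuous in the coefficients; \<open>rayleigh\<close> minimizes over them.\<close>

lemma nrm_comb_sq:
  assumes "finite B" "B \<subseteq> carr X"
  shows "(nrm X (\<Sum>b\<in>B. s (c b) b))\<^sup>2 = Re (\<Sum>b\<in>B. \<Sum>b'\<in>B. c b * (cnj (c b') * ip b b'))"
proof -
  have i: "b \<in> carr X" if "b \<in> B" for b using assms that by auto
  have "ip (\<Sum>b\<in>B. s (c b) b) (\<Sum>b\<in>B. s (c b) b) = (\<Sum>b\<in>B. c b * ip b (\<Sum>b\<in>B. s (c b) b))"
    using assms(1) i by (subst ip_sum_left) (auto intro!: in_sum sum.cong ip_scale_left)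
  also have "\<dots> = (\<Sum>b\<in>B. \<Sum>b'\<in>B. c b * (cnj (c b') * ip b b'))"
    unfolding sum_distrib_left[symmetric]
    by (intro sum.cong refl arg_cong2[where f = times])
       (use assms(1) i in \<open>auto simp: ip_sum_right ip_scale_right in_scale\<close>)
  finally have "Re (ip (\<Sum>b\<in>B. s (c b) b) (\<Sum>b\<in>B. s (c b) b)) = Re (\<Sum>b\<in>B. \<Sum>b'\<in>B. c b * (cnj (c b') * ip b b'))"
    by simp
  then show ?thesis using i by (simp add: ip_self in_sum in_scale)
qed

lemma orth_coeff:
  assumes "finite E" "E \<subseteq> carr X" "\<And>e f. e \<in> E \<Longrightarrow> f \<in> E \<Longrightarrow> e \<noteq> f \<Longrightarrow> ip e f = 0" "f \<in> E"
  shows "ip (\<Sum>e\<in>E. s (h e) e) f = h f * ip f f"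
proof -
  have "ip (\<Sum>e\<in>E. s (h e) e) f = (\<Sum>e\<in>E. h e * ip e f)"
    using assms by (subst ip_sum_left) (auto intro!: sum.cong ip_scale_left)
  also have "\<dots> = (\<Sum>e\<in>E. if e = f then h f * ip f f else 0)"
    using assms by (intro sum.cong) auto
  finally show ?thesis using assms by simp
qed

lemma orth_nrm:
  assumes E: "finite E" "E \<subseteq> carr X" "\<And>e f. e \<in> E \<Longrightarrow> f \<in> E \<Longrightarrow> e \<noteq> f \<Longrightarrow> ip e f = 0"
  shows "nrm X (\<Sum>e\<in>E. s (h e) e) = sqrt (\<Sum>e\<in>E. (nrm X e)\<^sup>2 * (cmod (h e))\<^sup>2)"
proof -
  let ?x = "\<Sum>e\<in>E. s (h e) e"
  have i: "e \<in> carr X" if "e \<in> E" for e using E that by auto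
  have x: "?x \<in> carr X" using i by (intro in_sum in_scale)
  have "ip ?x ?x = (\<Sum>e\<in>E. cnj (h e) * ip ?x e)"
    using E(1) i x by (subst ip_sum_right) (auto intro!: sum.cong ip_scale_right)
  also have "\<dots> = (\<Sum>e\<in>E. complex_of_real ((nrm X e)\<^sup>2 * (cmod (h e))\<^sup>2))"
  proof (intro sum.cong refl)
    fix e assume e: "e \<in> E"
    have "cnj (h e) * ip ?x e = (h e * cnj (h e)) * ip e e"
      using orth_coeff[OF E e, of h] by simp
    also have "\<dots> = complex_of_real ((nrm X e)\<^sup>2 * (cmod (h e))\<^sup>2)"
      using ip_self[OF i[OF e]] complex_norm_square[of "h e"] by simp
    finally show "cnj (h e) * ip ?x e = complex_of_real ((nrm X e)\<^sup>2 * (cmod (h e))\<^sup>2)" .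
  qed
  finally have "complex_of_real ((nrm X ?x)\<^sup>2) = complex_of_real (\<Sum>e\<in>E. (nrm X e)\<^sup>2 * (cmod (h e))\<^sup>2)"
    using ip_self[OF x] by simp
  then have "(nrm X ?x)\<^sup>2 = (\<Sum>e\<in>E. (nrm X e)\<^sup>2 * (cmod (h e))\<^sup>2)" by (simp only: of_real_eq_iff)
  then show ?thesis using nrm_ge0[OF x] by (metis real_sqrt_abs abs_of_nonneg)
qed

end

definition subsp :: "'v nspace \<Rightarrow> 'v set \<Rightarrow> 'v nspace" where
  "subsp X F = \<lparr>carr = F, nrm = nrm X\<rparr>"

lemma subsp_simps[simp]: "carr (subsp X F) = F" "nrm (subsp X F) = nrm X"
  by (simp_all add: subsp_def)

locale ipair = X: ips s X ipx + Y: ips s Y ipy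
  for s :: "complex \<Rightarrow> 'v::ab_group_add \<Rightarrow> 'v" and X ipx Y ipy
begin

lemma D_sub: "X.subspace (carr X \<inter> carr Y)" by (rule X.subspace_inter[OF X.sub Y.sub])

text \<open>The minimizer of the Rayleigh quotient is an eigenvector.\<close>
lemma rayleigh:
  assumes B: "finite B" "B \<subseteq> carr X \<inter> carr Y" "X.independent B" "B \<noteq> {}"
  shows "\<exists>u \<mu>. u \<in> X.span B \<and> u \<noteq> 0 \<and> (\<forall>y\<in>X.span B. ipy u y = complex_of_real \<mu> * ipx u y)"
proof -
  have BX: "B \<subseteq> carr X" "B \<subseteq> carr Y" using B by auto
  have spD: "x \<in> carr X \<and> x \<in> carr Y" if "x \<in> X.span B" for x
    using X.span_minimal[OF B(2) D_sub] that by auto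
  define comb where "comb c = (\<Sum>b\<in>B. s (c b) b)" for c
  have comb_span: "comb c \<in> X.span B" for c
    unfolding comb_def by (intro X.span_sum X.span_scale X.span_base)
  have contX: "continuous_on UNIV (\<lambda>c. (nrm X (comb c))\<^sup>2)"
    unfolding comb_def X.nrm_comb_sq[OF B(1) BX(1)]
    by (intro continuous_intros continuous_on_product_coordinates)
  have contY: "continuous_on UNIV (\<lambda>c. (nrm Y (comb c))\<^sup>2)"
    unfolding comb_def Y.nrm_comb_sq[OF B(1) BX(2)]
    by (intro continuous_intros continuous_on_product_coordinates)
  \<comment> \<open>Coefficients are functions on the whole type; fixing them to 0 off
    \<open>B\<close> makes the polydisc compact in the product topology, by Tychonoff's
    theorem.\<close>
  define P :: "('v \<Rightarrow> complex) set" where "P = PiE UNIV (\<lambda>b. if b \<in> B then cball 0 1 else {0})"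
  define SS where "SS = P \<inter> {c. (\<Sum>b\<in>B. (cmod (c b))\<^sup>2) = 1}"
  have "compactin (product_topology (\<lambda>i. euclidean) UNIV) P"
    unfolding P_def by (subst compactin_PiE) auto
  then have "compact P" by (simp add: euclidean_product_topology compactin_euclidean_iff)
  moreover have "closed {c :: 'v \<Rightarrow> complex. (\<Sum>b\<in>B. (cmod (c b))\<^sup>2) = 1}"
    by (intro closed_Collect_eq continuous_intros continuous_on_product_coordinates)
  ultimately have comp: "compact SS" unfolding SS_def by (rule compact_Int_closed)
  obtain k where k: "k \<in> B" using B(4) by auto
  have "(\<lambda>b. if b = k then 1 else 0) \<in> SS"
    using k B(1) by (auto simp: SS_def P_def if_distrib[of "\<lambda>z. (cmod z)\<^sup>2"] sum.delta cong: if_cong)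
  then have ne: "SS \<noteq> {}" by auto
  have posX: "nrm X (comb c) > 0" if "c \<in> SS" for c
  proof -
    have "comb c \<noteq> 0"
    proof
      assume "comb c = 0"
      then have "\<forall>b\<in>B. c b = 0" using X.independentD[OF B(3) B(1) subset_refl] by (auto simp: comb_def)
      then show False using that by (simp add: SS_def)
    qed
    then show ?thesis using X.nrm_eq0[of "comb c"] X.nrm_ge0[of "comb c"] spD[OF comb_span] by fastforce
  qed
  define R where "R c = (nrm Y (comb c))\<^sup>2 / (nrm X (comb c))\<^sup>2" for c
  have "continuous_on SS R"
    unfolding R_def using posX
    by (intro continuous_on_divide continuous_on_subset[OF contX] continuous_on_subset[OF contY]) fastforce+
  then obtain c0 where c0: "c0 \<in> SS" "\<And>c. c \<in> SS \<Longrightarrow> R c0 \<le> R c"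
    using continuous_attains_inf[OF comp ne] by blast
  define \<mu> where "\<mu> = R c0"
  define u where "u = comb c0"
  have u: "u \<in> X.span B" "u \<noteq> 0" using comb_span posX[OF c0(1)] by (auto simp: u_def)
  have eqU: "(nrm Y u)\<^sup>2 = \<mu> * (nrm X u)\<^sup>2" using posX[OF c0(1)] by (simp add: \<mu>_def R_def u_def)
  have min: "\<mu> * (nrm X y)\<^sup>2 \<le> (nrm Y y)\<^sup>2" if y: "y \<in> X.span B" for y
  proof -
    obtain c where c: "y = comb c" using y X.span_finite[OF B(1)] by (auto simp: comb_def)
    show ?thesis
    proof (cases "\<forall>b\<in>B. c b = 0")
      case True
      then have "y = 0" by (simp add: c comb_def)
      then show ?thesis by simp
    next
      case False
      define r where "r = sqrt (\<Sum>b\<in>B. (cmod (c b))\<^sup>2)"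
      have r2: "(\<Sum>b\<in>B. (cmod (c b))\<^sup>2) > 0"
        using False B(1) by (auto intro!: sum_pos2)
      then have r: "r > 0" "r\<^sup>2 = (\<Sum>b\<in>B. (cmod (c b))\<^sup>2)" by (auto simp: r_def)
      \<comment> \<open>Rescaling to the unit sphere of coefficients: the quotient is homogeneous of
        degree 0, so its minimum on the sphere bounds it on the whole span.\<close>
      define c' where "c' b = (if b \<in> B then c b / of_real r else 0)" for b
      have "(\<Sum>b\<in>B. (cmod (c' b))\<^sup>2) = (\<Sum>b\<in>B. (cmod (c b))\<^sup>2 / r\<^sup>2)"
        using r by (intro sum.cong) (auto simp: c'_def norm_divide power_divide)
      also have "\<dots> = 1" using r r2 by (simp flip: sum_divide_distrib)
      finally have s1: "(\<Sum>b\<in>B. (cmod (c' b))\<^sup>2) = 1" .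
      have "cmod (c' b) \<le> 1" if "b \<in> B" for b
      proof -
        have "(cmod (c' b))\<^sup>2 \<le> (\<Sum>b\<in>B. (cmod (c' b))\<^sup>2)" using B(1) that by (intro member_le_sum) auto
        then have "(cmod (c' b))\<^sup>2 \<le> 1\<^sup>2" using s1 by simp
        then show ?thesis by (rule power2_le_imp_le) simp
      qed
      then have "c' \<in> SS" using s1 by (auto simp: SS_def P_def c'_def)
      then have "\<mu> * (nrm X (comb c'))\<^sup>2 \<le> (nrm Y (comb c'))\<^sup>2"
        using c0(2)[of c'] posX[of c'] by (simp add: \<mu>_def[symmetric]) (simp add: R_def field_simps)
      moreover have "y = s (of_real r) (comb c')"
        using r by (simp add: c comb_def c'_def X.scale_sum_right)
      moreover have "comb c' \<in> carr X" "comb c' \<in> carr Y" using spD[OF comb_span] by auto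
      ultimately show ?thesis using r(1)
        by (simp add: X.nrm_scale Y.nrm_scale power_mult_distrib mult.left_commute[of \<mu>])
    qed
  qed
  \<comment> \<open>The form \<open>(nrm Y y)^2 - \<mu> * (nrm X y)^2\<close> is nonnegative on the
    span and vanishes at \<open>u\<close>, so its first variation at \<open>u\<close> vanishes
    too.\<close>
  have re: "Re (ipy u y) = \<mu> * Re (ipx u y)" if y: "y \<in> X.span B" for y
  proof -
    have "Re (ipy u y) - \<mu> * Re (ipx u y) = 0"
    proof (rule nonneg_quadratic_imp_zero[where q = "(nrm Y y)\<^sup>2 - \<mu> * (nrm X y)\<^sup>2"])
      fix t :: real
      have m: "u \<in> carr X" "u \<in> carr Y" "y \<in> carr X" "y \<in> carr Y" using spD u y by auto
      have "u + s (of_real t) y \<in> X.span B" using u(1) y by (intro X.span_add X.span_scale)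
      note min[OF this]
      also have "(nrm Y (u + s (of_real t) y))\<^sup>2 = (nrm Y u)\<^sup>2 + t\<^sup>2 * (nrm Y y)\<^sup>2 + 2 * t * Re (ipy u y)"
        using m by (simp add: Y.nrm_add_sq Y.in_scale Y.nrm_scale Y.ip_scale_right power_mult_distrib)
      also have "(nrm X (u + s (of_real t) y))\<^sup>2 = (nrm X u)\<^sup>2 + t\<^sup>2 * (nrm X y)\<^sup>2 + 2 * t * Re (ipx u y)"
        using m by (simp add: X.nrm_add_sq X.in_scale X.nrm_scale X.ip_scale_right power_mult_distrib)
      finally show "0 \<le> t\<^sup>2 * ((nrm Y y)\<^sup>2 - \<mu> * (nrm X y)\<^sup>2) + 2 * t * (Re (ipy u y) - \<mu> * Re (ipx u y))"
        unfolding eqU by (simp add: algebra_simps)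
    qed
    then show ?thesis by simp
  qed
  have "ipy u y = complex_of_real \<mu> * ipx u y" if y: "y \<in> X.span B" for y
  proof (rule complex_eqI)
    show "Re (ipy u y) = Re (complex_of_real \<mu> * ipx u y)" using re[OF y] by simp
    have "Re (ipy u (s \<i> y)) = \<mu> * Re (ipx u (s \<i> y))" using y by (intro re X.span_scale)
    then show "Im (ipy u y) = Im (complex_of_real \<mu> * ipx u y)"
      using spD[OF u(1)] spD[OF y] by (simp add: X.ip_scale_right Y.ip_scale_right)
  qed
  then show ?thesis using u by blast
qed

text \<open>Induction on the size of \<open>B\<close>. After an eigenvector \<open>u\<close> is
  split off, the remaining vectors are made \<open>X\<close>-orthogonal to it; the eigenvector
  equation turns this into \<open>Y\<close>-orthogonality, so one projection serves both inner
  products.\<close>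

lemma orth_basis:
  assumes "finite B" "B \<subseteq> carr X \<inter> carr Y"
  shows "\<exists>E. finite E \<and> X.span E = X.span B \<and> 0 \<notin> E \<and>
     (\<forall>e\<in>E. \<forall>f\<in>E. e \<noteq> f \<longrightarrow> ipx e f = 0 \<and> ipy e f = 0)"
  using assms
proof (induction "card B" arbitrary: B rule: less_induct)
  case less
  show ?case
  proof (cases "X.dependent B")
    case True
    then obtain b where b: "b \<in> B" "b \<in> X.span (B - {b})" by (auto simp: X.dependent_def)
    have "B \<subseteq> X.span (B - {b})" using b(2) X.span_base[of _ "B - {b}"] by blast
    then have "X.span (B - {b}) = X.span B" unfolding X.span_eq using X.span_base by blast
    moreover have "card (B - {b}) < card B" using less.prems b(1) by (intro psubset_card_mono) auto
    ultimately show ?thesis using less.hyps[of "B - {b}"] less.prems by auto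
  next
    case ind: False
    show ?thesis
    proof (cases "B = {}")
      case True then show ?thesis by (intro exI[of _ "{}"]) auto
    next
      case False
      obtain u \<mu> where u: "u \<in> X.span B" "u \<noteq> 0" "\<And>y. y \<in> X.span B \<Longrightarrow> ipy u y = complex_of_real \<mu> * ipx u y"
        using rayleigh[OF less.prems ind False] by blast
      have spD: "x \<in> carr X \<and> x \<in> carr Y" if "x \<in> X.span B" for x
        using X.span_minimal[OF less.prems(2) D_sub] that by auto
      have uX: "u \<in> carr X" "u \<in> carr Y" using spD[OF u(1)] by auto
      obtain c where c: "u = (\<Sum>b\<in>B. s (c b) b)" using u(1) X.span_finite[OF less.prems(1)] by auto
      have "\<exists>k\<in>B. c k \<noteq> 0"
      proof (rule ccontr)
        assume "\<not> (\<exists>k\<in>B. c k \<noteq> 0)"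
        then have "(\<Sum>b\<in>B. s (c b) b) = 0" by (intro sum.neutral) auto
        then show False using c u(2) by simp
      qed
      \<comment> \<open>Exchange step: \<open>u\<close> replaces a vector \<open>k\<close> that
        occurs in it, so \<open>u\<close> and the projections of the other vectors still
        span.\<close>
      then obtain k where k: "k \<in> B" "c k \<noteq> 0" by blast
      define p where "p b = b - s (ipx b u / ipx u u) u" for b
      define B' where "B' = p ` (B - {k})"
      have uu: "ipx u u \<noteq> 0" using X.ip_self[OF uX(1)] X.nrm_eq0[OF uX(1)] u(2) by simp
      have pB: "p b \<in> X.span B" if "b \<in> B" for b
        unfolding p_def using that u(1) by (intro X.span_diff X.span_scale) (auto intro: X.span_base)
      have B'B: "B' \<subseteq> X.span B" using pB by (auto simp: B'_def)
      have "card B' \<le> card (B - {k})" unfolding B'_def using less.prems by (intro card_image_le) auto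
      also have "\<dots> < card B" using less.prems k(1) by (intro psubset_card_mono) auto
      finally have "card B' < card B" .
      moreover have "finite B'" "B' \<subseteq> carr X \<inter> carr Y" using less.prems B'B spD by (auto simp: B'_def)
      ultimately obtain E where E: "finite E" "X.span E = X.span B'" "0 \<notin> E"
        "\<And>e f. e \<in> E \<Longrightarrow> f \<in> E \<Longrightarrow> e \<noteq> f \<Longrightarrow> ipx e f = 0 \<and> ipy e f = 0"
        using less.hyps[of B'] by blast
      have spB': "X.span B' \<subseteq> X.span B" using B'B by (rule X.span_minimal) (rule X.subspace_span)
      have bsp: "b \<in> X.span (insert u B')" if b: "b \<in> B" "b \<noteq> k" for b
      proof -
        have "p b \<in> X.span (insert u B')" using b by (intro X.span_base) (auto simp: B'_def)
        then have "p b + s (ipx b u / ipx u u) u \<in> X.span (insert u B')"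
          by (intro X.span_add X.span_scale) (auto intro: X.span_base)
        then show ?thesis by (simp add: p_def)
      qed
      have "k \<in> X.span (insert u B')"
      proof -
        have "u = s (c k) k + (\<Sum>b\<in>B - {k}. s (c b) b)"
          unfolding c by (rule sum.remove[OF less.prems(1) k(1)])
        then have "s (c k) k = u - (\<Sum>b\<in>B - {k}. s (c b) b)" by (simp add: algebra_simps)
        then have "k = s (1 / c k) (u - (\<Sum>b\<in>B - {k}. s (c b) b))"
          using k(2) X.scale_scale[of "1 / c k" "c k" k] by simp
        moreover have "u - (\<Sum>b\<in>B - {k}. s (c b) b) \<in> X.span (insert u B')"
          using bsp by (intro X.span_diff X.span_sum X.span_scale) (auto intro: X.span_base)
        ultimately show ?thesis using X.span_scale by metis
      qed
      then have "B \<subseteq> X.span (insert u B')" using bsp by blast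
      moreover have "insert u B' \<subseteq> X.span B" using u(1) B'B by blast
      ultimately have sp1: "X.span (insert u B') = X.span B" unfolding X.span_eq by blast
      have "insert u E \<subseteq> X.span (insert u B')"
        using X.span_mono[of B' "insert u B'"] X.span_base[of _ E] X.span_base[of u "insert u B'"] E(2) by blast
      moreover have "insert u B' \<subseteq> X.span (insert u E)"
        using X.span_mono[of E "insert u E"] X.span_base[of _ B'] X.span_base[of u "insert u E"] E(2) by blast
      ultimately have sp2: "X.span (insert u E) = X.span B" unfolding sp1[symmetric] X.span_eq by blast
      have "X.subspace {x \<in> carr X. ipx x u = 0}"
        unfolding X.subspace_def using uX(1) by (auto simp: X.ip_zero_left X.ip_add_left X.ip_scale_left)
      moreover have "B' \<subseteq> {x \<in> carr X. ipx x u = 0}"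
      proof
        fix x assume "x \<in> B'"
        then obtain b where b: "b \<in> B" "x = p b" by (auto simp: B'_def)
        have "b \<in> carr X" using less.prems b by auto
        then have "ipx (p b) u = 0"
          using uX uu by (simp add: p_def X.ip_diff_left X.ip_scale_left X.in_scale)
        then show "x \<in> {x \<in> carr X. ipx x u = 0}" using spD[OF pB[OF b(1)]] b by simp
      qed
      ultimately have orth: "X.span B' \<subseteq> {x \<in> carr X. ipx x u = 0}" by (intro X.span_minimal)
      have eo: "ipx e u = 0 \<and> ipx u e = 0 \<and> ipy e u = 0 \<and> ipy u e = 0" if e: "e \<in> E" for e
      proof -
        have eB: "e \<in> X.span B'" using X.span_base[OF e] E(2) by simp
        then have "e \<in> X.span B" using spB' by auto
        note eD = spD[OF this] and eu = u(3)[OF this]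
        have 1: "ipx e u = 0" using orth eB by auto
        have 2: "ipx u e = 0" using X.ip_cnj[of e u] uX eD 1 by simp
        have 3: "ipy u e = 0" using eu 2 by simp
        have "ipy e u = 0" using Y.ip_cnj[of u e] uX eD 3 by simp
        then show ?thesis using 1 2 3 by simp
      qed
      have "\<forall>e\<in>insert u E. \<forall>f\<in>insert u E. e \<noteq> f \<longrightarrow> ipx e f = 0 \<and> ipy e f = 0"
        using E(4) eo by blast
      moreover have "finite (insert u E)" "0 \<notin> insert u E" using E u(2) by auto
      ultimately show ?thesis using sp2 by blast
    qed
  qed
qed

lemma finite_diagonal:
  assumes B: "finite B" "B \<subseteq> carr X \<inter> carr Y"
  shows "\<exists>E c. coord (X.span B) E c \<and> E \<subseteq> X.span B \<and> (\<forall>x\<in>X.span B. x = (\<Sum>e\<in>E. s (c x e) e)) \<and>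
     (\<forall>e\<in>E. nrm X e > 0 \<and> nrm Y e > 0) \<and>
     diagonal (X.span B) E c (\<lambda>e. (nrm X e)\<^sup>2) (subsp X (X.span B)) \<and>
     diagonal (X.span B) E c (\<lambda>e. (nrm Y e)\<^sup>2) (subsp Y (X.span B))"
proof -
  obtain E where E: "finite E" "X.span E = X.span B" "0 \<notin> E"
    "\<And>e f. e \<in> E \<Longrightarrow> f \<in> E \<Longrightarrow> e \<noteq> f \<Longrightarrow> ipx e f = 0 \<and> ipy e f = 0"
    using orth_basis[OF B] by blast
  have spD: "x \<in> carr X \<and> x \<in> carr Y" if "x \<in> X.span B" for x
    using X.span_minimal[OF B(2) D_sub] that by auto
  have EB: "E \<subseteq> X.span B" using X.span_base[of _ E] E(2) by blast
  have EX: "E \<subseteq> carr X" "E \<subseteq> carr Y" using EB spD by auto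
  have pos: "nrm X e > 0 \<and> nrm Y e > 0" if e: "e \<in> E" for e
  proof -
    have "e \<in> carr X" "e \<in> carr Y" "e \<noteq> 0" using EX E(3) e by auto
    then show ?thesis
      using X.nrm_eq0[of e] X.nrm_ge0[of e] Y.nrm_eq0[of e] Y.nrm_ge0[of e] by (simp add: less_le)
  qed
  define c where "c x e = ipx x e / ipx e e" for x e
  have cc: "c (\<Sum>e\<in>E. s (h e) e) f = h f" if f: "f \<in> E" for h f
  proof -
    have "ipx f f \<noteq> 0" using X.ip_self[of f] EX pos[OF f] f by auto
    then show ?thesis using X.orth_coeff[OF E(1) EX(1) _ f, of h] E(4) by (simp add: c_def)
  qed
  have rep: "x = (\<Sum>e\<in>E. s (c x e) e)" if x: "x \<in> X.span B" for x
  proof -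
    obtain h where h: "x = (\<Sum>e\<in>E. s (h e) e)" using x E(2) X.span_finite[OF E(1)] by auto
    have "(\<Sum>e\<in>E. s (c x e) e) = (\<Sum>e\<in>E. s (h e) e)"
      unfolding h by (intro sum.cong refl) (simp add: cc)
    then show ?thesis using h by simp
  qed
  have "coord (X.span B) E c"
    unfolding coord_def
  proof (intro conjI ballI allI E(1))
    show "0 \<in> X.span B" by (rule X.span_zero)
    fix x y assume xy: "x \<in> X.span B" "y \<in> X.span B"
    then show "x + y \<in> X.span B" "x - y \<in> X.span B" by (auto intro: X.span_add X.span_diff)
    fix e assume e: "e \<in> E"
    show "c (x + y) e = c x e + c y e"
      using spD[OF xy(1)] spD[OF xy(2)] EX e by (simp add: c_def X.ip_add_left subsetD add_divide_distrib)
  next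
    fix h
    show "\<exists>x\<in>X.span B. \<forall>e\<in>E. c x e = h e"
      using EB by (intro bexI[of _ "\<Sum>e\<in>E. s (h e) e"])
        (auto simp: cc intro!: X.span_sum X.span_scale)
  qed
  moreover have "nrm X x = sqrt (\<Sum>e\<in>E. (nrm X e)\<^sup>2 * (cmod (c x e))\<^sup>2)" if "x \<in> X.span B" for x
    using X.orth_nrm[OF E(1) EX(1), of "c x"] E(4) rep[OF that] by simp
  moreover have "nrm Y x = sqrt (\<Sum>e\<in>E. (nrm Y e)\<^sup>2 * (cmod (c x e))\<^sup>2)" if "x \<in> X.span B" for x
    using Y.orth_nrm[OF E(1) EX(2), of "c x"] E(4) rep[OF that] by simp
  ultimately show ?thesis using rep pos EB
    by (intro exI[of _ E] exI[of _ c]) (auto simp: diagonal_def)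
qed

end

section \<open>Comparison of a pair with smaller spaces and larger norms\<close>

lemma K_mono_pair:
  assumes "carr X' \<subseteq> carr X" "carr Y' \<subseteq> carr Y"
    and "\<And>x. x \<in> carr X' \<Longrightarrow> 0 \<le> nrm X x \<and> nrm X x \<le> nrm X' x"
    and "\<And>y. y \<in> carr Y' \<Longrightarrow> 0 \<le> nrm Y y \<and> nrm Y y \<le> nrm Y' y"
    and z: "z \<in> carr (Sigma_space X' Y')"
  shows "K_functional X Y t z \<le> K_functional X' Y' t z"
proof (rule K_greatest[OF z])
  fix x y assume *: "x \<in> carr X'" "y \<in> carr Y'" "x + y = z"
  have "K_functional X Y t z \<le> sqrt ((nrm X x)\<^sup>2 + t\<^sup>2 * (nrm Y y)\<^sup>2)"
    using * assms by (intro K_lower) auto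
  also have "\<dots> \<le> sqrt ((nrm X' x)\<^sup>2 + t\<^sup>2 * (nrm Y' y)\<^sup>2)"
    using * assms by (intro real_sqrt_le_mono add_mono mult_left_mono power_mono) auto
  finally show "K_functional X Y t z \<le> sqrt ((nrm X' x)\<^sup>2 + t\<^sup>2 * (nrm Y' y)\<^sup>2)" .
qed

lemma Sigma_mono:
  assumes "carr X' \<subseteq> carr X" "carr Y' \<subseteq> carr Y" "z \<in> carr (Sigma_space X' Y')"
  shows "z \<in> carr (Sigma_space X Y)"
  using assms unfolding Sigma_iff by blast

text \<open>Smaller spaces with larger norms leave fewer and costlier decompositions. This gives
  both the lower bound of span norms by full norms and the decrease of span norms along growing
  spans.\<close>

lemma interp_mono:
  assumes c: "carr X' \<subseteq> carr X" "carr Y' \<subseteq> carr Y"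
    and n: "\<And>x. x \<in> carr X' \<Longrightarrow> 0 \<le> nrm X x \<and> nrm X x \<le> nrm X' x"
      "\<And>y. y \<in> carr Y' \<Longrightarrow> 0 \<le> nrm Y y \<and> nrm Y y \<le> nrm Y' y"
    and z: "z \<in> carr (interp X' Y' \<theta>)" and th: "\<theta> \<in> {0..1}"
  shows "nrm (interp X Y \<theta>) z \<le> nrm (interp X' Y' \<theta>) z"
proof -
  consider "\<theta> = 0" | "\<theta> = 1" | "0 < \<theta>" "\<theta> < 1" using th by fastforce
  then show ?thesis
  proof cases
    case 3
    have zS: "z \<in> carr (Sigma_space X' Y')" and fin: "K_integral X' Y' \<theta> z < \<infinity>"
      using z 3 by (auto simp: interp_def K_space_def)
    have "K_integral X Y \<theta> z \<le> K_integral X' Y' \<theta> z"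
      unfolding K_integral_eq
    proof (rule wint_mono)
      fix t :: real
      show "\<bar>K_functional X Y t z\<bar> \<le> \<bar>K_functional X' Y' t z\<bar>"
        using K_ge0[OF Sigma_mono[OF c zS], of t] K_mono_pair[OF c n zS, of t] by simp
    qed
    then have "enn2real (K_integral X Y \<theta> z) \<le> enn2real (K_integral X' Y' \<theta> z)"
      using fin by (intro enn2real_mono) auto
    then show ?thesis using 3 N_const_pos[OF 3] by (simp add: interp_def K_space_def)
  qed (use z n in \<open>auto simp: interp_def\<close>)
qed

section \<open>Reiteration\<close>

text \<open>Both bounds hold with one \<open>M\<close> for all \<open>n\<close>, so
  \<open>wint_min_bound\<close> yields a common majorant, a multiple of \<open>kscal 1 1\<close>,
  whose integral is finite.\<close>

lemma wint_norm_tendsto: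
  assumes th: "0 < \<theta>" "\<theta> < 1" and f: "\<And>n. klike (f n)" and g: "klike g"
    and bd: "\<And>n t. t > 0 \<Longrightarrow> f n t \<le> M" "\<And>n t. t > 0 \<Longrightarrow> f n t \<le> t * M"
    and lim: "\<And>t. t > 0 \<Longrightarrow> (\<lambda>n. f n t) \<longlonglongrightarrow> g t"
  shows "(\<lambda>n. N_const \<theta> * sqrt (enn2real (wint \<theta> (f n)))) \<longlonglongrightarrow> N_const \<theta> * sqrt (enn2real (wint \<theta> g))"
proof -
  have fb: "\<bar>f n t\<bar> \<le> M" "\<bar>f n t\<bar> \<le> t * M" if "t > 0" for n t
    using bd[OF that, of n] klikeD(1)[OF f that, of n] by auto
  have gb: "\<bar>g t\<bar> \<le> M" "\<bar>g t\<bar> \<le> t * M" if t: "t > 0" for t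
    using LIMSEQ_le_const2[OF lim[OF t], of M] LIMSEQ_le_const2[OF lim[OF t], of "t * M"] bd[OF t]
      klikeD(1)[OF g t] by auto
  have M: "M \<ge> 0" using fb(1)[of 1 0] by simp
  let ?h = "\<lambda>t. sqrt 2 * M * kscal 1 1 t"
  have hm: "posmeas (kscal 1 1)" by (intro klike_posmeas klike_kscal) auto
  then have "posmeas ?h" unfolding posmeas_def
    by (subst mult.left_commute) (rule borel_measurable_times[OF borel_measurable_const])
  moreover have "wint \<theta> ?h < \<infinity>"
    using wint_cmult[OF hm, of \<theta> "sqrt 2 * M"] wint_kscal[OF _ _ th, of 1 1] by (simp add: ennreal_mult_less_top)
  ultimately have conv: "(\<lambda>n. wint \<theta> (f n)) \<longlonglongrightarrow> wint \<theta> g"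
    using lim
  proof (intro wint_dominated[OF klike_posmeas[OF f] klike_posmeas[OF g], where g = ?h])
    fix n and t :: real assume t: "t > 0"
    have "\<bar>f n t\<bar> \<le> sqrt 2 * M * kscal 1 1 t"
      by (rule wint_min_bound(1)[OF th, where f = "f n"]) (use fb t in auto)
    then show "\<bar>f n t\<bar> \<le> \<bar>sqrt 2 * M * kscal 1 1 t\<bar>" by linarith
  qed auto
  have "wint \<theta> g \<le> ennreal (2 * M\<^sup>2 * (pi / (2 * sin (pi * \<theta>))))"
    by (rule wint_min_bound(2)[OF th]) (use gb in auto)
  then have "wint \<theta> g < \<infinity>" by (rule le_less_trans) simp
  then have "wint \<theta> g = ennreal (enn2real (wint \<theta> g))" by simp
  with conv have "(\<lambda>n. wint \<theta> (f n)) \<longlonglongrightarrow> ennreal (enn2real (wint \<theta> g))" by simp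
  then have "(\<lambda>n. enn2real (wint \<theta> (f n))) \<longlonglongrightarrow> enn2real (wint \<theta> g)"
    by (rule tendsto_enn2real) simp
  then show ?thesis by (intro tendsto_mult tendsto_const tendsto_real_sqrt)
qed

context hpair begin

abbreviation "D \<equiv> carr X \<inter> carr Y"
text \<open>Both parts of a decomposition are confined to \<open>F\<close>, so for intermediate
  \<theta> this norm can exceed that of \<open>J \<theta>\<close> on \<open>F\<close>.\<close>

abbreviation "fin \<theta> F \<equiv> interp (subsp X F) (subsp Y F) \<theta>"

lemma span_D: "B \<subseteq> D \<Longrightarrow> X.span B \<subseteq> D"
  by (rule X.span_minimal) (auto intro: X.subspace_inter X.sub Y.sub)

lemma finite_diag:
  assumes B: "finite B" "B \<subseteq> D"
  shows "\<exists>E c a b. coord (X.span B) E c \<and> E \<subseteq> X.span B \<and> (\<forall>x\<in>X.span B. x = (\<Sum>e\<in>E. s (c x e) e)) \<and>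
     (\<forall>e\<in>E. a e > 0 \<and> b e > 0) \<and>
     diagonal (X.span B) E c a (subsp X (X.span B)) \<and> diagonal (X.span B) E c b (subsp Y (X.span B))"
proof -
  obtain ipx ipy where "inner_on s X ipx" "inner_on s Y ipy"
    using X.jordan_von_neumann[OF pX] Y.jordan_von_neumann[OF pY] by blast
  then interpret ipair s X ipx Y ipy
    by (intro ipair.intro ips.intro ips_axioms.intro X.nvs_axioms Y.nvs_axioms)
  obtain E c where E: "coord (X.span B) E c" "E \<subseteq> X.span B" "\<forall>x\<in>X.span B. x = (\<Sum>e\<in>E. s (c x e) e)"
     "\<forall>e\<in>E. nrm X e > 0 \<and> nrm Y e > 0"
     "diagonal (X.span B) E c (\<lambda>e. (nrm X e)\<^sup>2) (subsp X (X.span B))"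
     "diagonal (X.span B) E c (\<lambda>e. (nrm Y e)\<^sup>2) (subsp Y (X.span B))"
    using finite_diagonal[OF B] by blast
  have pos: "\<forall>e\<in>E. (nrm X e)\<^sup>2 > 0 \<and> (nrm Y e)\<^sup>2 > 0" using E(4) by auto
  show ?thesis
    by (rule exI[of _ E], rule exI[of _ c], rule exI[of _ "\<lambda>e. (nrm X e)\<^sup>2"], rule exI[of _ "\<lambda>e. (nrm Y e)\<^sup>2"])
       (intro conjI E(1-3,5-6) pos)
qed

text \<open>The order of quantifiers is the point: coordinates and weights are chosen before
  \<theta>, so that several exponents can be compared in the same basis, as
  \<open>fin_reiteration\<close> requires.\<close>

lemma fin_diag:
  assumes B: "finite B" "B \<subseteq> D"
  shows "\<exists>E c a b. coord (X.span B) E c \<and> E \<subseteq> X.span B \<and> (\<forall>x\<in>X.span B. x = (\<Sum>e\<in>E. s (c x e) e)) \<and>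
     (\<forall>e\<in>E. a e > 0 \<and> b e > 0) \<and>
     (\<forall>\<theta>\<in>{0..1}. diagonal (X.span B) E c (\<lambda>e. a e powr (1 - \<theta>) * b e powr \<theta>) (fin \<theta> (X.span B)))"
proof -
  obtain E c a b where E: "coord (X.span B) E c" "E \<subseteq> X.span B" "\<forall>x\<in>X.span B. x = (\<Sum>e\<in>E. s (c x e) e)"
     "\<forall>e\<in>E. a e > 0 \<and> b e > 0"
     "diagonal (X.span B) E c a (subsp X (X.span B))" "diagonal (X.span B) E c b (subsp Y (X.span B))"
    using finite_diag[OF B] by blast
  have "diagonal (X.span B) E c (\<lambda>e. a e powr (1 - \<theta>) * b e powr \<theta>) (fin \<theta> (X.span B))"
    if "\<theta> \<in> {0..1}" for \<theta>
    by (rule diagonal_interp[OF E(1,5,6) _ _ that]) (use E(4) in auto)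
  then show ?thesis
    by (intro exI[of _ E] exI[of _ c] exI[of _ a] exI[of _ b] conjI E(1-4)) blast
qed

lemma fin_carr: "finite B \<Longrightarrow> B \<subseteq> D \<Longrightarrow> \<theta> \<in> {0..1} \<Longrightarrow> carr (fin \<theta> (X.span B)) = X.span B"
  using fin_diag by (fastforce simp: diagonal_def)

lemma J_le_fin:
  assumes "finite B" "B \<subseteq> D" "\<theta> \<in> {0..1}" "z \<in> X.span B"
  shows "nrm (J \<theta>) z \<le> nrm (fin \<theta> (X.span B)) z"
  by (rule interp_mono) (use span_D[OF assms(2)] X.nrm_ge0 Y.nrm_ge0 fin_carr[OF assms(1-3)] assms in auto)

lemma fin_antimono:
  assumes "finite B" "B \<subseteq> D" "\<theta> \<in> {0..1}" "z \<in> X.span B" "X.span B \<subseteq> X.span B'"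
  shows "nrm (fin \<theta> (X.span B')) z \<le> nrm (fin \<theta> (X.span B)) z"
  by (rule interp_mono) (use span_D[OF assms(2)] X.nrm_ge0 Y.nrm_ge0 fin_carr[OF assms(1-3)] assms in auto)

lemma J_ge0: "\<theta> \<in> {0..1} \<Longrightarrow> z \<in> carr (J \<theta>) \<Longrightarrow> 0 \<le> nrm (J \<theta>) z"
  by (rule nvs.nrm_ge0[OF J_nvs])

lemma D_J: "\<theta> \<in> {0..1} \<Longrightarrow> z \<in> D \<Longrightarrow> z \<in> carr (J \<theta>)"
  using J_Delta(1)[OF _ _ _ max.cobounded1 max.cobounded2] by blast

lemma K_fin_bounds:
  assumes "z \<in> F" "0 \<in> F" "F \<subseteq> D"
  shows "K_functional (subsp X F) (subsp Y F) t z \<le> nrm X z"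
    "t > 0 \<Longrightarrow> K_functional (subsp X F) (subsp Y F) t z \<le> t * nrm Y z"
  using K_lower[of z "subsp X F" 0 "subsp Y F" z t] K_lower[of 0 "subsp X F" z "subsp Y F" z t]
    X.nrm_ge0[of z] Y.nrm_ge0[of z] assms by (auto simp: real_sqrt_mult)

lemma Sigma_fin: "z \<in> F \<Longrightarrow> 0 \<in> F \<Longrightarrow> z \<in> carr (Sigma_space (subsp X F) (subsp Y F))"
  unfolding Sigma_iff subsp_simps using add.right_neutral by blast

lemma fin_approx:
  assumes z: "z \<in> D" and th: "\<theta> \<in> {0..1}" and e: "e > 0"
  shows "\<exists>B. finite B \<and> B \<subseteq> D \<and> z \<in> B \<and> nrm (fin \<theta> (X.span B)) z < nrm (J \<theta>) z + e"
proof (cases "\<theta> = 0 \<or> \<theta> = 1")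
  case True
  then show ?thesis using z e by (intro exI[of _ "{z}"]) (auto simp: interp_def)
next
  case False
  then have th': "0 < \<theta>" "\<theta> < 1" using th by auto
  \<comment> \<open>Inserting \<open>z\<close> makes it decomposable in every span, so that
    \<open>\<kappa> B\<close> is a genuine K-functional for each \<open>B\<close>.\<close>
  define F where "F B = X.span (insert z B)" for B
  have F: "z \<in> F B" "0 \<in> F B" "b \<in> B \<Longrightarrow> b \<in> F B" for B b
    by (auto simp: F_def intro: X.span_base X.span_zero)
  have FD: "F B \<subseteq> D" if "B \<subseteq> D" for B using that z unfolding F_def by (intro span_D) auto
  define \<kappa> where "\<kappa> B t = K_functional (subsp X (F B)) (subsp Y (F B)) t z" for B t
  have zS: "z \<in> carr S" using z S_X by auto
  have ge: "K t z \<le> \<kappa> B t" if "B \<subseteq> D" for B t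
    unfolding \<kappa>_def using FD[OF that] Sigma_fin[OF F(1,2)] X.nrm_ge0 Y.nrm_ge0
    by (intro K_mono_pair) auto
  have \<kappa>k: "klike (\<kappa> B)" for B
    unfolding \<kappa>_def by (rule K_klike) (rule Sigma_fin[OF F(1,2)])
  have "\<exists>B. (\<forall>n. finite (B n) \<and> B n \<subseteq> D) \<and> (\<forall>t>0. (\<lambda>n. \<kappa> (B n) t) \<longlonglongrightarrow> K t z)"
  proof (rule klike_selection[OF K_klike[OF zS] \<kappa>k])
    fix t e :: real assume t: "t > 0" and e: "e > 0"
    obtain x y where xy: "x \<in> carr X" "y \<in> carr Y" "x + y = z"
      "sqrt ((nrm X x)\<^sup>2 + t\<^sup>2 * (nrm Y y)\<^sup>2) < K t z + e" using K_approx[OF zS e] by blast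
    \<comment> \<open>Since \<open>z\<close> lies in both spaces, so does each part of a
      decomposition. Any span containing both parts then admits this near-optimal decomposition at
      the same cost.\<close>
    have yx: "y = z - x" "x = z - y" using xy(3) by auto
    have "y \<in> carr X" unfolding yx(1) using z xy(1) by auto
    moreover have "x \<in> carr Y" unfolding yx(2) using z xy(2) by auto
    ultimately have D: "{x, y} \<subseteq> D" using xy by auto
    have "\<bar>\<kappa> B' t - K t z\<bar> < e" if B': "{x, y} \<subseteq> B'" "B' \<subseteq> D" for B'
    proof -
      have "\<kappa> B' t \<le> sqrt ((nrm X x)\<^sup>2 + t\<^sup>2 * (nrm Y y)\<^sup>2)"
        using K_lower[of x "subsp X (F B')" y "subsp Y (F B')" z t] F(3) B'(1) xy(3) by (auto simp: \<kappa>_def)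
      then show ?thesis using xy(4) ge[OF B'(2), of t] by simp
    qed
    then show "\<exists>B. finite B \<and> B \<subseteq> D \<and> (\<forall>B'. finite B' \<longrightarrow> B \<subseteq> B' \<longrightarrow> B' \<subseteq> D \<longrightarrow> \<bar>\<kappa> B' t - K t z\<bar> < e)"
      using D by (intro exI[of _ "{x, y}"]) auto
  qed
  then obtain B where B: "\<And>n. finite (B n)" "\<And>n. B n \<subseteq> D" "\<And>t. t > 0 \<Longrightarrow> (\<lambda>n. \<kappa> (B n) t) \<longlonglongrightarrow> K t z" by blast
  define M where "M = max (nrm X z) (nrm Y z)"
  have b1: "\<kappa> (B n) t \<le> M" for n t
    using K_fin_bounds(1)[OF F(1,2) FD[OF B(2)[of n]], of t] by (simp add: \<kappa>_def M_def le_max_iff_disj)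
  have b2: "\<kappa> (B n) t \<le> t * M" if "t > 0" for n t
  proof -
    have "t * nrm Y z \<le> t * M" using that by (intro mult_left_mono) (auto simp: M_def)
    then show ?thesis using K_fin_bounds(2)[OF F(1,2) FD[OF B(2)[of n]] that] by (simp add: \<kappa>_def)
  qed
  have "(\<lambda>n. N_const \<theta> * sqrt (enn2real (wint \<theta> (\<kappa> (B n))))) \<longlonglongrightarrow> N_const \<theta> * sqrt (enn2real (W \<theta> z))"
    by (rule wint_norm_tendsto[OF th' \<kappa>k K_klike[OF zS] b1 b2 B(3)])
  moreover have "N_const \<theta> * sqrt (enn2real (wint \<theta> (\<kappa> (B n)))) = nrm (fin \<theta> (F (B n))) z" for n
    using False by (simp add: interp_def K_space_def K_integral_eq \<kappa>_def[abs_def])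
  moreover have "N_const \<theta> * sqrt (enn2real (W \<theta> z)) = nrm (J \<theta>) z"
    using False by (simp add: interp_def KS_nrm)
  ultimately have "(\<lambda>n. nrm (fin \<theta> (F (B n))) z) \<longlonglongrightarrow> nrm (J \<theta>) z" by simp
  then have "\<forall>\<^sub>F n in sequentially. nrm (fin \<theta> (F (B n))) z < nrm (J \<theta>) z + e"
    using e by (intro order_tendstoD(2)) auto
  then obtain n where "nrm (fin \<theta> (F (B n))) z < nrm (J \<theta>) z + e" using eventually_happens by fastforce
  then show ?thesis using B z by (intro exI[of _ "insert z (B n)"]) (auto simp: F_def)
qed

text \<open>All spaces involved are diagonal in one basis, and the exponents of the weights combine
  convexly: \<open>(1 - \<theta>0) * (1 - \<eta>) + (1 - \<theta>1) * \<eta>\<close> is the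
  complement of \<open>\<theta>0 * (1 - \<eta>) + \<theta>1 * \<eta>\<close> to 1.\<close>

lemma fin_reiteration:
  assumes B: "finite B" "B \<subseteq> D" and z: "z \<in> X.span B"
    and th: "\<theta>0 \<in> {0..1}" "\<theta>1 \<in> {0..1}" "\<eta> \<in> {0..1}"
  shows "nrm (interp (fin \<theta>0 (X.span B)) (fin \<theta>1 (X.span B)) \<eta>) z
     = nrm (fin ((1 - \<eta>) * \<theta>0 + \<eta> * \<theta>1) (X.span B)) z"
    and "carr (interp (fin \<theta>0 (X.span B)) (fin \<theta>1 (X.span B)) \<eta>) = X.span B"
proof -
  let ?F = "X.span B" and ?\<theta> = "(1 - \<eta>) * \<theta>0 + \<eta> * \<theta>1"
  obtain E c a b where E': "coord ?F E c" "E \<subseteq> ?F" "\<forall>x\<in>?F. x = (\<Sum>e\<in>E. s (c x e) e)"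
     "\<forall>e\<in>E. a e > 0 \<and> b e > 0"
     "\<forall>\<theta>\<in>{0..1}. diagonal ?F E c (\<lambda>e. a e powr (1 - \<theta>) * b e powr \<theta>) (fin \<theta> ?F)"
    using fin_diag[OF B] by blast
  note E = E'(1,4) E'(5)[rule_format]
  have "?\<theta> \<le> (1 - \<eta>) * 1 + \<eta> * 1" using th by (intro add_mono mult_left_mono) auto
  then have th': "?\<theta> \<in> {0..1}" using th by simp
  have d: "diagonal ?F E c (\<lambda>e. (a e powr (1 - \<theta>0) * b e powr \<theta>0) powr (1 - \<eta>) * (a e powr (1 - \<theta>1) * b e powr \<theta>1) powr \<eta>)
    (interp (fin \<theta>0 ?F) (fin \<theta>1 ?F) \<eta>)"
    by (rule diagonal_interp[OF E(1) E(3)[OF th(1)] E(3)[OF th(2)] _ _ th(3)]) (use E(2) in fastforce)+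
  have "(a e powr (1 - \<theta>0) * b e powr \<theta>0) powr (1 - \<eta>) * (a e powr (1 - \<theta>1) * b e powr \<theta>1) powr \<eta>
      = a e powr (1 - ?\<theta>) * b e powr ?\<theta>" if e: "e \<in> E" for e
  proof -
    have 1: "(a e powr (1 - \<theta>0) * b e powr \<theta>0) powr (1 - \<eta>) * (a e powr (1 - \<theta>1) * b e powr \<theta>1) powr \<eta>
      = a e powr ((1 - \<theta>0) * (1 - \<eta>) + (1 - \<theta>1) * \<eta>) * b e powr (\<theta>0 * (1 - \<eta>) + \<theta>1 * \<eta>)"
      by (simp add: powr_mult powr_powr powr_add)
    have 2: "(1 - \<theta>0) * (1 - \<eta>) + (1 - \<theta>1) * \<eta> = 1 - ?\<theta>" "\<theta>0 * (1 - \<eta>) + \<theta>1 * \<eta> = ?\<theta>"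
      by (simp_all add: algebra_simps)
    show ?thesis unfolding 1 2 ..
  qed
  then have "(\<Sum>e\<in>E. (a e powr (1 - \<theta>0) * b e powr \<theta>0) powr (1 - \<eta>) * (a e powr (1 - \<theta>1) * b e powr \<theta>1) powr \<eta> * (cmod (c z e))\<^sup>2)
     = (\<Sum>e\<in>E. a e powr (1 - ?\<theta>) * b e powr ?\<theta> * (cmod (c z e))\<^sup>2)"
    by (intro sum.cong) auto
  then show "nrm (interp (fin \<theta>0 ?F) (fin \<theta>1 ?F) \<eta>) z = nrm (fin ?\<theta> ?F) z"
    using d E(3)[OF th'] z by (simp add: diagonal_def)
  show "carr (interp (fin \<theta>0 ?F) (fin \<theta>1 ?F) \<eta>) = ?F" using d by (simp add: diagonal_def)
qed

text \<open>The bound is the same for all spans, which is what a common majorant in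
  \<open>reiteration_Delta\<close> needs.\<close>

lemma fin_le_max:
  assumes B: "finite B" "B \<subseteq> D" and z: "z \<in> X.span B" and th: "\<theta> \<in> {0..1}"
  shows "nrm (fin \<theta> (X.span B)) z \<le> sqrt 2 * max (nrm X z) (nrm Y z)"
proof -
  let ?M = "max (nrm X z) (nrm Y z)" and ?F = "X.span B"
  have zD: "z \<in> D" using span_D[OF B(2)] z by auto
  have M0: "?M \<ge> 0" using X.nrm_ge0[of z] zD by (simp add: le_max_iff_disj)
  then have M2: "?M \<le> sqrt 2 * ?M" using mult_right_mono[of 1 "sqrt 2" ?M] by simp
  consider "\<theta> = 0" | "\<theta> = 1" | "0 < \<theta>" "\<theta> < 1" using th by fastforce
  then show ?thesis
  proof cases
    case 1 then show ?thesis using M2 by (simp add: interp_def)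
  next
    case 2 then show ?thesis using M2 by (simp add: interp_def)
  next
    case 3
    let ?k = "\<lambda>t. K_functional (subsp X ?F) (subsp Y ?F) t z"
    have zS: "z \<in> carr (Sigma_space (subsp X ?F) (subsp Y ?F))" using Sigma_fin z X.span_zero by blast
    have "wint \<theta> ?k \<le> ennreal (2 * ?M\<^sup>2 * (pi / (2 * sin (pi * \<theta>))))"
    proof (rule wint_min_bound(2)[OF 3])
      fix t :: real assume t: "t > 0"
      show "\<bar>?k t\<bar> \<le> ?M" using K_ge0[OF zS, of t] K_fin_bounds(1)[OF z X.span_zero span_D[OF B(2)], of t] by simp
      have "t * nrm Y z \<le> t * ?M" using t by (intro mult_left_mono) auto
      then show "\<bar>?k t\<bar> \<le> t * ?M"
        using K_ge0[OF zS, of t] K_fin_bounds(2)[OF z X.span_zero span_D[OF B(2)] t] by simp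
    qed
    from enn2real_mono[OF this] have "enn2real (wint \<theta> ?k) \<le> 2 * ?M\<^sup>2 * (pi / (2 * sin (pi * \<theta>)))"
      using sin_pi_pos[OF 3] by simp
    then have "(N_const \<theta>)\<^sup>2 * enn2real (wint \<theta> ?k) \<le> (N_const \<theta>)\<^sup>2 * (2 * ?M\<^sup>2 * (pi / (2 * sin (pi * \<theta>))))"
      by (intro mult_left_mono) auto
    also have "\<dots> = 2 * ?M\<^sup>2 * ((N_const \<theta>)\<^sup>2 * (pi / (2 * sin (pi * \<theta>))))" by (rule mult.left_commute)
    also have "\<dots> = 2 * ?M\<^sup>2" unfolding N_const_sq[OF 3] by simp
    finally have "sqrt ((N_const \<theta>)\<^sup>2 * enn2real (wint \<theta> ?k)) \<le> sqrt (2 * ?M\<^sup>2)" by (rule real_sqrt_le_mono)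
    then have "N_const \<theta> * sqrt (enn2real (wint \<theta> ?k)) \<le> sqrt 2 * ?M"
      using N_const_pos[OF 3] M0 by (simp only: real_sqrt_mult real_sqrt_abs abs_of_pos abs_of_nonneg)
    then show ?thesis using 3 by (simp add: interp_def K_space_def K_integral_eq)
  qed
qed

text \<open>The K-functionals of the pairs \<open>fin \<theta>0\<close>,
  \<open>fin \<theta>1\<close> converge along suitable spans to that of \<open>J \<theta>0\<close>,
  \<open>J \<theta>1\<close>. As reiteration holds on spans, the interpolated norm is a limit of
  \<open>fin \<theta>\<close> norms for the combined exponent \<theta>, hence at least the norm of
  \<open>J \<theta>\<close>.\<close>

lemma reiteration_Delta:
  assumes th: "\<theta>0 \<in> {0..1}" "\<theta>1 \<in> {0..1}" "\<theta>0 \<noteq> \<theta>1" and eta: "0 < \<eta>" "\<eta> < 1" and z: "z \<in> D"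
  shows "nrm (interp (J \<theta>0) (J \<theta>1) \<eta>) z = nrm (J ((1 - \<eta>) * \<theta>0 + \<eta> * \<theta>1)) z"
proof -
  define \<theta> where "\<theta> = (1 - \<eta>) * \<theta>0 + \<eta> * \<theta>1"
  have "\<theta> \<le> (1 - \<eta>) * 1 + \<eta> * 1" unfolding \<theta>_def using th eta by (intro add_mono mult_left_mono) auto
  then have th': "\<theta> \<in> {0..1}" using th eta by (simp add: \<theta>_def)
  have etaI: "\<eta> \<in> {0..1}" using eta by simp
  interpret R: hpair s "J \<theta>0" "J \<theta>1" by (rule hpair_of_compatible[OF J_pair[OF th(1,2)]])
  have zJ: "z \<in> carr (J \<theta>0)" "z \<in> carr (J \<theta>1)" using D_J z th by auto
  define F where "F B = X.span (insert z B)" for B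
  have F: "z \<in> F B" "0 \<in> F B" "b \<in> B \<Longrightarrow> b \<in> F B" for B b
    by (auto simp: F_def intro: X.span_base X.span_zero)
  have FD: "F B \<subseteq> D" if "B \<subseteq> D" for B using that z unfolding F_def by (intro span_D) auto
  have iz: "finite (insert z B)" "insert z B \<subseteq> D" if "finite B" "B \<subseteq> D" for B using that z by auto
  have cF: "carr (fin \<phi> (F B)) = F B" if "finite B" "B \<subseteq> D" "\<phi> \<in> {0..1}" for B \<phi>
    unfolding F_def by (rule fin_carr[OF iz[OF that(1,2)] that(3)])
  have zSF: "z \<in> carr (Sigma_space (fin \<theta>0 (F B)) (fin \<theta>1 (F B)))" if "finite B" "B \<subseteq> D" for B
    unfolding Sigma_iff using cF[OF that th(1)] cF[OF that th(2)] F by (intro bexI[of _ z] bexI[of _ 0]) auto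
  have JF: "x \<in> F B \<Longrightarrow> 0 \<le> nrm (J \<phi>) x \<and> nrm (J \<phi>) x \<le> nrm (fin \<phi> (F B)) x"
    if "finite B" "B \<subseteq> D" "\<phi> \<in> {0..1}" for B \<phi> x
  proof -
    assume x: "x \<in> F B"
    then have "x \<in> D" using FD[OF that(2)] by blast
    then show ?thesis
      using J_le_fin[OF iz[OF that(1,2)] that(3), of x] J_ge0[OF that(3) D_J[OF that(3)]] x by (simp add: F_def)
  qed
  have FJ: "F B \<subseteq> carr (J \<phi>)" if "B \<subseteq> D" "\<phi> \<in> {0..1}" for B \<phi> using FD D_J that by blast
  define \<kappa> where "\<kappa> B t = K_functional (fin \<theta>0 (F B)) (fin \<theta>1 (F B)) t z" for B t
  have zS: "z \<in> carr (Sigma_space (J \<theta>0) (J \<theta>1))" using R.S_X zJ by auto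
  have ge: "R.K t z \<le> \<kappa> B t" if "finite B" "B \<subseteq> D" for B t
    unfolding \<kappa>_def
    by (rule K_mono_pair[OF _ _ _ _ zSF[OF that]])
       (use cF[OF that] FJ[OF that(2)] JF[OF that] th in auto)
  have \<kappa>k: "klike (\<kappa> B)" if "finite B" "B \<subseteq> D" for B
    unfolding \<kappa>_def by (rule K_klike) (rule zSF[OF that])
  have "\<exists>B. (\<forall>n. finite (B n) \<and> B n \<subseteq> D) \<and> (\<forall>t>0. (\<lambda>n. \<kappa> (B n) t) \<longlonglongrightarrow> R.K t z)"
  proof (rule klike_selection[OF K_klike[OF zS] \<kappa>k])
    fix t e :: real assume t: "t > 0" and e: "e > 0"
    \<comment> \<open>Each part of the decomposition will be perturbed by at most
      \<open>2 * \<delta>\<close> in norm, which changes the cost by at most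
      \<open>2 * \<delta> * (1 + t) = e/2\<close>.\<close>
    define \<delta> where "\<delta> = e / (4 * (1 + t))"
    have d: "\<delta> > 0" using e t by (simp add: \<delta>_def)
    obtain x y where xy: "x \<in> carr (J \<theta>0)" "y \<in> carr (J \<theta>1)" "x + y = z"
      "sqrt ((nrm (J \<theta>0) x)\<^sup>2 + t\<^sup>2 * (nrm (J \<theta>1) y)\<^sup>2) < R.K t z + e/2"
      using K_approx[OF zS, of "e/2" t] e by auto
    \<comment> \<open>The parts need not lie in \<open>D\<close>. But \<open>y\<close> lies in both
      interpolation spaces, so it can be replaced by some \<open>v\<close> in \<open>D\<close> close
      to it in both norms, and \<open>x\<close> by \<open>z - v\<close>.\<close>
    have "y = z - x" using xy(3) by auto
    then have yJ: "y \<in> carr (J \<theta>0)" using zJ xy(1) by auto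
    have ne: "\<not> (\<theta>0 = 0 \<and> \<theta>1 = 0)" "\<not> (\<theta>0 = 1 \<and> \<theta>1 = 1)" using th(3) by auto
    obtain v where v: "v \<in> D" "nrm (J \<theta>0) (y - v) < \<delta>" "nrm (J \<theta>1) (y - v) < \<delta>"
      using Delta_approx[OF th(1,2) ne yJ xy(2) d] by blast
    have vJ: "v \<in> carr (J \<theta>0)" "v \<in> carr (J \<theta>1)" using D_J v(1) th by auto
    have zv: "z - v \<in> D" using z v by (auto intro: X.in_diff Y.in_diff)
    have ze: "z - v = x + (y - v)" using xy(3) by (simp add: algebra_simps)
    have n0: "nrm (J \<theta>0) (z - v) \<le> nrm (J \<theta>0) x + \<delta>"
      unfolding ze using R.X.nrm_tri[OF xy(1) R.X.in_diff[OF yJ vJ(1)]] v(2) by linarith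
    have n1: "nrm (J \<theta>1) v \<le> nrm (J \<theta>1) y + \<delta>"
      using R.Y.nrm_rev[OF vJ(2) xy(2)] R.Y.nrm_commute[OF vJ(2) xy(2)] v(3) by simp
    \<comment> \<open>One span nearly attains the norm of \<open>z - v\<close> for \<theta>0,
      another that of \<open>v\<close> for \<theta>1; by \<open>fin_antimono\<close> any span
      containing both keeps the two estimates.\<close>
    obtain B0 where B0: "finite B0" "B0 \<subseteq> D" "z - v \<in> B0" "nrm (fin \<theta>0 (X.span B0)) (z - v) < nrm (J \<theta>0) (z - v) + \<delta>"
      using fin_approx[OF zv th(1) d] by blast
    obtain B1 where B1: "finite B1" "B1 \<subseteq> D" "v \<in> B1" "nrm (fin \<theta>1 (X.span B1)) v < nrm (J \<theta>1) v + \<delta>"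
      using fin_approx[OF v(1) th(2) d] by blast
    have "\<bar>\<kappa> B' t - R.K t z\<bar> < e" if B': "finite B'" "B0 \<union> B1 \<subseteq> B'" "B' \<subseteq> D" for B'
    proof -
      have sub: "X.span B0 \<subseteq> X.span (insert z B')" "X.span B1 \<subseteq> X.span (insert z B')"
        using B'(2) by (auto intro!: X.span_mono)
      have m0: "nrm (fin \<theta>0 (F B')) (z - v) \<le> nrm (J \<theta>0) x + 2 * \<delta>"
        using fin_antimono[OF B0(1,2) th(1) X.span_base[OF B0(3)] sub(1)] B0(4) n0 by (simp add: F_def)
      have m1: "nrm (fin \<theta>1 (F B')) v \<le> nrm (J \<theta>1) y + 2 * \<delta>"
        using fin_antimono[OF B1(1,2) th(2) X.span_base[OF B1(3)] sub(2)] B1(4) n1 by (simp add: F_def)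
      have vF: "v \<in> F B'" "z - v \<in> F B'" using F(3) B0(3) B1(3) B'(2) by auto
      have p0: "0 \<le> nrm (fin \<theta>0 (F B')) (z - v)" "0 \<le> nrm (fin \<theta>1 (F B')) v"
        using JF[OF B'(1,3) th(1) vF(2)] JF[OF B'(1,3) th(2) vF(1)] by auto
      have "\<kappa> B' t \<le> sqrt ((nrm (fin \<theta>0 (F B')) (z - v))\<^sup>2 + t\<^sup>2 * (nrm (fin \<theta>1 (F B')) v)\<^sup>2)"
        unfolding \<kappa>_def by (rule K_lower) (use cF[OF B'(1,3)] th vF in auto)
      also have "\<dots> \<le> sqrt ((nrm (J \<theta>0) x + 2 * \<delta>)\<^sup>2 + t\<^sup>2 * (nrm (J \<theta>1) y + 2 * \<delta>)\<^sup>2)"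
        using p0 m0 m1 by (intro real_sqrt_le_mono add_mono mult_left_mono power_mono) auto
      also have "\<dots> \<le> sqrt ((nrm (J \<theta>0) x)\<^sup>2 + t\<^sup>2 * (nrm (J \<theta>1) y)\<^sup>2) + sqrt ((2 * \<delta>)\<^sup>2 + t\<^sup>2 * (2 * \<delta>)\<^sup>2)"
        by (rule sqrt_sum_triangle)
      also have "sqrt ((2 * \<delta>)\<^sup>2 + t\<^sup>2 * (2 * \<delta>)\<^sup>2) \<le> 2 * \<delta> * (1 + t)"
      proof (rule real_le_lsqrt)
        have "(2 * \<delta> * (1 + t))\<^sup>2 = (2 * \<delta>)\<^sup>2 + t\<^sup>2 * (2 * \<delta>)\<^sup>2 + 2 * t * (2 * \<delta>)\<^sup>2"
          by (simp add: power2_eq_square algebra_simps)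
        then show "(2 * \<delta>)\<^sup>2 + t\<^sup>2 * (2 * \<delta>)\<^sup>2 \<le> (2 * \<delta> * (1 + t))\<^sup>2" using t by simp
      qed (use d t in auto)
      also have "2 * \<delta> * (1 + t) = e/2" using t by (simp add: \<delta>_def field_simps)
      finally have "\<kappa> B' t < R.K t z + e" using xy(4) by simp
      then show ?thesis using ge[OF B'(1,3), of t] by simp
    qed
    then show "\<exists>B. finite B \<and> B \<subseteq> D \<and> (\<forall>B'. finite B' \<longrightarrow> B \<subseteq> B' \<longrightarrow> B' \<subseteq> D \<longrightarrow> \<bar>\<kappa> B' t - R.K t z\<bar> < e)"
      using B0 B1 by (intro exI[of _ "B0 \<union> B1"]) auto
  qed
  then obtain B where B: "\<And>n. finite (B n)" "\<And>n. B n \<subseteq> D" "\<And>t. t > 0 \<Longrightarrow> (\<lambda>n. \<kappa> (B n) t) \<longlonglongrightarrow> R.K t z" by blast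
  define M where "M = sqrt 2 * max (nrm X z) (nrm Y z)"
  have fM: "nrm (fin \<phi> (F (B n))) z \<le> M" "0 \<le> nrm (fin \<phi> (F (B n))) z" "nrm (fin \<phi> (F (B n))) 0 = 0" if "\<phi> \<in> {0..1}" for \<phi> n
  proof -
    show "nrm (fin \<phi> (F (B n))) z \<le> M" unfolding M_def F_def
      by (rule fin_le_max[OF iz[OF B(1,2)] _ that]) (auto intro: X.span_base)
    show "0 \<le> nrm (fin \<phi> (F (B n))) z" using JF[OF B(1,2) that F(1), of n] by linarith
    have "nrm (fin \<phi> (F (B n))) 0 \<le> sqrt 2 * max (nrm X 0) (nrm Y 0)" unfolding F_def
      by (rule fin_le_max[OF iz[OF B(1,2)] X.span_zero that])
    then show "nrm (fin \<phi> (F (B n))) 0 = 0" using JF[OF B(1,2) that F(2), of n] by simp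
  qed
  have b1: "\<kappa> (B n) t \<le> M" for n t
    using K_lower[of z "fin \<theta>0 (F (B n))" 0 "fin \<theta>1 (F (B n))" z t] cF[OF B(1,2)] F th fM(1,2)[OF th(1), of n] fM(3)[OF th(2), of n]
    by (simp add: \<kappa>_def)
  have b2: "\<kappa> (B n) t \<le> t * M" if t: "t > 0" for n t
  proof -
    have "\<kappa> (B n) t \<le> t * nrm (fin \<theta>1 (F (B n))) z"
      using K_lower[of 0 "fin \<theta>0 (F (B n))" z "fin \<theta>1 (F (B n))" z t] cF[OF B(1,2)] F th fM(2)[OF th(2), of n] fM(3)[OF th(1), of n] t
      by (simp add: \<kappa>_def real_sqrt_mult)
    moreover have "t * nrm (fin \<theta>1 (F (B n))) z \<le> t * M" using fM(1)[OF th(2), of n] t by (intro mult_left_mono) auto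
    ultimately show ?thesis by simp
  qed
  have "(\<lambda>n. N_const \<eta> * sqrt (enn2real (wint \<eta> (\<kappa> (B n))))) \<longlonglongrightarrow> N_const \<eta> * sqrt (enn2real (R.W \<eta> z))"
    by (rule wint_norm_tendsto[OF eta \<kappa>k[OF B(1,2)] K_klike[OF zS] b1 b2 B(3)])
  moreover have "N_const \<eta> * sqrt (enn2real (wint \<eta> (\<kappa> (B n)))) = nrm (interp (fin \<theta>0 (F (B n))) (fin \<theta>1 (F (B n))) \<eta>) z" for n
    using eta by (simp add: interp_def[of _ _ \<eta>] K_space_def K_integral_eq \<kappa>_def[abs_def])
  moreover have "N_const \<eta> * sqrt (enn2real (R.W \<eta> z)) = nrm (interp (J \<theta>0) (J \<theta>1) \<eta>) z"
    using eta by (simp add: interp_def[of _ _ \<eta>] R.KS_nrm)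
  ultimately have lim: "(\<lambda>n. nrm (fin \<theta> (F (B n))) z) \<longlonglongrightarrow> nrm (interp (J \<theta>0) (J \<theta>1) \<eta>) z"
    using fin_reiteration(1)[OF iz[OF B(1,2)] _ th(1,2) etaI] F by (simp add: F_def \<theta>_def X.span_base)
  have "nrm (J \<theta>) z \<le> nrm (interp (J \<theta>0) (J \<theta>1) \<eta>) z"
    using LIMSEQ_le_const[OF lim] JF[OF B(1,2) th' F(1)] by blast
  \<comment> \<open>For this direction a span that is nearly optimal for the single norm of
    \<open>J \<theta>\<close> suffices, since reiteration is exact on it.\<close>
  moreover have "nrm (interp (J \<theta>0) (J \<theta>1) \<eta>) z \<le> nrm (J \<theta>) z"
  proof (rule field_le_epsilon)
    fix e :: real assume "e > 0"
    then obtain B where B: "finite B" "B \<subseteq> D" "z \<in> B" "nrm (fin \<theta> (X.span B)) z < nrm (J \<theta>) z + e"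
      using fin_approx[OF z th'] by blast
    have BF: "X.span B = F B" using B(3) by (simp add: F_def insert_absorb)
    have "nrm (interp (J \<theta>0) (J \<theta>1) \<eta>) z \<le> nrm (interp (fin \<theta>0 (F B)) (fin \<theta>1 (F B)) \<eta>) z"
      by (rule interp_mono)
         (use cF[OF B(1,2)] FJ[OF B(2)] JF[OF B(1,2)] th etaI F(1) fin_reiteration(2)[OF B(1,2) X.span_base[OF B(3)] th(1,2) etaI] BF in auto)
    also have "\<dots> = nrm (fin \<theta> (F B)) z"
      using fin_reiteration(1)[OF B(1,2) X.span_base[OF B(3)] th(1,2) etaI] BF by (simp add: \<theta>_def)
    finally show "nrm (interp (J \<theta>0) (J \<theta>1) \<eta>) z \<le> nrm (J \<theta>) z + e" using B(4) BF by simp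
  qed
  ultimately show ?thesis by (simp add: \<theta>_def)
qed

theorem reiteration:
  assumes th: "\<theta>0 \<in> {0..1}" "\<theta>1 \<in> {0..1}" and eta: "0 < \<eta>" "\<eta> < 1"
  shows "space_eq (interp (J \<theta>0) (J \<theta>1) \<eta>) (J ((1 - \<eta>) * \<theta>0 + \<eta> * \<theta>1))"
proof (cases "\<theta>0 = \<theta>1")
  case True
  have "(1 - \<eta>) * \<theta>0 + \<eta> * \<theta>1 = \<theta>0" using True by (simp add: algebra_simps)
  then show ?thesis using True interp_same[OF vs _ eta] J_hilbert[OF th(1)]
    by (simp add: hilbert_space_def banach_space_def)
next
  case False
  define \<theta> where "\<theta> = (1 - \<eta>) * \<theta>0 + \<eta> * \<theta>1"
  interpret R: hpair s "J \<theta>0" "J \<theta>1" by (rule hpair_of_compatible[OF J_pair[OF th]])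
  \<comment> \<open>Since the exponents differ, their strict convex combination lies inside the open
    unit interval even if both are endpoints.\<close>
  have th': "0 < \<theta>" "\<theta> < 1"
  proof -
    have "0 < \<theta>0 \<or> 0 < \<theta>1" "\<theta>0 < 1 \<or> \<theta>1 < 1" using th False by auto
    then show "0 < \<theta>" unfolding \<theta>_def using th eta by (auto intro: add_pos_nonneg add_nonneg_pos)
    have "0 < (1 - \<eta>) * (1 - \<theta>0) + \<eta> * (1 - \<theta>1)"
      using \<open>\<theta>0 < 1 \<or> \<theta>1 < 1\<close> th eta by (auto intro: add_pos_nonneg add_nonneg_pos)
    then show "\<theta> < 1" unfolding \<theta>_def by (simp add: algebra_simps)
  qed
  have thI: "\<theta> \<in> {0..1}" and etaI: "\<eta> \<in> {0..1}" using th' eta by auto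
  let ?Z = "interp (J \<theta>0) (J \<theta>1) \<eta>"
  interpret Z: nvs s ?Z by (rule R.J_nvs[OF etaI])
  have sub: "X.subspace D" by (rule X.subspace_inter[OF X.sub Y.sub])
  have dZ: "dense_in D ?Z"
    unfolding Z.dense_in_iff
  proof (intro conjI ballI allI impI)
    have DZ: "x \<in> carr ?Z" if "x \<in> D" for x using R.D_J[OF etaI] D_J[OF th(1)] D_J[OF th(2)] that by auto
    then show "D \<subseteq> carr ?Z" by auto
    \<comment> \<open>Density in two stages: \<open>x\<close> is approximated from the intersection
      of the two interpolation spaces, then that element from \<open>D\<close> in both norms at
      once. \<open>J_Delta\<close> converts the two estimates into one for \<open>?Z\<close>, at the
      price of a factor \<open>sqrt 2\<close>.\<close>
    fix x e assume x: "x \<in> carr ?Z" and e: "(e :: real) > 0"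
    obtain y where y: "y \<in> carr (J \<theta>0)" "y \<in> carr (J \<theta>1)" "nrm ?Z (x - y) < e/2"
      using R.Delta_approx[OF etaI etaI _ _ x x, of "e/2"] eta e by auto
    have ne: "\<not> (\<theta>0 = 0 \<and> \<theta>1 = 0)" "\<not> (\<theta>0 = 1 \<and> \<theta>1 = 1)" using False by auto
    obtain v where v: "v \<in> D" "nrm (J \<theta>0) (y - v) < e/4" "nrm (J \<theta>1) (y - v) < e/4"
      using Delta_approx[OF th ne y(1,2), of "e/4"] e by auto
    have vJ: "v \<in> carr (J \<theta>0)" "v \<in> carr (J \<theta>1)" using D_J v(1) th by auto
    have yv: "y - v \<in> carr (J \<theta>0)" "y - v \<in> carr (J \<theta>1)" using y vJ by auto
    have "nrm ?Z (y - v) \<le> sqrt 2 * (e/4)"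
      by (rule R.J_Delta(2)[OF etaI yv]) (use v in auto)
    also have "\<dots> \<le> 2 * (e/4)" using e sqrt2_less_2 by (intro mult_right_mono) auto
    finally have "nrm ?Z (y - v) \<le> e/2" by simp
    moreover have "y \<in> carr ?Z" using R.D_J[OF etaI] y by auto
    ultimately have "nrm ?Z (x - v) < e"
      using Z.nrm_tri3[OF x _ DZ[OF v(1)], of y] y(3) by simp
    then show "\<exists>d\<in>D. nrm ?Z (x - d) < e" using v(1) by blast
  qed
  have "consistent ?Z (J \<theta>)"
    unfolding consistent_def
  proof (intro allI impI)
    fix u x y assume x: "conv ?Z u x" and y: "conv (J \<theta>) u y"
    have ex: "\<exists>C\<ge>0. \<forall>v\<in>carr (J \<phi>). K 1 v \<le> C * nrm (J \<phi>) v" if phi: "\<phi> \<in> {0..1}" for \<phi>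
    proof -
      obtain C where C: "C \<ge> 0" "\<forall>z\<in>carr (J \<phi>). \<forall>t>0. K t z \<le> C * nrm (J \<phi>) z * t powr \<phi>"
        using J_K[OF phi] by blast
      have "K 1 v \<le> C * nrm (J \<phi>) v" if "v \<in> carr (J \<phi>)" for v
        using C(2)[rule_format, OF that, of 1] by simp
      then show ?thesis using C(1) by blast
    qed
    obtain C0 where C0: "C0 \<ge> 0" "\<And>v. v \<in> carr (J \<theta>0) \<Longrightarrow> K 1 v \<le> C0 * nrm (J \<theta>0) v"
      using ex[OF th(1)] by blast
    obtain C1 where C1: "C1 \<ge> 0" "\<And>v. v \<in> carr (J \<theta>1) \<Longrightarrow> K 1 v \<le> C1 * nrm (J \<theta>1) v"
      using ex[OF th(2)] by blast
    have RS: "z \<in> carr S" if "z \<in> carr R.S" for z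
      using that J_S[OF th(1)] J_S[OF th(2)] unfolding Sigma_iff[of z "J \<theta>0"] by (auto intro: S_add)
    \<comment> \<open>The sum of the interpolation spaces sits continuously in the original sum, so
      limits in \<open>?Z\<close> and in \<open>J \<theta>\<close> can be compared through the
      original \<open>K 1\<close>. The case of vanishing constants only avoids a division by
      0.\<close>
    have KR: "K 1 z \<le> (C0 + C1) * R.K 1 z" if z: "z \<in> carr R.S" for z
    proof (cases "C0 + C1 = 0")
      case True
      then have "C0 = 0" "C1 = 0" using C0(1) C1(1) by auto
      obtain a b where ab: "a \<in> carr (J \<theta>0)" "b \<in> carr (J \<theta>1)" "a + b = z" using z unfolding Sigma_iff by blast
      have "K 1 z \<le> K 1 a + K 1 b" using K_tri[OF J_S[OF th(1) ab(1)] J_S[OF th(2) ab(2)], of 1] ab(3) by simp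
      then show ?thesis using C0(2)[OF ab(1)] C1(2)[OF ab(2)] \<open>C0 = 0\<close> \<open>C1 = 0\<close> by simp
    next
      case False
      then have pos: "C0 + C1 > 0" using C0(1) C1(1) by simp
      have "K 1 z / (C0 + C1) \<le> R.K 1 z"
      proof (rule K_greatest[OF z])
        fix a b assume ab: "a \<in> carr (J \<theta>0)" "b \<in> carr (J \<theta>1)" "a + b = z"
        let ?r = "sqrt ((nrm (J \<theta>0) a)\<^sup>2 + 1\<^sup>2 * (nrm (J \<theta>1) b)\<^sup>2)"
        have "nrm (J \<theta>0) a \<le> ?r" "nrm (J \<theta>1) b \<le> ?r" by (rule real_le_rsqrt; simp)+
        then have "C0 * nrm (J \<theta>0) a + C1 * nrm (J \<theta>1) b \<le> C0 * ?r + C1 * ?r"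
          using C0(1) C1(1) by (intro add_mono mult_left_mono)
        moreover have "K 1 z \<le> K 1 a + K 1 b" using K_tri[OF J_S[OF th(1) ab(1)] J_S[OF th(2) ab(2)], of 1] ab(3) by simp
        ultimately have "K 1 z \<le> (C0 + C1) * ?r" using C0(2)[OF ab(1)] C1(2)[OF ab(2)] unfolding distrib_right by linarith
        then show "K 1 z / (C0 + C1) \<le> ?r" using pos by (simp add: pos_divide_le_eq mult.commute)
      qed
      then show ?thesis using pos by (simp add: pos_divide_le_eq mult.commute)
    qed
    have Zx: "u n \<in> carr R.S" "x \<in> carr R.S" for n using Z.convD[OF x] R.J_S[OF etaI] by auto
    have yS: "y \<in> carr S" using nvs.convD[OF J_nvs[OF thI] y] J_S[OF thI] by auto
    have "(\<lambda>n. (C0 + C1) * R.K 1 (u n - x) + K 1 (u n - y)) \<longlonglongrightarrow> (C0 + C1) * 0 + 0"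
      by (intro tendsto_add tendsto_mult tendsto_const R.J_conv_K[OF etaI x] J_conv_K[OF thI y])
    moreover have "K 1 (y - x) \<le> (C0 + C1) * R.K 1 (u n - x) + K 1 (u n - y)" for n
    proof -
      have "K 1 (y - x) \<le> K 1 (u n - x) + K 1 (u n - y)"
        using K_tri_diff[OF S_diff[OF RS[OF Zx(1)] RS[OF Zx(2)]] S_diff[OF RS[OF Zx(1)] yS], of 1 n n] by simp
      then show ?thesis using KR[OF R.S_diff[OF Zx(1) Zx(2)], of n] by simp
    qed
    ultimately have "K 1 (y - x) \<le> (C0 + C1) * 0 + 0" by (intro LIMSEQ_le_const) auto
    then have "K 1 (y - x) = 0" using K_ge0[OF S_diff[OF yS RS[OF Zx(2)]], of 1] by simp
    then show "x = y" using K_eq0[OF S_diff[OF yS RS[OF Zx(2)]], of 1] by simp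
  qed
  moreover have "banach_space s ?Z" "banach_space s (J \<theta>)"
    using R.J_hilbert[OF etaI] J_hilbert[OF thI] by (auto simp: hilbert_space_def)
  ultimately show ?thesis
    unfolding \<theta>_def[symmetric]
    using space_eq_of_dense[OF vs, of ?Z "J \<theta>" D] dZ Delta_dense_J[OF th'] sub
      reiteration_Delta[OF th False eta] by (auto simp: \<theta>_def)
qed

end

section \<open>Duals as spaces of functionals on a dense subspace\<close>

definition fun_on :: "(complex \<Rightarrow> 'v \<Rightarrow> 'v) \<Rightarrow> 'v::ab_group_add set \<Rightarrow> ('v \<Rightarrow> complex) \<Rightarrow> bool" where
  "fun_on s D g \<longleftrightarrow> (\<forall>x. x \<notin> D \<longrightarrow> g x = 0) \<and> linear_on s D g"

lemma dual_space_carr: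
  "f \<in> carr (dual_space s X) \<longleftrightarrow> fun_on s (carr X) f \<and> (\<exists>B. \<forall>x\<in>carr X. cmod (f x) \<le> B * nrm X x)"
  by (auto simp: dual_space_def fun_on_def linear_on_def)

lemma linear_onD:
  assumes "linear_on s D g"
  shows "x \<in> D \<Longrightarrow> y \<in> D \<Longrightarrow> g (x + y) = g x + g y" "x \<in> D \<Longrightarrow> g (s c x) = c * g x"
  using assms by (auto simp: linear_on_def)

context complex_vs begin

lemma linear_on_zero: "subspace D \<Longrightarrow> linear_on s D g \<Longrightarrow> g 0 = 0"
  using linear_onD(2)[of s D g 0 0] subspace_0 by simp

lemma linear_on_diff:
  assumes "subspace D" "linear_on s D g" "x \<in> D" "y \<in> D" shows "g (x - y) = g x - g y"
proof -
  have "g (x - y) + g y = g x"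
    using linear_onD(1)[OF assms(2) subspace_diff[OF assms(1,3,4)] assms(4)] by simp
  then show ?thesis by (simp add: eq_diff_eq)
qed

lemma linear_on_sum:
  assumes "subspace D" "linear_on s D g" "finite E" "E \<subseteq> D"
  shows "g (\<Sum>e\<in>E. s (c e) e) = (\<Sum>e\<in>E. c e * g e)"
  using assms(3,4)
proof (induction E)
  case empty
  then show ?case using linear_on_zero[OF assms(1,2)] by simp
next
  case (insert e E)
  have "(\<Sum>e\<in>E. s (c e) e) \<in> D" using insert assms(1) by (auto intro!: subspace_sum subspace_scale)
  then show ?case
    using insert assms(1) linear_onD[OF assms(2)] by (simp add: subspace_scale)
qed

end

context nvs begin

lemma dual_norm:
  assumes f: "f \<in> carr (dual_space s X)"
  shows "0 \<le> nrm (dual_space s X) f"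
    "x \<in> carr X \<Longrightarrow> cmod (f x) \<le> nrm (dual_space s X) f * nrm X x"
    "B \<ge> 0 \<Longrightarrow> (\<And>x. x \<in> carr X \<Longrightarrow> cmod (f x) \<le> B * nrm X x) \<Longrightarrow> nrm (dual_space s X) f \<le> B"
proof -
  let ?A = "{cmod (f x) | x. x \<in> carr X \<and> nrm X x \<le> 1}"
  have lin: "linear_on s (carr X) f" using f by (simp add: dual_space_carr fun_on_def)
  obtain B0 where B0: "\<And>x. x \<in> carr X \<Longrightarrow> cmod (f x) \<le> B0 * nrm X x" using f by (auto simp: dual_space_carr)
  have nrm: "nrm (dual_space s X) f = Sup ?A" by (simp add: dual_space_def)
  have "f 0 = 0" by (rule linear_on_zero[OF sub lin])
  then have 0: "0 \<in> ?A" by (force intro: exI[of _ 0])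
  have bdd: "bdd_above ?A"
  proof (rule bdd_aboveI)
    fix v assume "v \<in> ?A"
    then obtain x where x: "v = cmod (f x)" "x \<in> carr X" "nrm X x \<le> 1" by blast
    have "cmod (f x) \<le> B0 * nrm X x" using B0 x by blast
    also have "\<dots> \<le> \<bar>B0\<bar> * 1" using x nrm_ge0[OF x(2)] by (intro mult_mono) auto
    finally show "v \<le> \<bar>B0\<bar>" using x by simp
  qed
  show "0 \<le> nrm (dual_space s X) f" unfolding nrm by (rule cSup_upper[OF 0 bdd])
  show "cmod (f x) \<le> nrm (dual_space s X) f * nrm X x" if x: "x \<in> carr X"
  proof (cases "x = 0")
    case True then show ?thesis using \<open>f 0 = 0\<close> by simp
  next
    case False
    then have p: "nrm X x > 0" using nrm_eq0[OF x] nrm_ge0[OF x] by simp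
    define y where "y = s (of_real (1 / nrm X x)) x"
    have "y \<in> carr X" "nrm X y \<le> 1" using x p by (auto simp: y_def nrm_scale norm_divide)
    then have "cmod (f y) \<le> Sup ?A" by (intro cSup_upper bdd) auto
    moreover have "cmod (f y) = cmod (f x) / nrm X x"
      using linear_onD(2)[OF lin x] p by (simp add: y_def norm_mult norm_divide)
    ultimately show ?thesis using p by (simp add: nrm pos_divide_le_eq)
  qed
  assume B: "B \<ge> 0" "\<And>x. x \<in> carr X \<Longrightarrow> cmod (f x) \<le> B * nrm X x"
  show "nrm (dual_space s X) f \<le> B" unfolding nrm
  proof (rule cSup_least)
    fix v assume "v \<in> ?A"
    then obtain x where x: "v = cmod (f x)" "x \<in> carr X" "nrm X x \<le> 1" by blast
    then show "v \<le> B" using B(2)[OF x(2)] mult_left_mono[OF x(3) B(1)] by simp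
  qed (use 0 in auto)
qed

lemma bounded_of_dense:
  assumes D: "dense_in D X" and f: "f \<in> carr (dual_space s X)"
    and B: "\<And>x. x \<in> D \<Longrightarrow> cmod (f x) \<le> B * nrm X x" and x: "x \<in> carr X"
  shows "cmod (f x) \<le> B * nrm X x"
proof -
  obtain u where u: "\<And>n. u n \<in> D" "conv X u x" using dense_seq[OF D x] by blast
  have uX: "u n \<in> carr X" for n by (rule convD(1)[OF u(2)])
  have lin: "linear_on s (carr X) f" using f by (simp add: dual_space_carr fun_on_def)
  have l0: "(\<lambda>n. nrm (dual_space s X) f * nrm X (u n - x)) \<longlonglongrightarrow> 0"
    using u(2) by (auto simp: conv_def intro!: tendsto_mult_right_zero)
  have "(\<lambda>n. f (u n) - f x) \<longlonglongrightarrow> 0"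
  proof (rule Lim_null_comparison[OF _ l0], intro always_eventually allI)
    fix n show "norm (f (u n) - f x) \<le> nrm (dual_space s X) f * nrm X (u n - x)"
      using dual_norm(2)[OF f in_diff[OF uX[of n] x]] linear_on_diff[OF sub lin uX[of n] x] by simp
  qed
  then have "(\<lambda>n. cmod (f (u n))) \<longlonglongrightarrow> cmod (f x)" by (intro tendsto_norm) (rule LIM_zero_cancel)
  moreover have "(\<lambda>n. B * nrm X (u n)) \<longlonglongrightarrow> B * nrm X x" by (intro tendsto_intros conv_nrm[OF u(2)])
  ultimately show ?thesis by (rule LIMSEQ_le) (use B u(1) in auto)
qed

text \<open>The difference of two functionals that agree on \<open>D\<close> is bounded there with
  constant 0, and by density everywhere.\<close>

lemma restr_inj: assumes D: "dense_in D X" shows "inj_on (restr D) (carr (dual_space s X))"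
proof (rule inj_onI)
  fix f g assume f: "f \<in> carr (dual_space s X)" and g: "g \<in> carr (dual_space s X)" and e: "restr D f = restr D g"
  have eD: "f x = g x" if "x \<in> D" for x using fun_cong[OF e, of x] that by (simp add: restr_def)
  obtain B C where BC: "\<And>x. x \<in> carr X \<Longrightarrow> cmod (f x) \<le> B * nrm X x" "\<And>x. x \<in> carr X \<Longrightarrow> cmod (g x) \<le> C * nrm X x"
    using f g unfolding dual_space_carr by blast
  let ?h = "\<lambda>x. f x - g x"
  have "cmod (?h x) \<le> (B + C) * nrm X x" if "x \<in> carr X" for x
    using BC[OF that] norm_triangle_ineq4[of "f x" "g x"] by (simp add: distrib_right)
  moreover have "fun_on s (carr X) ?h"
    using f g unfolding dual_space_carr fun_on_def linear_on_def by (auto simp: algebra_simps)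
  ultimately have h: "?h \<in> carr (dual_space s X)" unfolding dual_space_carr by blast
  have "f x - g x = 0" if "x \<in> carr X" for x
    using bounded_of_dense[OF D h, of 0 x] eD that by simp
  moreover have "f x = g x" if "x \<notin> carr X" for x
    using f g that by (simp add: dual_space_carr fun_on_def)
  ultimately show "f = g" by (intro ext) (metis eq_iff_diff_eq_0)
qed

end

text \<open>Riesz represents a functional bounded on \<open>D\<close>, and the representing vector
  defines its extension to \<open>X\<close>; density keeps the best constant unchanged. Afterwards
  the dual is handled through functionals on \<open>D\<close> and their best constants, without
  reference to \<open>inv_into\<close>.\<close>

lemma (in hilbert) dual_on_char:
  assumes Ds: "subspace D" and D: "dense_in D X"
  shows "g \<in> carr (dual_on s D X) \<longleftrightarrow> fun_on s D g \<and> (\<exists>B. \<forall>x\<in>D. cmod (g x) \<le> B * nrm X x)"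
    and "g \<in> carr (dual_on s D X) \<Longrightarrow> 0 \<le> nrm (dual_on s D X) g"
    and "g \<in> carr (dual_on s D X) \<Longrightarrow> x \<in> D \<Longrightarrow> cmod (g x) \<le> nrm (dual_on s D X) g * nrm X x"
    and "g \<in> carr (dual_on s D X) \<Longrightarrow> B \<ge> 0 \<Longrightarrow> (\<And>x. x \<in> D \<Longrightarrow> cmod (g x) \<le> B * nrm X x)
       \<Longrightarrow> nrm (dual_on s D X) g \<le> B"
proof -
  have DX: "D \<subseteq> carr X" using D by (simp add: dense_in_iff)
  have carr: "carr (dual_on s D X) = restr D ` carr (dual_space s X)" by (simp add: dual_on_def)
  have nrm: "nrm (dual_on s D X) (restr D f) = nrm (dual_space s X) f" if "f \<in> carr (dual_space s X)" for f
    using inv_into_f_f[OF restr_inj[OF D] that] by (simp add: dual_on_def)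
  show "g \<in> carr (dual_on s D X) \<longleftrightarrow> fun_on s D g \<and> (\<exists>B. \<forall>x\<in>D. cmod (g x) \<le> B * nrm X x)"
  proof
    assume "g \<in> carr (dual_on s D X)"
    then obtain f where f: "f \<in> carr (dual_space s X)" "g = restr D f" by (auto simp: carr)
    have "x + y \<in> D" "s c x \<in> D" if "x \<in> D" "y \<in> D" for x y c
      using that Ds by (auto intro: subspace_add subspace_scale)
    then have "fun_on s D g"
      using f DX unfolding dual_space_carr fun_on_def linear_on_def by (auto simp: restr_def subset_iff)
    moreover have "cmod (g x) \<le> nrm (dual_space s X) f * nrm X x" if "x \<in> D" for x
      using dual_norm(2)[OF f(1), of x] f(2) that DX by (auto simp: restr_def)
    ultimately show "fun_on s D g \<and> (\<exists>B. \<forall>x\<in>D. cmod (g x) \<le> B * nrm X x)" by blast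
  next
    assume *: "fun_on s D g \<and> (\<exists>B. \<forall>x\<in>D. cmod (g x) \<le> B * nrm X x)"
    then obtain B where B: "\<And>x. x \<in> D \<Longrightarrow> cmod (g x) \<le> B * nrm X x" by blast
    have "cmod (g x) \<le> max B 0 * nrm X x" if "x \<in> D" for x
    proof -
      have "B * nrm X x \<le> max B 0 * nrm X x" using nrm_ge0[of x] DX that by (intro mult_right_mono) auto
      then show ?thesis using B[OF that] by simp
    qed
    then obtain e where e: "e \<in> carr X" "\<And>x. x \<in> D \<Longrightarrow> g x = ip x e"
      using riesz_on_subspace[OF Ds DX, of g "max B 0"] * by (auto simp: fun_on_def)
    define f where "f x = (if x \<in> carr X then ip x e else 0)" for x
    have "cmod (f x) \<le> nrm X e * nrm X x" if "x \<in> carr X" for x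
      using cauchy_schwarz[OF that e(1)] that by (simp add: f_def mult.commute)
    then have "f \<in> carr (dual_space s X)"
      using e(1) unfolding dual_space_carr fun_on_def linear_on_def
      by (auto simp: f_def ip_add_left ip_scale_left)
    moreover have "restr D f = g"
      using e(2) DX * by (auto simp: restr_def f_def fun_on_def fun_eq_iff)
    ultimately show "g \<in> carr (dual_on s D X)" by (auto simp: carr)
  qed
  assume "g \<in> carr (dual_on s D X)"
  then obtain f where f: "f \<in> carr (dual_space s X)" "g = restr D f" by (auto simp: carr)
  have gf: "g x = f x" if "x \<in> D" for x using that f(2) by (simp add: restr_def)
  have gn: "nrm (dual_on s D X) g = nrm (dual_space s X) f" using nrm f by simp
  show "0 \<le> nrm (dual_on s D X) g" unfolding gn by (rule dual_norm(1)[OF f(1)])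
  show "cmod (g x) \<le> nrm (dual_on s D X) g * nrm X x" if "x \<in> D"
    unfolding gn gf[OF that] using dual_norm(2)[OF f(1)] DX that by blast
  assume B: "B \<ge> 0" "\<And>x. x \<in> D \<Longrightarrow> cmod (g x) \<le> B * nrm X x"
  have Bf: "cmod (f y) \<le> B * nrm X y" if "y \<in> D" for y using B(2)[OF that] gf[OF that] by simp
  show "nrm (dual_on s D X) g \<le> B"
    unfolding gn by (rule dual_norm(3)[OF f(1) B(1) bounded_of_dense[OF D f(1) Bf]])
qed

lemma vector_space_fun_scale: "vector_space (fun_scale :: complex \<Rightarrow> ('v \<Rightarrow> complex) \<Rightarrow> 'v \<Rightarrow> complex)"
  by unfold_locales (auto simp: fun_scale_def fun_eq_iff algebra_simps)

lemma cauchy_schwarz_2: "a * x + b * y \<le> sqrt (a\<^sup>2 + b\<^sup>2) * sqrt (x\<^sup>2 + y\<^sup>2)" for a b x y :: real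
proof -
  have "(a * x + b * y)\<^sup>2 \<le> (a\<^sup>2 + b\<^sup>2) * (x\<^sup>2 + y\<^sup>2)"
    using zero_le_power2[of "a * y - b * x"] by (simp add: power2_eq_square algebra_simps)
  from real_le_rsqrt[OF this] show ?thesis by (simp add: real_sqrt_mult)
qed

text \<open>The dual of the subspace \<open>D\<close> of \<open>X\<close>, described by its universal property.\<close>
locale dual_rep = nvs s X for s :: "complex \<Rightarrow> 'v::ab_group_add \<Rightarrow> 'v" and X +
  fixes D :: "'v set" and Z :: "('v \<Rightarrow> complex) nspace"
  assumes Ds: "subspace D" and DX: "D \<subseteq> carr X" and pg: "pgram X"
    and Zc: "g \<in> carr Z \<longleftrightarrow> fun_on s D g \<and> (\<exists>B. \<forall>x\<in>D. cmod (g x) \<le> B * nrm X x)"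
    and Z0: "g \<in> carr Z \<Longrightarrow> 0 \<le> nrm Z g"
    and Zb: "g \<in> carr Z \<Longrightarrow> x \<in> D \<Longrightarrow> cmod (g x) \<le> nrm Z g * nrm X x"
    and Zl: "g \<in> carr Z \<Longrightarrow> B \<ge> 0 \<Longrightarrow> (\<And>x. x \<in> D \<Longrightarrow> cmod (g x) \<le> B * nrm X x) \<Longrightarrow> nrm Z g \<le> B"
begin

interpretation V: vector_space "fun_scale :: complex \<Rightarrow> ('v \<Rightarrow> complex) \<Rightarrow> 'v \<Rightarrow> complex"
  by (rule vector_space_fun_scale)

lemma Z_off: "g \<in> carr Z \<Longrightarrow> x \<notin> D \<Longrightarrow> g x = 0" by (simp add: Zc fun_on_def)
lemma Z_lin: "g \<in> carr Z \<Longrightarrow> linear_on s D g" by (simp add: Zc fun_on_def)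

lemma Z_bounded_in:
  assumes "fun_on s D g" "\<And>x. x \<in> D \<Longrightarrow> cmod (g x) \<le> B * nrm X x" shows "g \<in> carr Z"
  using assms Zc by blast

lemma Z_add: assumes f: "f \<in> carr Z" and g: "g \<in> carr Z" shows "f + g \<in> carr Z"
proof (rule Z_bounded_in)
  show "fun_on s D (f + g)" using f g unfolding Zc fun_on_def linear_on_def by (auto simp: algebra_simps)
  fix x assume x: "x \<in> D"
  show "cmod ((f + g) x) \<le> (nrm Z f + nrm Z g) * nrm X x"
    using Zb[OF f x] Zb[OF g x] norm_triangle_ineq[of "f x" "g x"] by (simp add: distrib_right)
qed

lemma Z_scale: assumes g: "g \<in> carr Z" shows "fun_scale c g \<in> carr Z"
proof (rule Z_bounded_in)
  show "fun_on s D (fun_scale c g)"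
    using g unfolding Zc fun_on_def linear_on_def by (auto simp: fun_scale_def algebra_simps)
  fix x assume x: "x \<in> D"
  show "cmod (fun_scale c g x) \<le> (cmod c * nrm Z g) * nrm X x"
    using mult_left_mono[OF Zb[OF g x], of "cmod c"] by (simp add: fun_scale_def norm_mult mult.assoc)
qed

lemma Z_zero: "0 \<in> carr Z"
  by (rule Z_bounded_in[where B = 0]) (auto simp: fun_on_def linear_on_def)

lemma Z_diff: "f \<in> carr Z \<Longrightarrow> g \<in> carr Z \<Longrightarrow> f - g \<in> carr Z"
  using Z_add[of f "fun_scale (-1) g"] Z_scale[of g "-1"] by simp

lemma Z_normed: "normed_space fun_scale Z"
  unfolding normed_space_def
proof (intro conjI ballI allI)
  show "V.subspace (carr Z)" by (rule V.subspaceI) (auto intro: Z_zero Z_add Z_scale)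
  fix g assume g: "g \<in> carr Z"
  show "0 \<le> nrm Z g" by (rule Z0[OF g])
  show "nrm Z g = 0 \<longleftrightarrow> g = 0"
  proof
    assume "nrm Z g = 0"
    then have "g x = 0" for x using Zb[OF g, of x] Z_off[OF g, of x] by (cases "x \<in> D") auto
    then show "g = 0" by (simp add: fun_eq_iff)
  next
    assume "g = 0"
    then show "nrm Z g = 0" using Zl[OF g, of 0] Z0[OF g] by simp
  qed
  fix c
  have le: "nrm Z (fun_scale c g) \<le> cmod c * nrm Z g" if g: "g \<in> carr Z" for c g
    by (rule Zl[OF Z_scale[OF g]])
       (use Z0[OF g] mult_left_mono[OF Zb[OF g], of _ "cmod c"] in \<open>auto simp: fun_scale_def norm_mult mult.assoc\<close>)
  show "nrm Z (fun_scale c g) = cmod c * nrm Z g"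
  proof (cases "c = 0")
    case True then show ?thesis using le[OF g, of c] Z0[OF Z_scale[OF g, of c]] by simp
  next
    case False
    have "nrm Z (fun_scale (1/c) (fun_scale c g)) \<le> cmod (1/c) * nrm Z (fun_scale c g)"
      by (rule le[OF Z_scale[OF g]])
    then show ?thesis using le[OF g, of c] False by (simp add: norm_divide field_simps)
  qed
next
  fix f g assume f: "f \<in> carr Z" and g: "g \<in> carr Z"
  show "nrm Z (f + g) \<le> nrm Z f + nrm Z g"
  proof (rule Zl[OF Z_add[OF f g]])
    show "0 \<le> nrm Z f + nrm Z g" using Z0[OF f] Z0[OF g] by simp
    fix x assume x: "x \<in> D"
    show "cmod ((f + g) x) \<le> (nrm Z f + nrm Z g) * nrm X x"
      using Zb[OF f x] Zb[OF g x] norm_triangle_ineq[of "f x" "g x"] by (simp add: distrib_right)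
  qed
qed

text \<open>Without such a vector, homogeneity would make \<open>nrm Z g - e\<close> an admissible
  constant, against the minimality in \<open>Zl\<close>.\<close>

lemma Z_approx:
  assumes g: "g \<in> carr Z" and e: "e > 0"
  shows "\<exists>x\<in>D. nrm X x \<le> 1 \<and> nrm Z g - e < cmod (g x)"
proof (rule ccontr)
  assume "\<not> ?thesis"
  then have le: "cmod (g x) \<le> nrm Z g - e" if "x \<in> D" "nrm X x \<le> 1" for x using that by force
  have B: "0 \<le> nrm Z g - e" using order_trans[OF norm_ge_zero le[of 0]] subspace_0[OF Ds] by simp
  have "nrm Z g \<le> nrm Z g - e"
  proof (rule Zl[OF g B])
    fix x assume x: "x \<in> D"
    have xX: "x \<in> carr X" using x DX by auto
    show "cmod (g x) \<le> (nrm Z g - e) * nrm X x"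
    proof (cases "nrm X x = 0")
      case True then show ?thesis using Zb[OF g x] by simp
    next
      case False
      then have p: "nrm X x > 0" using nrm_ge0[OF xX] by simp
      have "cmod (g (s (of_real (1 / nrm X x)) x)) \<le> nrm Z g - e"
        using x xX p Ds by (intro le) (auto simp: nrm_scale norm_divide intro: subspace_scale)
      then show ?thesis
        using linear_onD(2)[OF Z_lin[OF g] x] p by (simp add: norm_mult norm_divide pos_divide_le_eq)
    qed
  qed
  then show False using e by simp
qed

text \<open>With \<open>a, b\<close> the norms of \<open>f + g, f - g\<close> and nearly norming unit vectors \<open>x, y\<close> for them,
  test on \<open>f (ax + by) + g (ax - by)\<close> and apply the parallelogram law of \<open>X\<close>.\<close>
lemma Z_pgram: "pgram Z"
proof -
  have phase: "\<exists>p. cmod p = 1 \<and> p * z = complex_of_real (cmod z)" for z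
  proof (cases "z = 0")
    case True then show ?thesis by (intro exI[of _ 1]) simp
  next
    case False
    then show ?thesis
      by (intro exI[of _ "complex_of_real (cmod z) / z"]) (simp add: norm_divide)
  qed
  have le: "(nrm Z (f + g))\<^sup>2 + (nrm Z (f - g))\<^sup>2 \<le> 2 * (nrm Z f)\<^sup>2 + 2 * (nrm Z g)\<^sup>2"
    if f: "f \<in> carr Z" and g: "g \<in> carr Z" for f g
  proof -
    define F where "F = sqrt ((nrm Z f)\<^sup>2 + (nrm Z g)\<^sup>2)"
    have F0: "F \<ge> 0" by (simp add: F_def)
    have key: "cmod ((f + g) x) + cmod ((f - g) y) \<le> F * sqrt (2 * (nrm X x)\<^sup>2 + 2 * (nrm X y)\<^sup>2)"
      if x: "x \<in> D" and y: "y \<in> D" for x y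
    proof -
      \<comment> \<open>Rotating \<open>x\<close> and \<open>y\<close> by phases makes both values
        nonnegative, so their sum becomes the modulus of one expression in \<open>f\<close> and
        \<open>g\<close>.\<close>
      obtain p where p: "cmod p = 1" "p * (f + g) x = complex_of_real (cmod ((f + g) x))" using phase by blast
      obtain q where q: "cmod q = 1" "q * (f - g) y = complex_of_real (cmod ((f - g) y))" using phase by blast
      define x' y' where "x' = s p x" and "y' = s q y"
      have D': "x' \<in> D" "y' \<in> D" "x' + y' \<in> D" "x' - y' \<in> D"
        using x y Ds by (auto simp: x'_def y'_def intro: subspace_scale subspace_add subspace_diff)
      have X': "x' \<in> carr X" "y' \<in> carr X" using D' DX by auto
      have n': "nrm X x' = nrm X x" "nrm X y' = nrm X y"
        using x y DX p q by (auto simp: x'_def y'_def nrm_scale subset_iff)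
      have lf: "f x' = p * f x" "f y' = q * f y" and lg: "g x' = p * g x" "g y' = q * g y"
        using linear_onD(2)[OF Z_lin[OF f]] linear_onD(2)[OF Z_lin[OF g]] x y by (auto simp: x'_def y'_def)
      have "complex_of_real (cmod ((f + g) x) + cmod ((f - g) y)) = f (x' + y') + g (x' - y')"
        unfolding of_real_add p(2)[symmetric] q(2)[symmetric] linear_onD(1)[OF Z_lin[OF f] D'(1,2)]
          linear_on_diff[OF Ds Z_lin[OF g] D'(1,2)] lf lg
        by (simp add: algebra_simps)
      then have "cmod ((f + g) x) + cmod ((f - g) y) = cmod (f (x' + y') + g (x' - y'))"
        by (metis norm_of_real abs_of_nonneg add_nonneg_nonneg norm_ge_zero)
      also have "\<dots> \<le> nrm Z f * nrm X (x' + y') + nrm Z g * nrm X (x' - y')"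
        using Zb[OF f D'(3)] Zb[OF g D'(4)] by (intro order_trans[OF norm_triangle_ineq] add_mono)
      also have "\<dots> \<le> F * sqrt ((nrm X (x' + y'))\<^sup>2 + (nrm X (x' - y'))\<^sup>2)"
        unfolding F_def by (rule cauchy_schwarz_2)
      also have "(nrm X (x' + y'))\<^sup>2 + (nrm X (x' - y'))\<^sup>2 = 2 * (nrm X x)\<^sup>2 + 2 * (nrm X y)\<^sup>2"
        using pg X' n' by (simp add: pgram_def)
      finally show ?thesis .
    qed
    define a b T where "a = nrm Z (f + g)" and "b = nrm Z (f - g)" and "T = a\<^sup>2 + b\<^sup>2"
    have ab: "a \<ge> 0" "b \<ge> 0" using Z0[OF Z_add[OF f g]] Z0[OF Z_diff[OF f g]] by (auto simp: a_def b_def)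
    have T: "T \<ge> 0" by (simp add: T_def)
    \<comment> \<open>Squaring turns this into \<open>T \<le> 2 * F^2\<close>, the inequality
      sought. The weights \<open>a\<close> and \<open>b\<close> on the nearly norming vectors make
      the sum of the two values nearly \<open>a^2 + b^2\<close>.\<close>
    have "T \<le> F * sqrt (2 * T)"
    proof (rule field_le_epsilon)
      fix e :: real assume e: "e > 0"
      define d where "d = e / (a + b + 1)"
      have d: "d > 0" using e ab by (simp add: d_def)
      obtain x where x: "x \<in> D" "nrm X x \<le> 1" "a - d < cmod ((f + g) x)"
        using Z_approx[OF Z_add[OF f g] d] unfolding a_def by blast
      obtain y where y: "y \<in> D" "nrm X y \<le> 1" "b - d < cmod ((f - g) y)"
        using Z_approx[OF Z_diff[OF f g] d] unfolding b_def by blast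
      have X: "x \<in> carr X" "y \<in> carr X" using x y DX by auto
      let ?x = "s (of_real a) x" and ?y = "s (of_real b) y"
      have "a * (a - d) + b * (b - d) \<le> a * cmod ((f + g) x) + b * cmod ((f - g) y)"
        using ab x y by (intro add_mono mult_left_mono) auto
      also have "\<dots> = cmod ((f + g) ?x) + cmod ((f - g) ?y)"
        using linear_onD(2)[OF Z_lin[OF Z_add[OF f g]] x(1)] linear_onD(2)[OF Z_lin[OF Z_diff[OF f g]] y(1)] ab
        by (simp only: norm_mult norm_of_real abs_of_nonneg)
      also have "\<dots> \<le> F * sqrt (2 * (nrm X ?x)\<^sup>2 + 2 * (nrm X ?y)\<^sup>2)"
        using x y Ds by (intro key subspace_scale)
      also have "\<dots> \<le> F * sqrt (2 * T)"
      proof -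
        have "(nrm X ?x)\<^sup>2 \<le> a\<^sup>2" "(nrm X ?y)\<^sup>2 \<le> b\<^sup>2"
          using X x y ab nrm_ge0 by (auto simp: nrm_scale power_mult_distrib intro!: mult_left_le power_le_one)
        then show ?thesis using F0 by (intro mult_left_mono real_sqrt_le_mono) (auto simp: T_def)
      qed
      finally have "T - (a + b) * d \<le> F * sqrt (2 * T)" by (simp add: T_def power2_eq_square algebra_simps)
      moreover have "(a + b) * d \<le> (a + b + 1) * d" using d by simp
      moreover have "(a + b + 1) * d = e" using ab by (simp add: d_def)
      ultimately show "T \<le> F * sqrt (2 * T) + e" by linarith
    qed
    also have "\<dots> = sqrt (F\<^sup>2 * (2 * T))" using F0 by (simp add: real_sqrt_mult)
    finally have "T\<^sup>2 \<le> F\<^sup>2 * (2 * T)" using T by (intro sq_le_of_le_sqrt)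
    then have "T * T \<le> (2 * F\<^sup>2) * T" by (simp add: power2_eq_square mult_ac)
    then have "T \<le> 2 * F\<^sup>2" using T by (cases "T = 0") (auto simp: mult_le_cancel_right)
    then show ?thesis by (simp add: T_def F_def a_def b_def)
  qed
  show ?thesis
    unfolding pgram_def
  proof (intro ballI antisym le)
    fix f g assume f: "f \<in> carr Z" and g: "g \<in> carr Z"
    interpret z: nvs fun_scale Z
      by (intro nvs.intro complex_vs.intro nvs_axioms.intro vector_space_fun_scale Z_normed)
    \<comment> \<open>The reverse inequality by the same substitution as in
      \<open>K_pgram\<close>.\<close>
    have "(nrm Z ((f + g) + (f - g)))\<^sup>2 + (nrm Z ((f + g) - (f - g)))\<^sup>2 \<le> 2 * (nrm Z (f + g))\<^sup>2 + 2 * (nrm Z (f - g))\<^sup>2"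
      using f g by (intro le Z_add Z_diff)
    moreover have "(f + g) + (f - g) = fun_scale 2 f" "(f + g) - (f - g) = fun_scale 2 g"
      by (auto simp: fun_scale_def fun_eq_iff)
    ultimately show "2 * (nrm Z f)\<^sup>2 + 2 * (nrm Z g)\<^sup>2 \<le> (nrm Z (f + g))\<^sup>2 + (nrm Z (f - g))\<^sup>2"
      using f g by (simp add: z.nrm_scale power_mult_distrib)
  qed
qed

end

section \<open>Duality\<close>

context dual_rep begin

lemma Z_nvs: "nvs fun_scale Z"
  by (intro nvs.intro complex_vs.intro nvs_axioms.intro vector_space_fun_scale Z_normed)

lemma Z_pointwise:
  assumes f: "f \<in> carr Z" and g: "g \<in> carr Z" and x: "x \<in> D"
  shows "cmod (f x - g x) \<le> nrm Z (f - g) * nrm X x"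
  using Zb[OF Z_diff[OF f g] x] by simp

text \<open>A Cauchy sequence in norm is Cauchy at each point of \<open>D\<close>. Letting
  \<open>m\<close> grow in the pointwise bounds on \<open>u n - u m\<close> gives convergence in
  norm to the pointwise limit.\<close>

lemma Z_complete: assumes u: "cauchy Z u" shows "\<exists>f. conv Z u f"
proof -
  interpret z: nvs fun_scale Z by (rule Z_nvs)
  have uZ: "u n \<in> carr Z" for n using u by (simp add: cauchy_def)
  have "\<exists>l. (\<lambda>n. u n x) \<longlonglongrightarrow> l" for x
  proof (cases "x \<in> D")
    case True
    have "Cauchy (\<lambda>n. u n x)"
    proof (rule CauchyI)
      fix e :: real assume e: "e > 0"
      define d where "d = e / (nrm X x + 1)"
      have nx: "nrm X x \<ge> 0" using True DX nrm_ge0 by auto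
      have d: "d > 0" using e nx by (simp add: d_def)
      obtain N where N: "\<And>m n. m \<ge> N \<Longrightarrow> n \<ge> N \<Longrightarrow> nrm Z (u m - u n) < d"
        using u d unfolding cauchy_def by blast
      show "\<exists>M. \<forall>m\<ge>M. \<forall>n\<ge>M. norm (u m x - u n x) < e"
      proof (intro exI[of _ N] allI impI)
        fix m n assume mn: "m \<ge> N" "n \<ge> N"
        have "norm (u m x - u n x) \<le> nrm Z (u m - u n) * nrm X x" by (rule Z_pointwise[OF uZ uZ True])
        also have "\<dots> \<le> d * nrm X x" using N[OF mn] nx by (intro mult_right_mono) auto
        also have "\<dots> < d * (nrm X x + 1)" using d by simp
        also have "\<dots> = e" using nx by (simp add: d_def)
        finally show "norm (u m x - u n x) < e" .
      qed
    qed
    then show ?thesis by (simp add: Cauchy_convergent_iff convergent_def)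
  next
    case False
    then have "u n x = 0" for n using Z_off[OF uZ] by simp
    then show ?thesis by (intro exI[of _ 0]) simp
  qed
  then obtain f where f: "\<And>x. (\<lambda>n. u n x) \<longlonglongrightarrow> f x" by metis
  have ff: "fun_on s D f"
    unfolding fun_on_def linear_on_def
  proof (intro conjI allI impI ballI)
    fix x assume "x \<notin> D"
    then have "u n x = 0" for n using Z_off[OF uZ] by simp
    then show "f x = 0" using f[of x] by (simp add: LIMSEQ_const_iff)
  next
    fix x y assume xy: "x \<in> D" "y \<in> D"
    have "u n (x + y) = u n x + u n y" for n using linear_onD(1)[OF Z_lin[OF uZ] xy] .
    then show "f (x + y) = f x + f y"
      using LIMSEQ_unique[OF f[of "x + y"]] tendsto_add[OF f[of x] f[of y]] by simp
  next
    fix c x assume x: "x \<in> D"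
    have "u n (s c x) = c * u n x" for n using linear_onD(2)[OF Z_lin[OF uZ] x] .
    then show "f (s c x) = c * f x"
      using LIMSEQ_unique[OF f[of "s c x"]] tendsto_mult_left[OF f[of x], of c] by simp
  qed
  have ev: "\<exists>N. \<forall>n\<ge>N. u n - f \<in> carr Z \<and> nrm Z (u n - f) \<le> e" if e: "e > 0" for e
  proof -
    obtain N where N: "\<And>m n. m \<ge> N \<Longrightarrow> n \<ge> N \<Longrightarrow> nrm Z (u m - u n) < e"
      using u e unfolding cauchy_def by blast
    have "u n - f \<in> carr Z \<and> nrm Z (u n - f) \<le> e" if n: "n \<ge> N" for n
    proof -
      have b: "cmod ((u n - f) x) \<le> e * nrm X x" if x: "x \<in> D" for x
      proof -
        have "(\<lambda>m. cmod (u n x - u m x)) \<longlonglongrightarrow> cmod (u n x - f x)" by (intro tendsto_intros f)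
        moreover have "\<forall>m\<ge>N. cmod (u n x - u m x) \<le> e * nrm X x"
        proof (intro allI impI)
          fix m assume m: "m \<ge> N"
          have "cmod (u n x - u m x) \<le> nrm Z (u n - u m) * nrm X x" by (rule Z_pointwise[OF uZ uZ x])
          also have "\<dots> \<le> e * nrm X x" using N[OF n m] x DX nrm_ge0 by (intro mult_right_mono) auto
          finally show "cmod (u n x - u m x) \<le> e * nrm X x" .
        qed
        ultimately show ?thesis using LIMSEQ_le_const2[of "\<lambda>m. cmod (u n x - u m x)"] by auto
      qed
      have "fun_on s D (u n - f)"
        using ff uZ[of n] unfolding Zc fun_on_def linear_on_def by (auto simp: algebra_simps)
      then have "u n - f \<in> carr Z" using b by (rule Z_bounded_in)
      then show ?thesis using Zl[of "u n - f" e] b e by auto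
    qed
    then show ?thesis by blast
  qed
  obtain N where "u N - f \<in> carr Z" using ev[of 1] by auto
  from Z_diff[OF uZ[of N] this] have fZ: "f \<in> carr Z" by simp
  have "(\<lambda>n. nrm Z (u n - f)) \<longlonglongrightarrow> 0"
  proof (rule LIMSEQ_I)
    fix e :: real assume "e > 0"
    then obtain N where "\<forall>n\<ge>N. nrm Z (u n - f) \<le> e/2" using ev[of "e/2"] by auto
    then show "\<exists>N. \<forall>n\<ge>N. norm (nrm Z (u n - f) - 0) < e"
      using \<open>e > 0\<close> Z0[OF Z_diff[OF uZ fZ]] by (intro exI[of _ N]) fastforce
  qed
  then show ?thesis using uZ fZ by (auto simp: conv_def)
qed

lemma Z_hilbert: "hilbert_space fun_scale Z"
  using Z_normed Z_complete Z_pgram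
  by (auto simp: hilbert_iff[OF vector_space_fun_scale] banach_iff[OF vector_space_fun_scale])

lemma Z_conv_pointwise: assumes "conv Z u f" "x \<in> D" shows "(\<lambda>n. u n x) \<longlonglongrightarrow> f x"
proof -
  interpret z: nvs fun_scale Z by (rule Z_nvs)
  have l0: "(\<lambda>n. nrm Z (u n - f) * nrm X x) \<longlonglongrightarrow> 0"
    using assms by (auto simp: conv_def intro!: tendsto_mult_left_zero)
  have "(\<lambda>n. u n x - f x) \<longlonglongrightarrow> 0"
    by (rule Lim_null_comparison[OF _ l0])
       (use Z_pointwise[OF z.convD[OF assms(1)] assms(2)] in simp)
  then show ?thesis by (rule LIM_zero_cancel)
qed

end

lemma dual_rep_dual_on:
  assumes s: "vector_space s" and X: "hilbert_space s X" and Ds: "module.subspace s D" and D: "dense_in D X"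
  shows "dual_rep s X D (dual_on s D X)"
proof -
  obtain ip where "hilbert s X ip" using hilbert_space_imp_hilbert[OF s X] by blast
  then interpret hilbert s X ip .
  show ?thesis
    using Ds D dual_on_char[OF Ds D] pgram
    by unfold_locales (auto simp: dense_in_iff)
qed

lemma klike_sqrt_sum:
  assumes "\<And>e. e \<in> E \<Longrightarrow> klike (f e)" "\<And>e. e \<in> E \<Longrightarrow> \<gamma> e \<ge> 0"
  shows "klike (\<lambda>t. sqrt (\<Sum>e\<in>E. \<gamma> e * (f e t)\<^sup>2))"
  unfolding klike_def
proof (intro conjI allI impI)
  fix t show "0 \<le> sqrt (\<Sum>e\<in>E. \<gamma> e * (f e t)\<^sup>2)" using assms(2) by (auto intro!: sum_nonneg)
next
  fix r t :: real assume rt: "0 < r" "r \<le> t"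
  show "sqrt (\<Sum>e\<in>E. \<gamma> e * (f e r)\<^sup>2) \<le> sqrt (\<Sum>e\<in>E. \<gamma> e * (f e t)\<^sup>2)"
    using rt assms(2) klikeD[OF assms(1)]
    by (intro real_sqrt_le_mono sum_mono mult_left_mono power_mono) auto
  have m: "c * sqrt (\<Sum>e\<in>E. \<gamma> e * (f e v)\<^sup>2) = sqrt (\<Sum>e\<in>E. \<gamma> e * (c * f e v)\<^sup>2)" if "c > 0" for c v
  proof -
    have "(\<Sum>e\<in>E. \<gamma> e * (c * f e v)\<^sup>2) = c\<^sup>2 * (\<Sum>e\<in>E. \<gamma> e * (f e v)\<^sup>2)"
      by (simp add: sum_distrib_left power_mult_distrib mult_ac)
    then show ?thesis using that by (simp add: real_sqrt_mult)
  qed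
  have "(\<Sum>e\<in>E. \<gamma> e * (r * f e t)\<^sup>2) \<le> (\<Sum>e\<in>E. \<gamma> e * (t * f e r)\<^sup>2)"
  proof (intro sum_mono mult_left_mono power_mono)
    fix e assume e: "e \<in> E"
    show "r * f e t \<le> t * f e r" using klikeD(3)[OF assms(1)[OF e] rt] .
    show "0 \<le> r * f e t" using klikeD(1)[OF assms(1)[OF e], of t] rt by simp
  qed (use assms(2) in auto)
  then show "r * sqrt (\<Sum>e\<in>E. \<gamma> e * (f e t)\<^sup>2) \<le> t * sqrt (\<Sum>e\<in>E. \<gamma> e * (f e r)\<^sup>2)"
    using m[of r t] m[of t r] rt by simp
qed

text \<open>The dual of a diagonal space is the diagonal space with the reciprocal weights.\<close>
lemma diagonal_dual:
  assumes co: "coord F E c" and E: "\<And>x. x \<in> F \<Longrightarrow> g x = (\<Sum>e\<in>E. c x e * g e)"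
    and n: "\<And>x. x \<in> F \<Longrightarrow> n x = sqrt (\<Sum>e\<in>E. w e * (cmod (c x e))\<^sup>2)"
    and w: "\<And>e. e \<in> E \<Longrightarrow> w e > 0"
  shows "x \<in> F \<Longrightarrow> cmod (g x) \<le> sqrt (\<Sum>e\<in>E. (cmod (g e))\<^sup>2 / w e) * n x"
    "M \<ge> 0 \<Longrightarrow> (\<And>x. x \<in> F \<Longrightarrow> cmod (g x) \<le> M * n x) \<Longrightarrow> sqrt (\<Sum>e\<in>E. (cmod (g e))\<^sup>2 / w e) \<le> M"
proof -
  let ?Q = "\<Sum>e\<in>E. (cmod (g e))\<^sup>2 / w e"
  have Q: "?Q \<ge> 0" using w by (auto intro!: sum_nonneg divide_nonneg_pos)
  show "cmod (g x) \<le> sqrt ?Q * n x" if x: "x \<in> F"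
  proof -
    have "cmod (g x) \<le> (\<Sum>e\<in>E. (cmod (g e) / sqrt (w e)) * (sqrt (w e) * cmod (c x e)))"
      unfolding E[OF x] using w by (intro order_trans[OF norm_sum] sum_mono) (auto simp: norm_mult less_imp_neq[symmetric])
    also have "\<dots> \<le> sqrt ((\<Sum>e\<in>E. (cmod (g e) / sqrt (w e))\<^sup>2) * (\<Sum>e\<in>E. (sqrt (w e) * cmod (c x e))\<^sup>2))"
      by (rule real_le_rsqrt[OF Cauchy_Schwarz_ineq_sum])
    also have "(\<Sum>e\<in>E. (cmod (g e) / sqrt (w e))\<^sup>2) = ?Q"
      using w by (intro sum.cong refl) (simp add: power_divide less_imp_le)
    also have "(\<Sum>e\<in>E. (sqrt (w e) * cmod (c x e))\<^sup>2) = (\<Sum>e\<in>E. w e * (cmod (c x e))\<^sup>2)"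
      using w by (intro sum.cong refl) (simp add: power_mult_distrib less_imp_le)
    finally show ?thesis using n[OF x] by (simp add: real_sqrt_mult)
  qed
  assume M: "M \<ge> 0" "\<And>x. x \<in> F \<Longrightarrow> cmod (g x) \<le> M * n x"
  \<comment> \<open>The equality case of the Cauchy-Schwarz inequality, realizable because
    coordinates can be prescribed freely.\<close>
  obtain x where x: "x \<in> F" "\<forall>e\<in>E. c x e = cnj (g e) / of_real (w e)"
    using co unfolding coord_def by (elim conjE allE[of _ "\<lambda>e. cnj (g e) / of_real (w e)"]) blast
  have "g x = (\<Sum>e\<in>E. complex_of_real ((cmod (g e))\<^sup>2 / w e))"
    unfolding E[OF x(1)] using x(2)
    by (intro sum.cong refl) (simp add: complex_norm_square[symmetric] mult.commute[of "cnj _"])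
  also have "\<dots> = complex_of_real ?Q" by simp
  finally have gx: "cmod (g x) = ?Q" using Q by (simp only: norm_of_real abs_of_nonneg)
  have "(\<Sum>e\<in>E. w e * (cmod (c x e))\<^sup>2) = ?Q"
  proof (intro sum.cong refl)
    fix e assume e: "e \<in> E"
    have "w e > 0" using w e .
    then show "w e * (cmod (c x e))\<^sup>2 = (cmod (g e))\<^sup>2 / w e"
      using x(2) e by (simp add: norm_divide power_divide power2_eq_square)
  qed
  then have "n x = sqrt ?Q" using n[OF x(1)] by simp
  then have "sqrt ?Q * sqrt ?Q \<le> M * sqrt ?Q" using M(2)[OF x(1)] gx Q by simp
  note le = this
  show "sqrt ?Q \<le> M"
  proof (cases "?Q = 0")
    case True then show ?thesis using M(1) by simp
  next
    case False
    then have "sqrt ?Q > 0" using Q by simp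
    with le show ?thesis by (rule mult_right_le_imp_le)
  qed
qed

context hpair begin

text \<open>The norm on \<open>D\<close> dual to the cost in the K-functional of functionals: a
  factor \<open>t\<close> on the second functional corresponds to \<open>1 / t\<close> on the second
  norm of the vector.\<close>

definition "tnorm t x = sqrt ((nrm X x)\<^sup>2 + (nrm Y x)\<^sup>2 / t\<^sup>2)"

lemma tnorm_ge: "x \<in> D \<Longrightarrow> nrm X x \<le> tnorm t x" "x \<in> D \<Longrightarrow> t > 0 \<Longrightarrow> nrm Y x \<le> t * tnorm t x"
proof -
  assume x: "x \<in> D"
  show "nrm X x \<le> tnorm t x" unfolding tnorm_def by (rule real_le_rsqrt) simp
  assume t: "t > 0"
  have "nrm Y x / t \<le> tnorm t x" unfolding tnorm_def by (rule real_le_rsqrt) (simp add: power_divide)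
  then show "nrm Y x \<le> t * tnorm t x" using t by (simp add: pos_divide_le_eq mult.commute)
qed

text \<open>The two inner products are exposed along with their combination because
  \<open>K_dual_le\<close> splits a functional along them. Completeness is that of the intersection,
  whose maximum norm is equivalent to \<open>tnorm t\<close>.\<close>

lemma tnorm_hilbert:
  assumes t: "t > 0" shows "\<exists>ipx ipy. hilbert s \<lparr>carr = D, nrm = tnorm t\<rparr> (\<lambda>x y. ipx x y + ipy x y / (of_real t)\<^sup>2) \<and>
     inner_on s X ipx \<and> inner_on s Y ipy"
proof -
  let ?R = "\<lparr>carr = D, nrm = tnorm t\<rparr>"
  obtain ipx ipy where ip: "inner_on s X ipx" "inner_on s Y ipy"
    using X.jordan_von_neumann[OF pX] Y.jordan_von_neumann[OF pY] by blast
  interpret ix: ips s X ipx by (intro ips.intro ips_axioms.intro X.nvs_axioms ip)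
  interpret iy: ips s Y ipy by (intro ips.intro ips_axioms.intro Y.nvs_axioms ip)
  have sub: "X.subspace D" by (rule X.subspace_inter[OF X.sub Y.sub])
  have nR: "normed_space s ?R"
    unfolding normed_space_def nspace.simps
  proof (intro conjI ballI allI sub)
    fix x assume x: "x \<in> D"
    show "0 \<le> tnorm t x" by (simp add: tnorm_def)
    show "(tnorm t x = 0) = (x = 0)"
    proof
      assume "tnorm t x = 0"
      then have "nrm X x \<le> 0" using tnorm_ge(1)[OF x, of t] by simp
      then show "x = 0" using X.nrm_eq0[of x] X.nrm_ge0[of x] x by simp
    qed (simp add: tnorm_def)
    fix c
    have "(nrm X (s c x))\<^sup>2 + (nrm Y (s c x))\<^sup>2 / t\<^sup>2 = (cmod c)\<^sup>2 * ((nrm X x)\<^sup>2 + (nrm Y x)\<^sup>2 / t\<^sup>2)"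
      using x by (simp add: X.nrm_scale Y.nrm_scale power_mult_distrib algebra_simps)
    then show "tnorm t (s c x) = cmod c * tnorm t x" by (simp add: tnorm_def real_sqrt_mult)
  next
    fix x y assume x: "x \<in> D" and y: "y \<in> D"
    have "tnorm t (x + y) \<le> sqrt ((nrm X x + nrm X y)\<^sup>2 + (1/t)\<^sup>2 * (nrm Y x + nrm Y y)\<^sup>2)"
      unfolding tnorm_def using x y
      by (auto simp: power_divide intro!: divide_right_mono add_mono power_mono X.nrm_tri Y.nrm_tri X.nrm_ge0 Y.nrm_ge0)
    also have "\<dots> \<le> tnorm t x + tnorm t y"
      using sqrt_sum_triangle[of "nrm X x" "nrm X y" "1/t" "nrm Y x" "nrm Y y"] by (simp add: tnorm_def power_divide)
    finally show "tnorm t (x + y) \<le> tnorm t x + tnorm t y" .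
  qed
  have "inner_on s ?R (\<lambda>x y. ipx x y + ipy x y / (of_real t)\<^sup>2)"
    unfolding inner_on_def nspace.simps
  proof (intro conjI ballI allI)
    fix x y assume "x \<in> D" "y \<in> D"
    then show "ipx y x + ipy y x / (of_real t)\<^sup>2 = cnj (ipx x y + ipy x y / (of_real t)\<^sup>2)"
      using ix.ip_cnj[of x y] iy.ip_cnj[of x y] by simp
  next
    fix x assume x: "x \<in> D"
    have "(tnorm t x)\<^sup>2 = (nrm X x)\<^sup>2 + (nrm Y x)\<^sup>2 / t\<^sup>2" by (simp add: tnorm_def)
    then show "ipx x x + ipy x x / (of_real t)\<^sup>2 = complex_of_real ((tnorm t x)\<^sup>2)"
      using ix.ip_self[of x] iy.ip_self[of x] x by simp
  qed (auto simp: ix.ip_add_left iy.ip_add_left ix.ip_scale_left iy.ip_scale_left add_divide_distrib algebra_simps)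
  moreover have "\<exists>x. conv ?R u x" if u: "cauchy ?R u" for u
  proof -
    have uD: "u n \<in> D" for n using u by (simp add: cauchy_def)
    have diffD: "x - y \<in> D" if "x \<in> D" "y \<in> D" for x y using X.subspace_diff[OF sub that] .
    have "consistent X Y" using J_consistent[of 0 1] by (simp add: interp_def)
    moreover have "cauchy (Delta_space X Y) u"
      unfolding cauchy_def Delta_space_def nspace.simps
    proof (intro conjI allI impI uD)
      fix e :: real assume e: "e > 0"
      obtain N where N: "\<And>m n. m \<ge> N \<Longrightarrow> n \<ge> N \<Longrightarrow> tnorm t (u m - u n) < e / (1 + t)"
        using u e t unfolding cauchy_def nspace.simps by (meson add_pos_pos divide_pos_pos zero_less_one)
      show "\<exists>N. \<forall>m\<ge>N. \<forall>n\<ge>N. max (nrm X (u m - u n)) (nrm Y (u m - u n)) < e"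
      proof (intro exI[of _ N] allI impI)
        fix m n assume mn: "m \<ge> N" "n \<ge> N"
        have r0: "tnorm t (u m - u n) \<ge> 0" by (simp add: tnorm_def)
        have "(1 + t) * tnorm t (u m - u n) < e" using N[OF mn] t by (simp add: pos_less_divide_eq mult.commute)
        moreover have "nrm X (u m - u n) \<le> tnorm t (u m - u n)" "nrm Y (u m - u n) \<le> t * tnorm t (u m - u n)"
          using tnorm_ge[OF diffD[OF uD uD]] t by auto
        moreover have "t * tnorm t (u m - u n) \<ge> 0" using r0 t by simp
        ultimately show "max (nrm X (u m - u n)) (nrm Y (u m - u n)) < e" using r0 by (simp add: distrib_right)
      qed
    qed
    ultimately obtain x where x: "conv (Delta_space X Y) u x" using Delta_complete[OF _ cX cY] by blast
    have xD: "x \<in> D" using x by (simp add: conv_def Delta_space_def)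
    have l: "(\<lambda>n. max (nrm X (u n - x)) (nrm Y (u n - x))) \<longlonglongrightarrow> 0" using x by (simp add: conv_def Delta_space_def)
    have "(\<lambda>n. nrm X (u n - x)) \<longlonglongrightarrow> 0"
      by (rule tendsto_sandwich[OF _ _ tendsto_const l]) (use diffD[OF uD xD] X.nrm_ge0 in auto)
    moreover have "(\<lambda>n. nrm Y (u n - x)) \<longlonglongrightarrow> 0"
      by (rule tendsto_sandwich[OF _ _ tendsto_const l]) (use diffD[OF uD xD] Y.nrm_ge0 in auto)
    ultimately have "(\<lambda>n. tnorm t (u n - x)) \<longlonglongrightarrow> sqrt (0\<^sup>2 + 0\<^sup>2 / t\<^sup>2)"
      unfolding tnorm_def using t by (intro tendsto_real_sqrt tendsto_add tendsto_divide tendsto_power tendsto_const) auto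
    then show ?thesis using uD xD by (auto simp: conv_def)
  qed
  ultimately have "hilbert s ?R (\<lambda>x y. ipx x y + ipy x y / (of_real t)\<^sup>2)"
    by (intro hilbert.intro ips.intro nvs.intro nvs_axioms.intro ips_axioms.intro hilbert_axioms.intro nR X.complex_vs_axioms)
  then show ?thesis using ip by blast
qed

text \<open>Duality on a span: the weights \<open>a + b / t^2\<close> of \<open>tnorm\<close> have
  as reciprocals the squares of \<open>kscal (1 / a) (1 / b) t\<close>, and integrating these gives,
  up to normalization, the reciprocals of the weights of \<open>fin \<theta>\<close>. Describing
  \<open>\<kappa> t\<close> and \<open>q\<close> as best constants hides the basis and allows
  comparison with the full space.\<close>

lemma fin_dual:
  assumes B: "finite B" "B \<subseteq> D" and g: "linear_on s D g"
  shows "\<exists>\<kappa>. klike \<kappa> \<and>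
    (\<forall>t>0. (\<forall>x\<in>X.span B. cmod (g x) \<le> \<kappa> t * tnorm t x) \<and>
       (\<forall>M\<ge>0. (\<forall>x\<in>X.span B. cmod (g x) \<le> M * tnorm t x) \<longrightarrow> \<kappa> t \<le> M)) \<and>
    (\<forall>\<theta>. 0 < \<theta> \<longrightarrow> \<theta> < 1 \<longrightarrow> (\<exists>q\<ge>0. wint \<theta> \<kappa> = ennreal ((q / N_const \<theta>)\<^sup>2) \<and>
       (\<forall>x\<in>X.span B. cmod (g x) \<le> q * nrm (fin \<theta> (X.span B)) x) \<and>
       (\<forall>M\<ge>0. (\<forall>x\<in>X.span B. cmod (g x) \<le> M * nrm (fin \<theta> (X.span B)) x) \<longrightarrow> q \<le> M)))"
proof -
  let ?F = "X.span B"
  obtain E c a b where E: "coord ?F E c" "E \<subseteq> ?F" "\<forall>x\<in>?F. x = (\<Sum>e\<in>E. s (c x e) e)" "\<forall>e\<in>E. a e > 0 \<and> b e > 0"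
    "diagonal ?F E c a (subsp X ?F)" "diagonal ?F E c b (subsp Y ?F)"
    using finite_diag[OF B] by blast
  have fE: "finite E" using E(1) by (simp add: coord_def)
  have ED: "E \<subseteq> D" using E(2) span_D[OF B(2)] by blast
  have pos: "a e > 0" "b e > 0" if "e \<in> E" for e using E(4) that by auto
  have sub: "X.subspace D" by (rule X.subspace_inter[OF X.sub Y.sub])
  have grep: "g x = (\<Sum>e\<in>E. c x e * g e)" if x: "x \<in> ?F" for x
    using X.linear_on_sum[OF sub g fE ED, of "c x"] E(3) x by metis
  define \<kappa> where "\<kappa> t = sqrt (\<Sum>e\<in>E. (cmod (g e))\<^sup>2 * (kscal (1 / a e) (1 / b e) t)\<^sup>2)" for t
  have kl: "klike \<kappa>"
    unfolding \<kappa>_def[abs_def] using pos by (intro klike_sqrt_sum klike_kscal) auto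
  have \<kappa>t: "\<kappa> t = sqrt (\<Sum>e\<in>E. (cmod (g e))\<^sup>2 / (a e + b e / t\<^sup>2))" if t: "t > 0" for t
  proof -
    have "(kscal (1 / a e) (1 / b e) t)\<^sup>2 = 1 / (a e + b e / t\<^sup>2)" if e: "e \<in> E" for e
    proof -
      have p: "b e + t\<^sup>2 * a e > 0" using pos[OF e] t by (simp add: add_pos_pos)
      have "1 / a e + t\<^sup>2 * (1 / b e) = (b e + t\<^sup>2 * a e) / (a e * b e)" using pos[OF e] by (simp add: field_simps)
      then have "t\<^sup>2 * (1 / a e) * (1 / b e) / (1 / a e + t\<^sup>2 * (1 / b e)) = t\<^sup>2 / (b e + t\<^sup>2 * a e)"
        using pos[OF e] by (simp add: less_imp_neq[symmetric])
      also have "\<dots> = 1 / (a e + b e / t\<^sup>2)" using t p by (simp add: field_simps)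
      finally show ?thesis using pos[OF e] t p by (simp add: kscal_def add_nonneg_nonneg)
    qed
    then show ?thesis by (auto simp: \<kappa>_def intro!: sum.cong)
  qed
  have nX: "(nrm X x)\<^sup>2 = (\<Sum>e\<in>E. a e * (cmod (c x e))\<^sup>2)" if "x \<in> ?F" for x
    using E(5) that pos(1) by (simp add: diagonal_def sum_nonneg less_imp_le)
  have nY: "(nrm Y x)\<^sup>2 = (\<Sum>e\<in>E. b e * (cmod (c x e))\<^sup>2)" if "x \<in> ?F" for x
    using E(6) that pos(2) by (simp add: diagonal_def sum_nonneg less_imp_le)
  have rt: "tnorm t x = sqrt (\<Sum>e\<in>E. (a e + b e / t\<^sup>2) * (cmod (c x e))\<^sup>2)" if "x \<in> ?F" for t x
    using that by (simp add: tnorm_def nX nY sum.distrib distrib_right sum_divide_distrib)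
  have wpos: "a e + b e / t\<^sup>2 > 0" if "e \<in> E" for e t using pos[OF that] by (intro add_pos_nonneg) auto
  have 1: "(\<forall>x\<in>?F. cmod (g x) \<le> \<kappa> t * tnorm t x) \<and> (\<forall>M\<ge>0. (\<forall>x\<in>?F. cmod (g x) \<le> M * tnorm t x) \<longrightarrow> \<kappa> t \<le> M)" if t: "t > 0" for t
    unfolding \<kappa>t[OF t]
    using diagonal_dual[of ?F E c g "tnorm t" "\<lambda>e. a e + b e / t\<^sup>2", OF E(1) grep rt wpos] by blast
  have 2: "\<exists>q\<ge>0. wint \<theta> \<kappa> = ennreal ((q / N_const \<theta>)\<^sup>2) \<and>
       (\<forall>x\<in>?F. cmod (g x) \<le> q * nrm (fin \<theta> ?F) x) \<and>
       (\<forall>M\<ge>0. (\<forall>x\<in>?F. cmod (g x) \<le> M * nrm (fin \<theta> ?F) x) \<longrightarrow> q \<le> M)" if th: "0 < \<theta>" "\<theta> < 1" for \<theta>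
  proof -
    define w where "w e = a e powr (1 - \<theta>) * b e powr \<theta>" for e
    have w: "w e > 0" if "e \<in> E" for e using pos[OF that] by (simp add: w_def)
    define Q where "Q = (\<Sum>e\<in>E. (cmod (g e))\<^sup>2 / w e)"
    have Q: "Q \<ge> 0" unfolding Q_def using w by (auto intro!: sum_nonneg divide_nonneg_pos)
    have "diagonal ?F E c w (fin \<theta> ?F)"
      unfolding w_def[abs_def] by (rule diagonal_interp[OF E(1,5,6)]) (use pos th in auto)
    then have n: "nrm (fin \<theta> ?F) x = sqrt (\<Sum>e\<in>E. w e * (cmod (c x e))\<^sup>2)" if "x \<in> ?F" for x
      using that by (simp add: diagonal_def)
    define p where "p = pi / (2 * sin (pi * \<theta>))"
    have p: "p > 0" "(N_const \<theta>)\<^sup>2 * p = 1" using sin_pi_pos[OF th] N_const_sq[OF th] by (auto simp: p_def)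
    have "wint \<theta> \<kappa> = (\<Sum>e\<in>E. ennreal ((cmod (g e))\<^sup>2) * wint \<theta> (kscal (1 / a e) (1 / b e)))"
      unfolding \<kappa>_def[abs_def] by (rule wint_sum) (use fE pos in \<open>auto intro!: klike_posmeas klike_kscal\<close>)
    also have "\<dots> = (\<Sum>e\<in>E. ennreal ((cmod (g e))\<^sup>2 / w e * p))"
    proof (intro sum.cong refl)
      fix e assume e: "e \<in> E"
      have "(1 / a e) powr (1 - \<theta>) * (1 / b e) powr \<theta> = 1 / w e"
        using pos[OF e] by (simp add: w_def powr_divide)
      then have "wint \<theta> (kscal (1 / a e) (1 / b e)) = ennreal (1 / w e * p)"
        using wint_kscal[OF _ _ th, of "1 / a e" "1 / b e"] pos[OF e] by (simp add: p_def)
      then show "ennreal ((cmod (g e))\<^sup>2) * wint \<theta> (kscal (1 / a e) (1 / b e)) = ennreal ((cmod (g e))\<^sup>2 / w e * p)"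
        using w[OF e] p by (simp add: ennreal_mult[symmetric])
    qed
    also have "\<dots> = ennreal (Q * p)"
      using p w by (subst sum_ennreal) (auto simp: Q_def sum_distrib_right less_imp_le)
    also have "Q * p = (sqrt Q / N_const \<theta>)\<^sup>2"
      using Q p N_const_pos[OF th] by (simp add: power_divide field_simps)
    finally have "wint \<theta> \<kappa> = ennreal ((sqrt Q / N_const \<theta>)\<^sup>2)" .
    moreover have "(\<forall>x\<in>?F. cmod (g x) \<le> sqrt Q * nrm (fin \<theta> ?F) x) \<and>
       (\<forall>M\<ge>0. (\<forall>x\<in>?F. cmod (g x) \<le> M * nrm (fin \<theta> ?F) x) \<longrightarrow> sqrt Q \<le> M)"
      unfolding Q_def using diagonal_dual[OF E(1) grep n w] by blast
    ultimately show ?thesis using Q by (intro exI[of _ "sqrt Q"]) auto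
  qed
  show ?thesis using kl 1 2 by blast
qed

end

section \<open>The dual pair and its K-functional\<close>

locale dpair = hpair +
  assumes dX: "dense_in (carr X \<inter> carr Y) X" and dY: "dense_in (carr X \<inter> carr Y) Y"
begin

abbreviation "Xd \<equiv> dual_on s D X"
abbreviation "Yd \<equiv> dual_on s D Y"

lemma sD: "X.subspace D" by (rule X.subspace_inter[OF X.sub Y.sub])

sublocale XD: dual_rep s X D Xd by (rule dual_rep_dual_on[OF vs hX sD dX])
sublocale YD: dual_rep s Y D Yd by (rule dual_rep_dual_on[OF vs hY sD dY])

lemma dual_consistent: "consistent Xd Yd"
  unfolding consistent_def
proof (intro allI impI ext)
  fix u f g x assume f: "conv Xd u f" and g: "conv Yd u g"
  show "f x = g x"
  proof (cases "x \<in> D")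
    case True
    show ?thesis by (rule LIMSEQ_unique[OF XD.Z_conv_pointwise[OF f True] YD.Z_conv_pointwise[OF g True]])
  next
    case False
    have "f \<in> carr Xd" "g \<in> carr Yd" using f g by (auto simp: conv_def)
    then show ?thesis using XD.Z_off[of f x] YD.Z_off[of g x] False by simp
  qed
qed

lemma dual_pair: "hilbert_compatible_pair fun_scale Xd Yd"
  by (rule hilbert_compatible_pairI[OF vector_space_fun_scale XD.Z_hilbert YD.Z_hilbert dual_consistent])

sublocale dual: hpair fun_scale Xd Yd by (rule hpair_of_compatible[OF dual_pair])

lemma Sigma_dual_fun_on: assumes "g \<in> carr dual.S" shows "fun_on s D g"
proof -
  obtain g0 g1 where *: "g0 \<in> carr Xd" "g1 \<in> carr Yd" "g0 + g1 = g" using assms unfolding Sigma_iff by blast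
  then have "fun_on s D g0" "fun_on s D g1" by (simp_all add: XD.Zc YD.Zc)
  then show ?thesis using *(3)[symmetric] unfolding fun_on_def linear_on_def by (simp add: algebra_simps)
qed

text \<open>For each splitting of \<open>g\<close>, the Cauchy-Schwarz inequality pairs the numbers
  \<open>nrm Xd g0\<close>, \<open>t * nrm Yd g1\<close> with \<open>nrm X x\<close>,
  \<open>nrm Y x / t\<close>; the infimum over splittings keeps the bound.\<close>

lemma K_dual_bound:
  assumes g: "g \<in> carr dual.S" and t: "t > 0" and x: "x \<in> D"
  shows "cmod (g x) \<le> dual.K t g * tnorm t x"
proof (cases "tnorm t x = 0")
  case True
  then have "nrm X x \<le> 0" using tnorm_ge(1)[OF x, of t] by simp
  then have "x = 0" using X.nrm_eq0[of x] X.nrm_ge0[of x] x by simp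
  then have "g x = 0" using X.linear_on_zero[OF sD] Sigma_dual_fun_on[OF g] by (simp add: fun_on_def)
  then show ?thesis using True by simp
next
  case False
  then have r: "tnorm t x > 0" by (simp add: tnorm_def less_le)
  have "cmod (g x) / tnorm t x \<le> dual.K t g"
  proof (rule K_greatest[OF g])
    fix g0 g1 assume g01: "g0 \<in> carr Xd" "g1 \<in> carr Yd" "g0 + g1 = g"
    let ?a = "nrm Xd g0" and ?b = "nrm Yd g1"
    have "cmod (g x) \<le> cmod (g0 x) + cmod (g1 x)" using norm_triangle_ineq[of "g0 x" "g1 x"] g01(3) by auto
    also have "\<dots> \<le> ?a * nrm X x + (t * ?b) * (nrm Y x / t)"
      using XD.Zb[OF g01(1) x] YD.Zb[OF g01(2) x] t by simp
    also have "\<dots> \<le> sqrt (?a\<^sup>2 + t\<^sup>2 * ?b\<^sup>2) * tnorm t x"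
      using cauchy_schwarz_2[of ?a "nrm X x" "t * ?b" "nrm Y x / t"]
      unfolding tnorm_def power_mult_distrib power_divide .
    finally show "cmod (g x) / tnorm t x \<le> sqrt (?a\<^sup>2 + t\<^sup>2 * ?b\<^sup>2)" using r by (simp add: pos_divide_le_eq)
  qed
  then show ?thesis using r by (simp add: pos_divide_le_eq)
qed

text \<open>The Riesz representative \<open>e\<close> in \<open>D\<close> splits \<open>g\<close> into its \<open>X\<close>- and \<open>Y\<close>-inner product parts.\<close>
lemma K_dual_le:
  assumes g: "fun_on s D g" and t: "t > 0" and M: "M \<ge> 0" "\<And>x. x \<in> D \<Longrightarrow> cmod (g x) \<le> M * tnorm t x"
  shows "g \<in> carr dual.S" "dual.K t g \<le> M"
proof -
  let ?R = "\<lparr>carr = D, nrm = tnorm t\<rparr>"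
  obtain ipx ipy where H: "hilbert s ?R (\<lambda>x y. ipx x y + ipy x y / (of_real t)\<^sup>2)"
    and ip: "inner_on s X ipx" "inner_on s Y ipy" using tnorm_hilbert[OF t] by blast
  interpret ix: ips s X ipx by (intro ips.intro ips_axioms.intro X.nvs_axioms ip)
  interpret iy: ips s Y ipy by (intro ips.intro ips_axioms.intro Y.nvs_axioms ip)
  have lin: "linear_on s D g" using g by (simp add: fun_on_def)
  obtain e where e: "e \<in> D" "\<And>x. x \<in> D \<Longrightarrow> g x = ipx x e + ipy x e / (of_real t)\<^sup>2" "tnorm t e \<le> M"
    using hilbert.riesz_on_subspace[OF H sD _ lin M(1)] M(2) by auto
  define g0 where "g0 x = (if x \<in> D then ipx x e else 0)" for x
  define g1 where "g1 x = (if x \<in> D then ipy x e / (of_real t)\<^sup>2 else 0)" for x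
  have cl: "x + y \<in> D" "s c x \<in> D" if "x \<in> D" "y \<in> D" for x y c
    using that by auto
  have f0: "fun_on s D g0" using e(1) cl
    by (auto simp: fun_on_def linear_on_def g0_def ix.ip_add_left ix.ip_scale_left)
  have f1: "fun_on s D g1" using e(1) cl
    by (auto simp: fun_on_def linear_on_def g1_def iy.ip_add_left iy.ip_scale_left add_divide_distrib)
  have b0: "cmod (g0 x) \<le> nrm X e * nrm X x" if "x \<in> D" for x
    using ix.cauchy_schwarz[of x e] e(1) that by (simp add: g0_def mult.commute)
  have b1: "cmod (g1 x) \<le> (nrm Y e / t\<^sup>2) * nrm Y x" if "x \<in> D" for x
  proof -
    have "cmod (g1 x) = cmod (ipy x e) / t\<^sup>2" using that by (simp add: g1_def norm_divide norm_power)
    also have "\<dots> \<le> (nrm Y x * nrm Y e) / t\<^sup>2" using iy.cauchy_schwarz[of x e] e(1) that by (intro divide_right_mono) auto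
    finally show ?thesis by (simp add: mult.commute)
  qed
  have c0: "g0 \<in> carr Xd" using XD.Z_bounded_in[OF f0 b0] .
  have c1: "g1 \<in> carr Yd" using YD.Z_bounded_in[OF f1 b1] .
  have n0: "nrm Xd g0 \<le> nrm X e" using XD.Zl[OF c0 _ b0] X.nrm_ge0[of e] e(1) by auto
  have n1: "nrm Yd g1 \<le> nrm Y e / t\<^sup>2" using YD.Zl[OF c1 _ b1] Y.nrm_ge0[of e] e(1) by auto
  have sum: "g0 + g1 = g"
  proof
    fix x show "(g0 + g1) x = g x" using e(2)[of x] g by (simp add: g0_def g1_def fun_on_def)
  qed
  show "g \<in> carr dual.S" unfolding Sigma_iff using c0 c1 sum by blast
  have "dual.K t g \<le> sqrt ((nrm Xd g0)\<^sup>2 + t\<^sup>2 * (nrm Yd g1)\<^sup>2)" by (rule K_lower[OF c0 c1 sum])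
  also have "\<dots> \<le> sqrt ((nrm X e)\<^sup>2 + t\<^sup>2 * (nrm Y e / t\<^sup>2)\<^sup>2)"
    using n0 n1 XD.Z0[OF c0] YD.Z0[OF c1]
    by (intro real_sqrt_le_mono add_mono mult_left_mono power_mono) auto
  also have "t\<^sup>2 * (nrm Y e / t\<^sup>2)\<^sup>2 = (nrm Y e)\<^sup>2 / t\<^sup>2" using t by (simp add: power2_eq_square)
  also have "sqrt ((nrm X e)\<^sup>2 + (nrm Y e)\<^sup>2 / t\<^sup>2) = tnorm t e" by (simp add: tnorm_def)
  finally show "dual.K t g \<le> M" using e(3) by simp
qed

text \<open>In \<open>A\<close> the best constant \<open>b\<close> for \<open>J \<theta>\<close>
  bounds the integrals on all spans, and Fatou's lemma transfers the bound to \<open>dual.K\<close>.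
  In \<open>Bd\<close> the functions of the spans lie below \<open>dual.K\<close>, so
  \<open>b\<close> is an admissible constant on every span, and \<open>fin_approx\<close> passes
  from span norms to the norm of \<open>J \<theta>\<close>.\<close>

theorem duality:
  assumes th: "0 < \<theta>" "\<theta> < 1"
  shows "space_eq (dual_on s D (J \<theta>)) (dual.J \<theta>)"
proof -
  have thI: "\<theta> \<in> {0..1}" using th by simp
  interpret JD: dual_rep s "J \<theta>" D "dual_on s D (J \<theta>)"
    by (rule dual_rep_dual_on[OF vs J_hilbert[OF thI] sD Delta_dense_J[OF th]])
  have Jd: "dual.J \<theta> = dual.KS \<theta>" using th by (simp add: interp_def)
  have A: "g \<in> carr (dual.J \<theta>) \<and> nrm (dual.J \<theta>) g \<le> nrm (dual_on s D (J \<theta>)) g"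
    if g: "g \<in> carr (dual_on s D (J \<theta>))" for g
  proof -
    define b where "b = nrm (dual_on s D (J \<theta>)) g"
    have b: "b \<ge> 0" "\<And>x. x \<in> D \<Longrightarrow> cmod (g x) \<le> b * nrm (J \<theta>) x"
      using JD.Z0[OF g] JD.Zb[OF g] by (auto simp: b_def)
    have gf: "fun_on s D g" using g by (simp add: JD.Zc)
    then have lin: "linear_on s D g" by (simp add: fun_on_def)
    \<comment> \<open>Membership in the sum of the duals needs a bound at a single \<open>t\<close>
      only. At \<open>t = 1\<close>, \<open>tnorm\<close> dominates both norms, and
      \<open>J_Delta\<close> applies.\<close>
    have "cmod (g x) \<le> (b * sqrt 2) * tnorm 1 x" if x: "x \<in> D" for x
    proof -
      have "nrm (J \<theta>) x \<le> sqrt 2 * tnorm 1 x" using tnorm_ge[OF x, of 1] x by (intro J_Delta(2)[OF thI]) auto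
      then have "b * nrm (J \<theta>) x \<le> b * (sqrt 2 * tnorm 1 x)" using b(1) by (rule mult_left_mono)
      then show ?thesis using b(2)[OF x] by simp
    qed
    then have gS: "g \<in> carr dual.S" using K_dual_le(1)[OF gf, of 1 "b * sqrt 2"] b(1) by simp
    \<comment> \<open>\<open>fin_dual\<close> gives a function for each span separately; a choice
      over all finite \<open>B\<close> is made before \<open>klike_selection\<close> can pick a
      sequence of spans.\<close>
    have "\<exists>\<kappa>. \<forall>B. finite B \<and> B \<subseteq> D \<longrightarrow> klike (\<kappa> B) \<and>
        (\<forall>t>0. (\<forall>x\<in>X.span B. cmod (g x) \<le> \<kappa> B t * tnorm t x) \<and>
           (\<forall>M\<ge>0. (\<forall>x\<in>X.span B. cmod (g x) \<le> M * tnorm t x) \<longrightarrow> \<kappa> B t \<le> M)) \<and>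
        wint \<theta> (\<kappa> B) \<le> ennreal ((b / N_const \<theta>)\<^sup>2)"
    proof (rule choice, intro allI)
      fix B
      show "\<exists>\<kappa>. finite B \<and> B \<subseteq> D \<longrightarrow> klike \<kappa> \<and>
        (\<forall>t>0. (\<forall>x\<in>X.span B. cmod (g x) \<le> \<kappa> t * tnorm t x) \<and>
           (\<forall>M\<ge>0. (\<forall>x\<in>X.span B. cmod (g x) \<le> M * tnorm t x) \<longrightarrow> \<kappa> t \<le> M)) \<and>
        wint \<theta> \<kappa> \<le> ennreal ((b / N_const \<theta>)\<^sup>2)"
      proof (cases "finite B \<and> B \<subseteq> D")
        case True
        then have B: "finite B" "B \<subseteq> D" by auto
        obtain \<kappa> where \<kappa>: "klike \<kappa>"
          "\<forall>t>0. (\<forall>x\<in>X.span B. cmod (g x) \<le> \<kappa> t * tnorm t x) \<and>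
           (\<forall>M\<ge>0. (\<forall>x\<in>X.span B. cmod (g x) \<le> M * tnorm t x) \<longrightarrow> \<kappa> t \<le> M)"
          "\<exists>q\<ge>0. wint \<theta> \<kappa> = ennreal ((q / N_const \<theta>)\<^sup>2) \<and>
           (\<forall>x\<in>X.span B. cmod (g x) \<le> q * nrm (fin \<theta> (X.span B)) x) \<and>
           (\<forall>M\<ge>0. (\<forall>x\<in>X.span B. cmod (g x) \<le> M * nrm (fin \<theta> (X.span B)) x) \<longrightarrow> q \<le> M)"
          using fin_dual[OF B lin] th by blast
        obtain q where q: "q \<ge> 0" "wint \<theta> \<kappa> = ennreal ((q / N_const \<theta>)\<^sup>2)"
          "\<And>M. M \<ge> 0 \<Longrightarrow> (\<forall>x\<in>X.span B. cmod (g x) \<le> M * nrm (fin \<theta> (X.span B)) x) \<Longrightarrow> q \<le> M"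
          using \<kappa>(3) by blast
        have "cmod (g x) \<le> b * nrm (fin \<theta> (X.span B)) x" if x: "x \<in> X.span B" for x
        proof -
          have "x \<in> D" using span_D[OF B(2)] x by blast
          moreover have "b * nrm (J \<theta>) x \<le> b * nrm (fin \<theta> (X.span B)) x"
            using J_le_fin[OF B thI x] b(1) by (rule mult_left_mono)
          ultimately show ?thesis using b(2)[of x] by simp
        qed
        then have "q \<le> b" using q(3)[OF b(1)] by blast
        then have "wint \<theta> \<kappa> \<le> ennreal ((b / N_const \<theta>)\<^sup>2)"
          unfolding q(2) using q(1) N_const_pos[OF th] by (intro ennreal_leI power_mono divide_right_mono) auto
        then show ?thesis using \<kappa>(1,2) by blast
      qed blast
    qed
    then obtain \<kappa> where *: "\<forall>B. finite B \<and> B \<subseteq> D \<longrightarrow> klike (\<kappa> B) \<and>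
        (\<forall>t>0. (\<forall>x\<in>X.span B. cmod (g x) \<le> \<kappa> B t * tnorm t x) \<and>
           (\<forall>M\<ge>0. (\<forall>x\<in>X.span B. cmod (g x) \<le> M * tnorm t x) \<longrightarrow> \<kappa> B t \<le> M)) \<and>
        wint \<theta> (\<kappa> B) \<le> ennreal ((b / N_const \<theta>)\<^sup>2)" ..
    have \<kappa>: "\<And>B. finite B \<Longrightarrow> B \<subseteq> D \<Longrightarrow> klike (\<kappa> B)"
      "\<And>B t x. finite B \<Longrightarrow> B \<subseteq> D \<Longrightarrow> t > 0 \<Longrightarrow> x \<in> X.span B \<Longrightarrow> cmod (g x) \<le> \<kappa> B t * tnorm t x"
      "\<And>B t M. finite B \<Longrightarrow> B \<subseteq> D \<Longrightarrow> t > 0 \<Longrightarrow> M \<ge> 0 \<Longrightarrow> (\<forall>x\<in>X.span B. cmod (g x) \<le> M * tnorm t x) \<Longrightarrow> \<kappa> B t \<le> M"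
      "\<And>B. finite B \<Longrightarrow> B \<subseteq> D \<Longrightarrow> wint \<theta> (\<kappa> B) \<le> ennreal ((b / N_const \<theta>)\<^sup>2)"
      using * by blast+
    have "\<exists>B. (\<forall>n. finite (B n) \<and> B n \<subseteq> D) \<and> (\<forall>t>0. (\<lambda>n. \<kappa> (B n) t) \<longlonglongrightarrow> dual.K t g)"
    proof (rule klike_selection[OF K_klike[OF gS] \<kappa>(1)])
      fix t e :: real assume t: "t > 0" and e: "e > 0"
      have K0: "0 \<le> dual.K t g" by (rule K_ge0[OF gS])
      \<comment> \<open>By \<open>K_dual_le\<close>, a vector must witness that
        \<open>dual.K t g - e\<close> is too small a constant. The second alternative covers a
        negative \<open>dual.K t g - e\<close>, where nonnegativity of \<open>\<kappa>\<close>
        already suffices.\<close>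
      have "\<exists>x\<in>D. cmod (g x) > (dual.K t g - e) * tnorm t x \<or> dual.K t g < e"
      proof (rule ccontr)
        assume no: "\<not> ?thesis"
        then have nn: "dual.K t g - e \<ge> 0" using X.subspace_0[OF sD] by force
        have "cmod (g x) \<le> (dual.K t g - e) * tnorm t x" if "x \<in> D" for x using no that by force
        then have "dual.K t g \<le> dual.K t g - e" using K_dual_le(2)[OF gf t nn] by blast
        then show False using e by simp
      qed
      then obtain x where x: "x \<in> D" "cmod (g x) > (dual.K t g - e) * tnorm t x \<or> dual.K t g < e" by blast
      have "\<bar>\<kappa> B' t - dual.K t g\<bar> < e" if B': "finite B'" "{x} \<subseteq> B'" "B' \<subseteq> D" for B'
      proof -
        have up: "\<kappa> B' t \<le> dual.K t g"
          using K_dual_bound[OF gS t] span_D[OF B'(3)] by (intro \<kappa>(3)[OF B'(1,3) t K0]) blast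
        have "cmod (g x) \<le> \<kappa> B' t * tnorm t x" using \<kappa>(2)[OF B'(1,3) t] X.span_base B'(2) by blast
        moreover have "tnorm t x \<ge> 0" by (simp add: tnorm_def)
        moreover have "0 \<le> \<kappa> B' t" using klikeD(1)[OF \<kappa>(1)[OF B'(1,3)] t] .
        ultimately have "dual.K t g - e < \<kappa> B' t"
          using x(2) mult_right_mono[of "\<kappa> B' t" "dual.K t g - e" "tnorm t x"] by fastforce
        then show ?thesis using up e by simp
      qed
      then show "\<exists>B. finite B \<and> B \<subseteq> D \<and> (\<forall>B'. finite B' \<longrightarrow> B \<subseteq> B' \<longrightarrow> B' \<subseteq> D \<longrightarrow> \<bar>\<kappa> B' t - dual.K t g\<bar> < e)"
        using x(1) by (intro exI[of _ "{x}"]) auto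
    qed
    then obtain B where B: "\<And>n. finite (B n)" "\<And>n. B n \<subseteq> D" "\<And>t. t > 0 \<Longrightarrow> (\<lambda>n. \<kappa> (B n) t) \<longlonglongrightarrow> dual.K t g"
      by blast
    have "dual.W \<theta> g \<le> ennreal ((b / N_const \<theta>)\<^sup>2)"
      by (rule wint_fatou[OF klike_posmeas[OF \<kappa>(1)[OF B(1,2)]] \<kappa>(4)[OF B(1,2)] B(3)])
    then show ?thesis using dual.KS_le[OF th gS _ b(1)] unfolding Jd b_def by blast
  qed
  have Bd: "g \<in> carr (dual_on s D (J \<theta>)) \<and> nrm (dual_on s D (J \<theta>)) g \<le> nrm (dual.J \<theta>) g"
    if g: "g \<in> carr (dual.J \<theta>)" for g
  proof -
    define b where "b = nrm (dual.J \<theta>) g"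
    have b: "b \<ge> 0" unfolding b_def by (rule dual.J_ge0[OF thI g])
    have gS: "g \<in> carr dual.S" by (rule dual.J_S[OF thI g])
    have gf: "fun_on s D g" by (rule Sigma_dual_fun_on[OF gS])
    then have lin: "linear_on s D g" by (simp add: fun_on_def)
    have W: "dual.W \<theta> g = ennreal ((b / N_const \<theta>)\<^sup>2)"
      using dual.W_eq[OF th] g unfolding b_def Jd by blast
    have bound: "cmod (g x) \<le> b * nrm (J \<theta>) x" if x: "x \<in> D" for x
    proof (rule field_le_epsilon)
      fix e :: real assume e: "e > 0"
      define d where "d = e / (b + 1)"
      have d: "d > 0" using e b by (simp add: d_def)
      obtain B where B: "finite B" "B \<subseteq> D" "x \<in> B" "nrm (fin \<theta> (X.span B)) x < nrm (J \<theta>) x + d"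
        using fin_approx[OF x thI d] by blast
      obtain \<kappa> where \<kappa>: "klike \<kappa>"
        "\<forall>t>0. (\<forall>x\<in>X.span B. cmod (g x) \<le> \<kappa> t * tnorm t x) \<and>
           (\<forall>M\<ge>0. (\<forall>x\<in>X.span B. cmod (g x) \<le> M * tnorm t x) \<longrightarrow> \<kappa> t \<le> M)"
        "\<exists>q\<ge>0. wint \<theta> \<kappa> = ennreal ((q / N_const \<theta>)\<^sup>2) \<and>
           (\<forall>x\<in>X.span B. cmod (g x) \<le> q * nrm (fin \<theta> (X.span B)) x) \<and>
           (\<forall>M\<ge>0. (\<forall>x\<in>X.span B. cmod (g x) \<le> M * nrm (fin \<theta> (X.span B)) x) \<longrightarrow> q \<le> M)"
        using fin_dual[OF B(1,2) lin] th by blast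
      obtain q where q: "q \<ge> 0" "wint \<theta> \<kappa> = ennreal ((q / N_const \<theta>)\<^sup>2)"
          "\<And>x. x \<in> X.span B \<Longrightarrow> cmod (g x) \<le> q * nrm (fin \<theta> (X.span B)) x"
        using \<kappa>(3) by blast
      have "wint \<theta> \<kappa> \<le> dual.W \<theta> g"
      proof (rule wint_mono)
        fix t :: real assume t: "t > 0"
        have "\<forall>x\<in>X.span B. cmod (g x) \<le> dual.K t g * tnorm t x"
          using K_dual_bound[OF gS t] span_D[OF B(2)] by blast
        then have "\<kappa> t \<le> dual.K t g" using \<kappa>(2) t K_ge0[OF gS, of t] by blast
        then show "\<bar>\<kappa> t\<bar> \<le> \<bar>dual.K t g\<bar>" using klikeD(1)[OF \<kappa>(1) t] by simp
      qed
      then have "(q / N_const \<theta>)\<^sup>2 \<le> (b / N_const \<theta>)\<^sup>2" unfolding q(2) W by (subst (asm) ennreal_le_iff) auto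
      then have "q / N_const \<theta> \<le> b / N_const \<theta>" by (rule power2_le_imp_le) (use b N_const_pos[OF th] in simp)
      then have qb: "q \<le> b" using N_const_pos[OF th] by (simp add: divide_le_cancel)
      have n0: "0 \<le> nrm (fin \<theta> (X.span B)) x"
        using J_le_fin[OF B(1,2) thI X.span_base[OF B(3)]] J_ge0[OF thI D_J[OF thI x]] by simp
      have "cmod (g x) \<le> q * nrm (fin \<theta> (X.span B)) x" using q(3)[OF X.span_base[OF B(3)]] .
      also have "\<dots> \<le> b * (nrm (J \<theta>) x + d)" using qb B(4) b n0 by (intro mult_mono) auto
      also have "\<dots> \<le> b * nrm (J \<theta>) x + e"
      proof -
        have "b * d \<le> (b + 1) * d" using d by simp
        also have "\<dots> = e" using b by (simp add: d_def)
        finally show ?thesis by (simp add: distrib_left)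
      qed
      finally show "cmod (g x) \<le> b * nrm (J \<theta>) x + e" .
    qed
    have gd: "g \<in> carr (dual_on s D (J \<theta>))" using JD.Z_bounded_in[OF gf bound] .
    then show ?thesis using JD.Zl[OF gd b bound] by (simp add: b_def)
  qed
  show ?thesis unfolding space_eq_def using A Bd by (auto intro: antisym)
qed

end

theorem theorem3p7:
  fixes s :: "complex \<Rightarrow> 'v::ab_group_add \<Rightarrow> 'v"
    and H0 H1 :: "'v nspace"
  assumes "hilbert_compatible_pair s H0 H1"
  shows
    "(\<forall>\<theta>0\<in>{0..1}. \<forall>\<theta>1\<in>{0..1}. \<forall>\<eta>\<in>{0<..<1}.
        hilbert_compatible_pair s (interp H0 H1 \<theta>0) (interp H0 H1 \<theta>1) \<and>
        space_eq (interp (interp H0 H1 \<theta>0) (interp H0 H1 \<theta>1) \<eta>)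
                 (interp H0 H1 ((1 - \<eta>) * \<theta>0 + \<eta> * \<theta>1)))
     \<and>
     (let D = carr (Delta_space H0 H1) in
      dense_in D H0 \<and> dense_in D H1 \<longrightarrow>
        hilbert_compatible_pair fun_scale (dual_on s D H0) (dual_on s D H1) \<and>
        (\<forall>\<theta>\<in>{0<..<1}.
           dense_in D (interp H0 H1 \<theta>) \<and>
           space_eq (dual_on s D (interp H0 H1 \<theta>))
                    (interp (dual_on s D H0) (dual_on s D H1) \<theta>)))"
proof -
  interpret H: hpair s H0 H1 by (rule hpair_of_compatible[OF assms])
  have D: "carr (Delta_space H0 H1) = carr H0 \<inter> carr H1" by (simp add: Delta_space_def)
  show ?thesis
    unfolding Let_def D
  proof (intro conjI ballI impI)
    fix \<theta>0 \<theta>1 \<eta> :: real assume "\<theta>0 \<in> {0..1}" "\<theta>1 \<in> {0..1}" "\<eta> \<in> {0<..<1}"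
    then show "hilbert_compatible_pair s (interp H0 H1 \<theta>0) (interp H0 H1 \<theta>1)"
      "space_eq (interp (interp H0 H1 \<theta>0) (interp H0 H1 \<theta>1) \<eta>) (interp H0 H1 ((1 - \<eta>) * \<theta>0 + \<eta> * \<theta>1))"
      by (auto intro: H.J_pair H.reiteration)
  next
    assume "dense_in (carr H0 \<inter> carr H1) H0 \<and> dense_in (carr H0 \<inter> carr H1) H1"
    then interpret d: dpair s H0 H1 by unfold_locales auto
    show "hilbert_compatible_pair fun_scale (dual_on s (carr H0 \<inter> carr H1) H0) (dual_on s (carr H0 \<inter> carr H1) H1)"
      by (rule d.dual_pair)
    fix \<theta> :: real assume "\<theta> \<in> {0<..<1}"
    then have th: "0 < \<theta>" "\<theta> < 1" by auto
    show "dense_in (carr H0 \<inter> carr H1) (interp H0 H1 \<theta>)" by (rule H.Delta_dense_J[OF th])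
    show "space_eq (dual_on s (carr H0 \<inter> carr H1) (interp H0 H1 \<theta>))
       (interp (dual_on s (carr H0 \<inter> carr H1) H0) (dual_on s (carr H0 \<inter> carr H1) H1) \<theta>)"
      by (rule d.duality[OF th])
  qed
qed

end
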